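(* Let $(\omega_1,\omega_2)$ be a Cartan structure on a closed, oriented $3$-manifold $M$, let $\alpha$ be the associated $1$-form, uniquely determined by $\mathrm{d}\omega_1=\omega_2\wedge\alpha$ and $\mathrm{d}\omega_2=\alpha\wedge\omega_1$, and let $X$ be the vector field defined by $X\in\ker\omega_1\cap\ker\omega_2$ and $\alpha(X)=1$. Then $\mathrm{vol}_X$ equals the negative of the Bott invariant of any transversely holomorphic structure on the foliation $\langle X\rangle$ by flow lines of $X$.
   Context: A Cartan structure on a closed, oriented $3$-manifold $M$ is a pair of contact forms $(\omega_1,\omega_2)$ with $$\omega_1\wedge\mathrm{d}\omega_1=\omega_2\wedge\mathrm{d}\omega_2\neq0\ \text{(nowhere zero)},\qquad \omega_1\wedge\mathrm{d}\omega_2=\omega_2\wedge\mathrm{d}\omega_1=0.$$ For such a pair there is a unique, nowhere vanishing $1$-form $\alpha$ with $\mathrm{d}\omega_1=\omega_2\wedge\alpha$, $\mathrm{d}\omega_2=\alpha\wedge\omega_1$; it is nonzero on $\ker\omega_1\cap\ker\omega_2$, and the vector field $X$ defined in the claim satisfies $i_X\mathrm{d}\alpha=0$. The volume of $X$ is $\mathrm{vol}_X:=\int_M\beta\wedge\mathrm{d}\beta$ for any $1$-form $\beta$ with $\beta(X)=1$ and $i_X\mathrm{d}\beta=0$ (independent of the choice). A transversely holomorphic structure on $\langle X\rangle$ is described by a complex-valued $1$-form $\omega_{\mathrm{c}}$ on $M$ whose real and imaginary parts are pointwise linearly independent with common kernel spanned by $X$, and which is formally integrable, i.e. $\omega_{\mathrm{c}}\wedge\mathrm{d}\omega_{\mathrm{c}}=0$.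 Formal integrability implies the existence of a (not unique) complex-valued $1$-form $\alpha_{\mathrm{c}}$ with $\mathrm{d}\omega_{\mathrm{c}}=\alpha_{\mathrm{c}}\wedge\omega_{\mathrm{c}}$. The Bott invariant of the transversely holomorphic structure is the complex number $\int_M\alpha_{\mathrm{c}}\wedge\mathrm{d}\alpha_{\mathrm{c}}$; it does not depend on the choice of $\omega_{\mathrm{c}}$ (describing the given structure) and $\alpha_{\mathrm{c}}$. *)

theory Defs
  imports "HOL-Analysis.Analysis"
begin

section \<open>Smooth maps between open subsets of normed spaces\<close>

text \<open>The recursion characterises \<open>C\<^sup>n\<close> maps when \<open>S\<close> is open and the domain is finite-dimensional;
  this is the only situation in which it is used.\<close>

primrec C_diff_on :: "nat \<Rightarrow> 'a::real_normed_vector set \<Rightarrow> ('a \<Rightarrow> 'b::real_normed_vector) \<Rightarrow> bool"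
where
  "C_diff_on 0 S f \<longleftrightarrow> continuous_on S f"
| "C_diff_on (Suc n) S f \<longleftrightarrow>
     (\<forall>x\<in>S. f differentiable (at x)) \<and>
     (\<forall>v. C_diff_on n S (\<lambda>x. frechet_derivative f (at x) v))"

definition smooth_on :: "'a::real_normed_vector set \<Rightarrow> ('a \<Rightarrow> 'b::real_normed_vector) \<Rightarrow> bool"
  where "smooth_on S f \<longleftrightarrow> (\<forall>n. C_diff_on n S f)"

section \<open>Closed oriented 3-manifolds\<close>

text \<open>A chart is a pair \<open>(U, \<phi>)\<close>; the values of \<open>\<phi>\<close> outside \<open>U\<close> are irrelevant.\<close>

type_synonym 'a chart = "'a set \<times> ('a \<Rightarrow> real^3)"

abbreviation chart_dom :: "'a chart \<Rightarrow> 'a set" where "chart_dom c \<equiv> fst c"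
abbreviation chart_map :: "'a chart \<Rightarrow> 'a \<Rightarrow> real^3" where "chart_map c \<equiv> snd c"

definition chart_img :: "'a chart \<Rightarrow> (real^3) set"
  where "chart_img c = chart_map c ` chart_dom c"

definition chart_inv :: "'a chart \<Rightarrow> real^3 \<Rightarrow> 'a"
  where "chart_inv c = inv_into (chart_dom c) (chart_map c)"

definition chart_overlap :: "'a chart \<Rightarrow> 'a chart \<Rightarrow> (real^3) set"
  where "chart_overlap c c' = chart_map c ` (chart_dom c \<inter> chart_dom c')"

definition transition :: "'a chart \<Rightarrow> 'a chart \<Rightarrow> real^3 \<Rightarrow> real^3"
  where "transition c c' = chart_map c' \<circ> chart_inv c"

definition is_chart :: "'a topology \<Rightarrow> 'a chart \<Rightarrow> bool" where
  "is_chart M c \<longleftrightarrow>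
     openin M (chart_dom c) \<and> open (chart_img c) \<and>
     homeomorphic_map (subtopology M (chart_dom c)) (top_of_set (chart_img c)) (chart_map c)"

text \<open>The atlas need not be maximal: a smooth oriented structure is given by any of its atlases.\<close>

definition oriented_atlas :: "'a topology \<Rightarrow> 'a chart set \<Rightarrow> bool" where
  "oriented_atlas M \<A> \<longleftrightarrow>
     (\<forall>c\<in>\<A>. is_chart M c) \<and>
     \<Union>(chart_dom ` \<A>) = topspace M \<and>
     (\<forall>c\<in>\<A>. \<forall>c'\<in>\<A>.
        smooth_on (chart_overlap c c') (transition c c') \<and>
        (\<forall>x\<in>chart_overlap c c'.
           det (matrix (frechet_derivative (transition c c') (at x))) > 0))"

text \<open>Second countability is automatic: a compact space with such an atlas is covered by
  finitely many charts. Connectedness is not required.\<close>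

definition closed_oriented_3manifold :: "'a topology \<Rightarrow> 'a chart set \<Rightarrow> bool" where
  "closed_oriented_3manifold M \<A> \<longleftrightarrow>
     compact_space M \<and> Hausdorff_space M \<and> oriented_atlas M \<A>"

section \<open>Vector fields and differential forms\<close>

text \<open>Tensor fields are given by their local representatives: a vector field \<open>X\<close> (a 1-form \<open>\<omega>\<close>)
  has, for each chart \<open>c\<close> of the atlas and each \<open>x\<close> in the image of \<open>c\<close>, a value \<open>X c x\<close>
  in \<open>\<real>\<^sup>3\<close> (a linear form \<open>\<omega> c x\<close> on \<open>\<real>\<^sup>3\<close>), smooth in \<open>x\<close>, and the representatives are related by
  the transition maps. Only the values at \<open>c\<close> in the atlas and \<open>x\<close> in the image of \<open>c\<close> matter,
  so identities between tensor fields are stated with \<open>field_eq\<close> rather than \<open>=\<close>.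
  The coefficients of forms are real or complex; linearity is over the reals in both cases.\<close>

type_synonym 'a vfield = "'a chart \<Rightarrow> real^3 \<Rightarrow> real^3"
type_synonym ('a, 'b) form1 = "'a chart \<Rightarrow> real^3 \<Rightarrow> real^3 \<Rightarrow> 'b"
type_synonym ('a, 'b) form2 = "'a chart \<Rightarrow> real^3 \<Rightarrow> real^3 \<Rightarrow> real^3 \<Rightarrow> 'b"
type_synonym ('a, 'b) form3 = "'a chart \<Rightarrow> real^3 \<Rightarrow> real^3 \<Rightarrow> real^3 \<Rightarrow> real^3 \<Rightarrow> 'b"

definition field_eq :: "'a chart set \<Rightarrow> ('a chart \<Rightarrow> real^3 \<Rightarrow> 'c) \<Rightarrow> ('a chart \<Rightarrow> real^3 \<Rightarrow> 'c) \<Rightarrow> bool"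
  where "field_eq \<A> S T \<longleftrightarrow> (\<forall>c\<in>\<A>. \<forall>x\<in>chart_img c. S c x = T c x)"

definition vector_field :: "'a chart set \<Rightarrow> 'a vfield \<Rightarrow> bool" where
  "vector_field \<A> X \<longleftrightarrow>
     (\<forall>c\<in>\<A>. smooth_on (chart_img c) (X c)) \<and>
     (\<forall>c\<in>\<A>. \<forall>c'\<in>\<A>. \<forall>x\<in>chart_overlap c c'.
        X c' (transition c c' x) = frechet_derivative (transition c c') (at x) (X c x))"

definition one_form :: "'a chart set \<Rightarrow> ('a, 'b::real_normed_field) form1 \<Rightarrow> bool" where
  "one_form \<A> \<omega> \<longleftrightarrow>
     (\<forall>c\<in>\<A>. (\<forall>x\<in>chart_img c. linear (\<omega> c x)) \<and>
             (\<forall>v. smooth_on (chart_img c) (\<lambda>x. \<omega> c x v))) \<and>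
     (\<forall>c\<in>\<A>. \<forall>c'\<in>\<A>. \<forall>x\<in>chart_overlap c c'. \<forall>v.
        \<omega> c' (transition c c' x) (frechet_derivative (transition c c') (at x) v) = \<omega> c x v)"

text \<open>Conventions: no factors \<open>1/k!\<close>, i.e. \<open>(dx \<and> dy \<and> dz)(e\<^sub>1, e\<^sub>2, e\<^sub>3) = 1\<close> and
  \<open>d\<omega>(X, Y) = X(\<omega>(Y)) - Y(\<omega>(X)) - \<omega>([X, Y])\<close>; in a chart the last term vanishes for the
  constant fields \<open>u\<close>, \<open>v\<close>.\<close>

definition wedge11 ::
  "('a, 'b::real_normed_field) form1 \<Rightarrow> ('a, 'b) form1 \<Rightarrow> ('a, 'b) form2" where
  "wedge11 \<alpha> \<beta> = (\<lambda>c x u v. \<alpha> c x u * \<beta> c x v - \<alpha> c x v * \<beta> c x u)"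

definition wedge12 ::
  "('a, 'b::real_normed_field) form1 \<Rightarrow> ('a, 'b) form2 \<Rightarrow> ('a, 'b) form3" where
  "wedge12 \<alpha> \<sigma> = (\<lambda>c x u v w.
     \<alpha> c x u * \<sigma> c x v w + \<alpha> c x v * \<sigma> c x w u + \<alpha> c x w * \<sigma> c x u v)"

definition ext_d :: "('a, 'b::real_normed_field) form1 \<Rightarrow> ('a, 'b) form2" where
  "ext_d \<omega> = (\<lambda>c x u v. frechet_derivative (\<lambda>y. \<omega> c y v) (at x) u
                       - frechet_derivative (\<lambda>y. \<omega> c y u) (at x) v)"

definition pair1 :: "('a, 'b) form1 \<Rightarrow> 'a vfield \<Rightarrow> 'a chart \<Rightarrow> real^3 \<Rightarrow> 'b"
  where "pair1 \<omega> X = (\<lambda>c x. \<omega> c x (X c x))"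

definition interior_prod :: "'a vfield \<Rightarrow> ('a, 'b) form2 \<Rightarrow> ('a, 'b) form1"
  where "interior_prod X \<sigma> = (\<lambda>c x v. \<sigma> c x (X c x) v)"

abbreviation zero1 :: "('a, 'b::zero) form1" where "zero1 \<equiv> \<lambda>c x u. 0"
abbreviation zero3 :: "('a, 'b::zero) form3" where "zero3 \<equiv> \<lambda>c x u v w. 0"

definition nowhere_zero3 :: "'a chart set \<Rightarrow> ('a, 'b::zero) form3 \<Rightarrow> bool" where
  "nowhere_zero3 \<A> \<Omega> \<longleftrightarrow> (\<forall>c\<in>\<A>. \<forall>x\<in>chart_img c. \<exists>u v w. \<Omega> c x u v w \<noteq> 0)"

section \<open>Integration of 3-forms\<close>

text \<open>A finite smooth partition of unity on a compact \<open>M\<close>, indexed by charts and subordinate to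
  their domains.\<close>

definition partition_of_unity ::
  "'a topology \<Rightarrow> 'a chart set \<Rightarrow> 'a chart set \<times> ('a chart \<Rightarrow> 'a \<Rightarrow> real) \<Rightarrow> bool" where
  "partition_of_unity M \<A> P \<longleftrightarrow> (case P of (C, \<rho>) \<Rightarrow>
     finite C \<and> C \<subseteq> \<A> \<and>
     (\<forall>c\<in>C. (\<forall>c'\<in>\<A>. smooth_on (chart_img c') (\<rho> c \<circ> chart_inv c')) \<and>
            (\<forall>p\<in>topspace M. 0 \<le> \<rho> c p) \<and>
            M closure_of {p \<in> topspace M. \<rho> c p \<noteq> 0} \<subseteq> chart_dom c) \<and>
     (\<forall>p\<in>topspace M. (\<Sum>c\<in>C. \<rho> c p) = 1))"

text \<open>On a closed oriented manifold a partition of unity exists and, for a smooth 3-form,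
  the value does not depend on the chosen one.\<close>

definition manifold_integral ::
  "'a topology \<Rightarrow> 'a chart set \<Rightarrow> ('a, 'b::{real_normed_field, banach}) form3 \<Rightarrow> 'b" where
  "manifold_integral M \<A> \<Omega> =
     (case (SOME P. partition_of_unity M \<A> P) of (C, \<rho>) \<Rightarrow>
       \<Sum>c\<in>C. integral (chart_img c)
         (\<lambda>x. \<rho> c (chart_inv c x) *\<^sub>R \<Omega> c x (axis 1 1) (axis 2 1) (axis 3 1)))"

section \<open>Cartan structures, volume and Bott invariant\<close>

definition contact_form :: "'a chart set \<Rightarrow> ('a, real) form1 \<Rightarrow> bool" where
  "contact_form \<A> \<omega> \<longleftrightarrow> one_form \<A> \<omega> \<and> nowhere_zero3 \<A> (wedge12 \<omega> (ext_d \<omega>))"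

definition cartan_structure :: "'a chart set \<Rightarrow> ('a, real) form1 \<Rightarrow> ('a, real) form1 \<Rightarrow> bool" where
  "cartan_structure \<A> \<omega>1 \<omega>2 \<longleftrightarrow>
     contact_form \<A> \<omega>1 \<and> contact_form \<A> \<omega>2 \<and>
     field_eq \<A> (wedge12 \<omega>1 (ext_d \<omega>1)) (wedge12 \<omega>2 (ext_d \<omega>2)) \<and>
     field_eq \<A> (wedge12 \<omega>1 (ext_d \<omega>2)) zero3 \<and>
     field_eq \<A> (wedge12 \<omega>2 (ext_d \<omega>1)) zero3"

definition vol :: "'a topology \<Rightarrow> 'a chart set \<Rightarrow> 'a vfield \<Rightarrow> real" where
  "vol M \<A> X = (THE r. \<exists>\<beta>. one_form \<A> \<beta> \<and>
     field_eq \<A> (pair1 \<beta> X) (\<lambda>c x. 1) \<and>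
     field_eq \<A> (interior_prod X (ext_d \<beta>)) zero1 \<and>
     r = manifold_integral M \<A> (wedge12 \<beta> (ext_d \<beta>)))"

text \<open>\<open>\<omega>\<close> describes a transversely holomorphic structure on the foliation by flow lines of \<open>X\<close>.
  A structure is a class of such \<open>\<omega>\<close> up to multiplication by nowhere zero complex functions.\<close>

definition transversely_holomorphic ::
  "'a chart set \<Rightarrow> 'a vfield \<Rightarrow> ('a, complex) form1 \<Rightarrow> bool" where
  "transversely_holomorphic \<A> X \<omega> \<longleftrightarrow>
     one_form \<A> \<omega> \<and>
     (\<forall>c\<in>\<A>. \<forall>x\<in>chart_img c.
        (\<forall>a b. (\<forall>v. a * Re (\<omega> c x v) + b * Im (\<omega> c x v) = 0) \<longrightarrow> a = 0 \<and> b = 0) \<and>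
        {v. Re (\<omega> c x v) = 0} \<inter> {v. Im (\<omega> c x v) = 0} = span {X c x}) \<and>
     field_eq \<A> (wedge12 \<omega> (ext_d \<omega>)) zero3"

definition bott_invariant ::
  "'a topology \<Rightarrow> 'a chart set \<Rightarrow> ('a, complex) form1 \<Rightarrow> complex" where
  "bott_invariant M \<A> \<omega> = (THE z. \<exists>\<alpha>. one_form \<A> \<alpha> \<and>
     field_eq \<A> (ext_d \<omega>) (wedge11 \<alpha> \<omega>) \<and>
     z = manifold_integral M \<A> (wedge12 \<alpha> (ext_d \<alpha>)))"

end

theory Submission
  imports Defs
begin

text \<open>
  Put \<open>\<theta> = \<omega>\<^sub>1 + i \<omega>\<^sub>2\<close>. The structure equations say \<open>d\<theta> = i\<alpha> \<and> \<theta>\<close>, so \<open>\<theta>\<close> describes a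
  transversely holomorphic structure with connection form \<open>i\<alpha>\<close>, and \<open>i\<alpha> \<and> d(i\<alpha>) = - \<alpha> \<and> d\<alpha>\<close>.
  Since \<open>i\<^sub>X d\<alpha> = 0\<close>, the integral of \<open>\<alpha> \<and> d\<alpha>\<close> is the volume of \<open>X\<close>, and the claim holds
  for this particular structure. The point is that any other structure on the same foliation
  has the same Bott invariant.

  An arbitrary \<open>\<omega>\<close> that defines the foliation is a combination \<open>\<omega> = f (\<theta> + \<mu> \<theta>')\<close>, where
  \<open>\<theta>'\<close> is the conjugate of \<open>\<theta>\<close> and \<open>f\<close> is nowhere zero, provided that \<open>\<omega>\<close> induces the same transverse
  orientation as \<open>\<theta>\<close>. Otherwise replace \<open>(\<omega>\<^sub>2, \<alpha>)\<close> by \<open>(- \<omega>\<^sub>2, - \<alpha>)\<close>, which preserves the structure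
  equations and \<open>\<alpha> \<and> d\<alpha>\<close>; as \<open>M\<close> may be disconnected, the sign is a locally constant function
  (\<open>cartan_frame_flip\<close>). Write \<open>d\<mu> = \<mu>\<^sub>\<theta> \<theta> + b \<theta>' + m i\<alpha>\<close>. Formal integrability of \<open>\<omega>\<close> amounts to
  \<open>m = 2\<mu>\<close> (\<open>grad_\<mu>\<close>), and then
  \<open>\<alpha>\<^sub>0 = i\<alpha> + df/f - \<mu>\<^sub>\<theta> \<theta>'\<close> satisfies \<open>d\<omega> = \<alpha>\<^sub>0 \<and> \<omega>\<close> (\<open>d_\<omega>_\<alpha>0\<close>).

  Everything else is one consequence of Stokes' theorem: replacing \<open>a\<close> by \<open>a + h\<close> does not change
  the integral of \<open>a \<and> da\<close> if \<open>h \<and> dh = 0\<close> and either \<open>h \<and> da = 0\<close> or \<open>a \<and> dh = 0\<close>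
  (\<open>manifold_integral_shift\<close>). It shows that the summands \<open>df/f\<close>, which is closed, and \<open>- \<mu>\<^sub>\<theta> \<theta>'\<close>,
  for which \<open>\<theta>' \<and> d\<theta>' = 0\<close> and \<open>\<theta>' \<and> d\<alpha> = 0\<close>, contribute nothing (\<open>integral_\<alpha>0\<close>). It shows that the
  Bott invariant does not depend on the connection form, because two of them differ by a multiple of
  \<open>\<omega>\<close> and \<open>d(d\<omega>) = 0\<close> gives \<open>\<omega> \<and> d\<alpha>\<^sub>0 = 0\<close> (\<open>bott_invariant_eq\<close>). And it shows that the volume
  does not depend on the form \<open>\<beta>\<close> (\<open>vol_eq\<close>), because the relevant 3-forms are annihilated
  by \<open>X\<close>.

  Stokes' theorem is proved by means of a partition of unity. In each chart, the exact part is the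
  divergence of a compactly supported vector field, whose integral vanishes because the integral
  is invariant under translations. The terms with derivatives of the partition of unity cancel
  after a change of variables between the charts (\<open>stokes_real\<close>).
\<close>

section \<open>Calculus of smooth functions\<close>

lemma differentiable_at_has_frechet_derivative:
  "f differentiable (at x) \<Longrightarrow> (f has_derivative frechet_derivative f (at x)) (at x)"
  using frechet_derivative_works by blast

lemma C_diff_on_cong:
  assumes "open S" "\<And>x. x \<in> S \<Longrightarrow> f x = g x" "C_diff_on n S f"
  shows "C_diff_on n S g"
  using assms(2,3)
proof (induction n arbitrary: f g)
  case 0
  then show ?case using continuous_on_cong[of S S f g] by simp
next
  case (Suc n)
  have D: "frechet_derivative f (at x) = frechet_derivative g (at x)"
          "f differentiable (at x)" "g differentiable (at x)" if "x \<in> S" for x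
  proof -
    show f: "f differentiable (at x)" using Suc.prems(2) that by simp
    then have h: "(f has_derivative frechet_derivative f (at x)) (at x)"
      using frechet_derivative_works by blast
    have "(g has_derivative frechet_derivative f (at x)) (at x)"
      by (rule has_derivative_transform_within_open[OF h assms(1) that]) (use Suc.prems(1) in auto)
    then show "frechet_derivative f (at x) = frechet_derivative g (at x)" "g differentiable (at x)"
      by (auto simp: frechet_derivative_at differentiable_def)
  qed
  have "C_diff_on n S (\<lambda>x. frechet_derivative g (at x) v)" for v
    by (rule Suc.IH[of "\<lambda>x. frechet_derivative f (at x) v"]) (use Suc.prems D in auto)
  then show ?case using D by simp
qed

lemma C_diff_on_imp_continuous_on:
  assumes "C_diff_on n S f" shows "continuous_on S f"
proof (cases n)
  case (Suc m)
  then have "f differentiable_on S"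
    using assms by (simp add: differentiable_on_def differentiable_at_withinI)
  then show ?thesis by (rule differentiable_imp_continuous_on)
qed (use assms in simp)

lemma C_diff_on_SucD: "C_diff_on (Suc n) S f \<Longrightarrow> C_diff_on n S f"
proof (induction n arbitrary: f)
  case 0
  then have "continuous_on S f" by (rule C_diff_on_imp_continuous_on)
  then show ?case by simp
next
  case (Suc n)
  then show ?case by simp
qed

lemma C_diff_on_Union:
  assumes "\<And>i. i \<in> I \<Longrightarrow> open (U i)" "\<And>i. i \<in> I \<Longrightarrow> C_diff_on n (U i) f"
  shows "C_diff_on n (\<Union>i\<in>I. U i) f"
  using assms(2)
proof (induction n arbitrary: f)
  case 0
  then show ?case using assms(1) by (auto intro!: continuous_on_open_UN)
next
  case (Suc n)
  then show ?case by auto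
qed

lemma C_diff_on_subset: "C_diff_on n S f \<Longrightarrow> T \<subseteq> S \<Longrightarrow> C_diff_on n T f"
  by (induction n arbitrary: f) (auto intro: continuous_on_subset)

lemma C_diff_on_const: "C_diff_on n S (\<lambda>x. c)"
  by (induction n arbitrary: c) auto

lemma C_diff_on_bounded_linear:
  assumes "bounded_linear L" "open S" "C_diff_on n S f"
  shows "C_diff_on n S (\<lambda>x. L (f x))"
  using assms(3)
proof (induction n arbitrary: f)
  case 0
  then show ?case by (auto intro!: bounded_linear.continuous_on[OF assms(1)])
next
  case (Suc n)
  have h: "((\<lambda>x. L (f x)) has_derivative (\<lambda>v. L (frechet_derivative f (at x) v))) (at x)"
    if "x \<in> S" for x
    using Suc.prems that by (intro bounded_linear.has_derivative[OF assms(1)] differentiable_at_has_frechet_derivative) auto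
  have "C_diff_on n S (\<lambda>x. frechet_derivative (\<lambda>x. L (f x)) (at x) v)" for v
    by (rule C_diff_on_cong[OF assms(2) _ Suc.IH[of "\<lambda>x. frechet_derivative f (at x) v"]])
       (use Suc.prems in \<open>simp_all add: frechet_derivative_at[OF h, symmetric]\<close>)
  then show ?case using h by (auto simp: differentiable_def)
qed

lemma C_diff_on_add:
  assumes "open S" "C_diff_on n S f" "C_diff_on n S g"
  shows "C_diff_on n S (\<lambda>x. f x + g x)"
  using assms(2,3)
proof (induction n arbitrary: f g)
  case 0
  then show ?case by (auto intro!: continuous_intros)
next
  case (Suc n)
  have h: "((\<lambda>x. f x + g x) has_derivative
      (\<lambda>v. frechet_derivative f (at x) v + frechet_derivative g (at x) v)) (at x)"
    if "x \<in> S" for x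
    using Suc.prems that
    by (intro has_derivative_add differentiable_at_has_frechet_derivative) auto
  have "C_diff_on n S (\<lambda>x. frechet_derivative (\<lambda>x. f x + g x) (at x) v)" for v
    by (rule C_diff_on_cong[OF assms(1) _ Suc.IH[of "\<lambda>x. frechet_derivative f (at x) v"
          "\<lambda>x. frechet_derivative g (at x) v"]])
       (use Suc.prems in \<open>simp_all add: frechet_derivative_at[OF h, symmetric]\<close>)
  then show ?case using h by (auto simp: differentiable_def)
qed

lemma C_diff_on_bilinear:
  assumes "bounded_bilinear B" "open S" "C_diff_on n S f" "C_diff_on n S g"
  shows "C_diff_on n S (\<lambda>x. B (f x) (g x))"
  using assms(3,4)
proof (induction n arbitrary: f g)
  case 0
  then show ?case by (auto intro!: bounded_bilinear.continuous_on[OF assms(1)])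
next
  case (Suc n)
  have h: "((\<lambda>x. B (f x) (g x)) has_derivative
      (\<lambda>v. B (f x) (frechet_derivative g (at x) v) + B (frechet_derivative f (at x) v) (g x))) (at x)"
    if "x \<in> S" for x
    using Suc.prems that
    by (intro bounded_bilinear.FDERIV[OF assms(1)] differentiable_at_has_frechet_derivative) auto
  have "C_diff_on n S (\<lambda>x. frechet_derivative (\<lambda>x. B (f x) (g x)) (at x) v)" for v
  proof (rule C_diff_on_cong[OF assms(2)])
    show "C_diff_on n S (\<lambda>x. B (f x) (frechet_derivative g (at x) v)
        + B (frechet_derivative f (at x) v) (g x))"
      by (intro C_diff_on_add[OF assms(2)] Suc.IH) (use Suc.prems C_diff_on_SucD in auto)
  qed (simp add: frechet_derivative_at[OF h, symmetric])
  then show ?case using h by (auto simp: differentiable_def)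
qed

lemma C_diff_on_sum:
  assumes "open S" "\<And>i. i \<in> I \<Longrightarrow> C_diff_on n S (f i)"
  shows "C_diff_on n S (\<lambda>x. \<Sum>i\<in>I. f i x)"
  using assms(2)
proof (induction I rule: infinite_finite_induct)
  case (insert i I)
  then show ?case by (auto intro: C_diff_on_add[OF assms(1)])
qed (auto intro: C_diff_on_const)

lemma C_diff_on_inverse:
  fixes f :: "'a::real_normed_vector \<Rightarrow> 'b::real_normed_field"
  assumes "open S" "C_diff_on n S f" "\<And>x. x \<in> S \<Longrightarrow> f x \<noteq> 0"
  shows "C_diff_on n S (\<lambda>x. inverse (f x))"
  using assms(2)
proof (induction n)
  case 0
  then show ?case using assms(3) by (auto intro!: continuous_intros)
next
  case (Suc n)
  have h: "((\<lambda>x. inverse (f x)) has_derivative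
      (\<lambda>v. - (inverse (f x) * frechet_derivative f (at x) v * inverse (f x)))) (at x)"
    if "x \<in> S" for x
    using Suc.prems that assms(3)
    by (intro Deriv.has_derivative_inverse differentiable_at_has_frechet_derivative) auto
  have "C_diff_on n S (\<lambda>x. frechet_derivative (\<lambda>x. inverse (f x)) (at x) v)" for v
  proof (rule C_diff_on_cong[OF assms(1)])
    show "C_diff_on n S (\<lambda>x. - (inverse (f x) * frechet_derivative f (at x) v * inverse (f x)))"
      by (intro C_diff_on_bounded_linear[OF bounded_linear_minus[OF bounded_linear_ident] assms(1)]
           C_diff_on_bilinear[OF bounded_bilinear_mult assms(1)] Suc.IH)
         (use Suc.prems C_diff_on_SucD in auto)
  qed (simp add: frechet_derivative_at[OF h, symmetric])
  then show ?case using h by (auto simp: differentiable_def)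
qed

text \<open>Expanding the inner derivative in a basis turns the chain rule into a sum of products of
  directional derivatives, to which the induction hypothesis applies.\<close>

lemma C_diff_on_compose:
  fixes g :: "'a::real_normed_vector \<Rightarrow> 'b::euclidean_space"
  assumes "open S" "C_diff_on n S g" "C_diff_on n T f" "g ` S \<subseteq> T"
  shows "C_diff_on n S (\<lambda>x. f (g x))"
  using assms(2,3)
proof (induction n arbitrary: f)
  case 0
  then show ?case using assms(4) by (auto intro: continuous_on_compose2)
next
  case (Suc n)
  let ?f' = "\<lambda>x. frechet_derivative f (at x)" and ?g' = "\<lambda>x. frechet_derivative g (at x)"
  have f: "f differentiable (at (g x))" and g: "g differentiable (at x)" if "x \<in> S" for x
    using that Suc.prems assms(4) by auto
  have h: "((\<lambda>x. f (g x)) has_derivative (\<lambda>v. ?f' (g x) (?g' x v))) (at x)" if "x \<in> S" for x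
    using diff_chain_at[OF g[OF that, THEN differentiable_at_has_frechet_derivative]
        f[OF that, THEN differentiable_at_has_frechet_derivative]] by (simp add: o_def)
  have e: "?f' (g x) (?g' x v) = (\<Sum>i\<in>Basis. (?g' x v \<bullet> i) *\<^sub>R ?f' (g x) i)" if "x \<in> S" for x v
  proof -
    have lin: "linear (?f' (g x))" using f[OF that] by (rule linear_frechet_derivative)
    have "?f' (g x) (?g' x v) = ?f' (g x) (\<Sum>i\<in>Basis. (?g' x v \<bullet> i) *\<^sub>R i)"
      by (simp only: euclidean_representation)
    also have "\<dots> = (\<Sum>i\<in>Basis. (?g' x v \<bullet> i) *\<^sub>R ?f' (g x) i)"
      by (simp only: linear_sum[OF lin] linear_scale[OF lin])
    finally show ?thesis .
  qed
  have "C_diff_on n S (\<lambda>x. frechet_derivative (\<lambda>x. f (g x)) (at x) v)" for v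
  proof (rule C_diff_on_cong[OF assms(1)])
    show "C_diff_on n S (\<lambda>x. \<Sum>i\<in>Basis. (?g' x v \<bullet> i) *\<^sub>R ?f' (g x) i)"
      by (intro C_diff_on_sum C_diff_on_bilinear[OF bounded_bilinear_scaleR] assms(1)
           C_diff_on_bounded_linear[OF bounded_linear_inner_left] Suc.IH)
         (use Suc.prems C_diff_on_SucD in auto)
  qed (simp add: frechet_derivative_at[OF h, symmetric] e)
  then show ?case using h by (auto simp: differentiable_def)
qed

lemma smooth_on_cong:
  "smooth_on S f \<Longrightarrow> open S \<Longrightarrow> (\<And>x. x \<in> S \<Longrightarrow> f x = g x) \<Longrightarrow> smooth_on S g"
  unfolding smooth_on_def using C_diff_on_cong[of S f g] by blast

lemma smooth_on_subset: "smooth_on S f \<Longrightarrow> T \<subseteq> S \<Longrightarrow> smooth_on T f"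
  unfolding smooth_on_def using C_diff_on_subset by blast

lemma smooth_on_imp_continuous_on: "smooth_on S f \<Longrightarrow> continuous_on S f"
  unfolding smooth_on_def using C_diff_on_imp_continuous_on by blast

lemma smooth_on_const: "smooth_on S (\<lambda>x. c)"
  unfolding smooth_on_def using C_diff_on_const by blast

lemma smooth_on_bounded_linear:
  "bounded_linear L \<Longrightarrow> open S \<Longrightarrow> smooth_on S f \<Longrightarrow> smooth_on S (\<lambda>x. L (f x))"
  unfolding smooth_on_def using C_diff_on_bounded_linear[of L S _ f] by blast

lemma smooth_on_add:
  "open S \<Longrightarrow> smooth_on S f \<Longrightarrow> smooth_on S g \<Longrightarrow> smooth_on S (\<lambda>x. f x + g x)"
  unfolding smooth_on_def using C_diff_on_add[of S _ f g] by blast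

lemma smooth_on_minus: "open S \<Longrightarrow> smooth_on S f \<Longrightarrow> smooth_on S (\<lambda>x. - f x)"
  by (rule smooth_on_bounded_linear[OF bounded_linear_minus[OF bounded_linear_ident]])

lemma smooth_on_diff:
  "open S \<Longrightarrow> smooth_on S f \<Longrightarrow> smooth_on S g \<Longrightarrow> smooth_on S (\<lambda>x. f x - g x)"
  using smooth_on_add[of S f "\<lambda>x. - g x"] smooth_on_minus[of S g] by simp

lemma smooth_on_bilinear:
  "bounded_bilinear B \<Longrightarrow> open S \<Longrightarrow> smooth_on S f \<Longrightarrow> smooth_on S g \<Longrightarrow>
    smooth_on S (\<lambda>x. B (f x) (g x))"
  unfolding smooth_on_def using C_diff_on_bilinear[of B S _ f g] by blast

lemma smooth_on_mult:
  fixes f g :: "'a::real_normed_vector \<Rightarrow> 'b::real_normed_algebra"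
  shows "open S \<Longrightarrow> smooth_on S f \<Longrightarrow> smooth_on S g \<Longrightarrow> smooth_on S (\<lambda>x. f x * g x)"
  by (rule smooth_on_bilinear[OF bounded_bilinear_mult])

lemma smooth_on_sum:
  "open S \<Longrightarrow> (\<And>i. i \<in> I \<Longrightarrow> smooth_on S (f i)) \<Longrightarrow> smooth_on S (\<lambda>x. \<Sum>i\<in>I. f i x)"
  unfolding smooth_on_def using C_diff_on_sum[of S I _ f] by blast

lemma smooth_on_inverse:
  fixes f :: "'a::real_normed_vector \<Rightarrow> 'b::real_normed_field"
  shows "open S \<Longrightarrow> smooth_on S f \<Longrightarrow> (\<And>x. x \<in> S \<Longrightarrow> f x \<noteq> 0) \<Longrightarrow> smooth_on S (\<lambda>x. inverse (f x))"
  unfolding smooth_on_def using C_diff_on_inverse[of S _ f] by blast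

lemma smooth_on_divide:
  fixes f g :: "'a::real_normed_vector \<Rightarrow> 'b::real_normed_field"
  assumes "open S" "smooth_on S f" "smooth_on S g" "\<And>x. x \<in> S \<Longrightarrow> g x \<noteq> 0"
  shows "smooth_on S (\<lambda>x. f x / g x)"
  unfolding divide_inverse by (rule smooth_on_mult[OF assms(1,2) smooth_on_inverse[OF assms(1,3,4)]])

lemma smooth_on_compose:
  fixes g :: "'a::real_normed_vector \<Rightarrow> 'b::euclidean_space"
  shows "open S \<Longrightarrow> smooth_on S g \<Longrightarrow> smooth_on T f \<Longrightarrow> g ` S \<subseteq> T \<Longrightarrow> smooth_on S (\<lambda>x. f (g x))"
  unfolding smooth_on_def using C_diff_on_compose[of S _ g T f] by blast

lemma smooth_on_frechet_derivative:
  "smooth_on S f \<Longrightarrow> smooth_on S (\<lambda>x. frechet_derivative f (at x) v)"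
  unfolding smooth_on_def using C_diff_on.simps(2)[of _ S f] by blast

lemma smooth_on_imp_differentiable: "smooth_on S f \<Longrightarrow> x \<in> S \<Longrightarrow> f differentiable (at x)"
  unfolding smooth_on_def by (auto dest: spec[of _ "Suc 0"])

lemma smooth_on_has_derivative:
  "smooth_on S f \<Longrightarrow> x \<in> S \<Longrightarrow> (f has_derivative frechet_derivative f (at x)) (at x)"
  using smooth_on_imp_differentiable differentiable_at_has_frechet_derivative by blast

lemma smooth_on_ident: "open S \<Longrightarrow> smooth_on S (\<lambda>x. x)"
  unfolding smooth_on_def
proof
  fix n show "C_diff_on n S (\<lambda>x. x)"
    by (cases n) (auto intro: C_diff_on_const)
qed

lemma smooth_on_locally:
  assumes "\<And>x. x \<in> S \<Longrightarrow> \<exists>U. open U \<and> x \<in> U \<and> smooth_on U f"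
  shows "smooth_on S f"
proof -
  from assms obtain U where U: "\<And>x. x \<in> S \<Longrightarrow> open (U x) \<and> x \<in> U x \<and> smooth_on (U x) f"
    by metis
  then have "C_diff_on n (\<Union>x\<in>S. U x) f" for n
    by (intro C_diff_on_Union) (auto simp: smooth_on_def)
  then have "smooth_on (\<Union>x\<in>S. U x) f" by (simp add: smooth_on_def)
  then show ?thesis by (rule smooth_on_subset) (use U in auto)
qed

text \<open>Induction on the order of differentiability needs the whole family
  \<open>t\<^sup>-\<^sup>k exp (-1/t)\<close>, since it is closed under differentiation up to linear combinations.\<close>

definition flat_power :: "nat \<Rightarrow> real \<Rightarrow> real" where
  "flat_power k t = (if t > 0 then exp (- inverse t) * inverse t ^ k else 0)"

lemma flat_power_tendsto_0: "(flat_power k \<longlongrightarrow> 0) (at 0)"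
proof -
  have "((\<lambda>x. x ^ k / exp x) \<longlongrightarrow> (0::real)) at_top" by (rule tendsto_power_div_exp_0)
  then have "((\<lambda>t. inverse t ^ k / exp (inverse t)) \<longlongrightarrow> (0::real)) (at_right 0)"
    by (rule filterlim_compose[OF _ filterlim_inverse_at_top_right])
  then have r: "(flat_power k \<longlongrightarrow> 0) (at_right 0)"
    by (rule Lim_transform_eventually)
       (rule eventually_at_rightI[of 0 1], auto simp: flat_power_def exp_minus field_simps)
  have l: "(flat_power k \<longlongrightarrow> 0) (at_left 0)"
    by (rule Lim_transform_eventually[OF tendsto_const])
       (rule eventually_at_leftI[of "-1" 0], auto simp: flat_power_def)
  show ?thesis using l r by (simp add: filterlim_at_split)
qed

lemma flat_power_deriv:
  "(flat_power k has_real_derivative (flat_power (k + 2) t - of_nat k * flat_power (k + 1) t)) (at t)"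
proof (cases t "0::real" rule: linorder_cases)
  case less
  have "((\<lambda>t. 0) has_real_derivative 0) (at t)" by simp
  then have "(flat_power k has_real_derivative 0) (at t)"
    by (rule has_field_derivative_transform_within_open[where S="{..<0}"])
       (use less in \<open>auto simp: flat_power_def\<close>)
  then show ?thesis using less by (simp add: flat_power_def)
next
  case equal
  have "((\<lambda>h. (flat_power k (0 + h) - flat_power k 0) / h) \<longlongrightarrow> 0) (at 0)"
    by (rule Lim_transform_eventually[OF flat_power_tendsto_0[of "k+1"]])
       (auto simp: eventually_at flat_power_def field_simps intro: exI[of _ 1])
  then have "(flat_power k has_real_derivative 0) (at t)"
    unfolding DERIV_def using equal by simp
  then show ?thesis using equal by (simp add: flat_power_def)
next
  case greater
  have "((\<lambda>t. exp (- inverse t) * inverse t ^ k) has_real_derivative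
      exp (- inverse t) * (inverse t * inverse t) * inverse t ^ k
      - exp (- inverse t) * (of_nat k * inverse t ^ (k - 1) * (inverse t * inverse t))) (at t)"
    using greater by (auto intro!: derivative_eq_intros simp: algebra_simps power2_eq_square)
  also have "exp (- inverse t) * (inverse t * inverse t) * inverse t ^ k
      - exp (- inverse t) * (of_nat k * inverse t ^ (k - 1) * (inverse t * inverse t))
      = flat_power (k + 2) t - of_nat k * flat_power (k + 1) t"
    using greater by (cases k) (simp_all add: flat_power_def algebra_simps)
  finally have "((\<lambda>t. exp (- inverse t) * inverse t ^ k) has_real_derivative
      (flat_power (k + 2) t - of_nat k * flat_power (k + 1) t)) (at t)" .
  then show ?thesis
    by (rule has_field_derivative_transform_within_open[where S="{0<..}"])
       (use greater in \<open>auto simp: flat_power_def\<close>)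
qed

lemma smooth_on_flat_power: "smooth_on UNIV (flat_power k)"
  unfolding smooth_on_def
proof
  fix n show "C_diff_on n UNIV (flat_power k)"
  proof (induction n arbitrary: k)
    case 0
    then show ?case
      by (simp, rule DERIV_continuous_on[OF has_field_derivative_at_within[OF flat_power_deriv]])
  next
    case (Suc n)
    have h: "(flat_power k has_derivative
        (\<lambda>v. (flat_power (k + 2) t - of_nat k * flat_power (k + 1) t) * v)) (at t)" for t
      using flat_power_deriv[of k t] by (simp add: has_field_derivative_def)
    have "C_diff_on n UNIV (\<lambda>t. (flat_power (k + 2) t - of_nat k * flat_power (k + 1) t) * v)" for v
      using C_diff_on_add[OF open_UNIV Suc.IH[of "k+2"] C_diff_on_bounded_linear[OF
          bounded_linear_mult_right[of "- of_nat k"] open_UNIV Suc.IH[of "k+1"]]]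
      by (intro C_diff_on_bounded_linear[OF bounded_linear_mult_left[of v] open_UNIV]) simp
    then have "C_diff_on n UNIV (\<lambda>t. frechet_derivative (flat_power k) (at t) v)" for v
      using frechet_derivative_at[OF h] by (simp add: fun_eq_iff)
    then show ?case using h by (auto simp: differentiable_def)
  qed
qed

lemma exists_smooth_bump:
  fixes x :: "'a::euclidean_space"
  assumes "r > 0"
  obtains b :: "'a \<Rightarrow> real" where "smooth_on UNIV b" "\<And>y. 0 \<le> b y" "\<And>y. b y \<noteq> 0 \<longleftrightarrow> y \<in> ball x r"
proof
  let ?q = "\<lambda>y. r\<^sup>2 - (y - x) \<bullet> (y - x)"
  let ?b = "\<lambda>y. flat_power 0 (?q y)"
  have "smooth_on UNIV ?q"
    by (intro smooth_on_diff smooth_on_const smooth_on_bilinear[OF bounded_bilinear_inner]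
        smooth_on_ident open_UNIV)
  then show "smooth_on UNIV ?b"
    by (rule smooth_on_compose[OF open_UNIV _ smooth_on_flat_power]) auto
  show "0 \<le> ?b y" for y by (simp add: flat_power_def)
  have "?q y > 0 \<longleftrightarrow> y \<in> ball x r" for y
  proof -
    have "?q y > 0 \<longleftrightarrow> (norm (y - x))\<^sup>2 < r\<^sup>2" by (simp add: power2_norm_eq_inner)
    also have "\<dots> \<longleftrightarrow> norm (y - x) < r"
      using assms power_strict_mono[of "norm (y - x)" r 2] power2_less_imp_less[of "norm (y - x)" r] by auto
    finally show ?thesis by (simp add: dist_norm norm_minus_commute)
  qed
  then show "?b y \<noteq> 0 \<longleftrightarrow> y \<in> ball x r" for y by (simp add: flat_power_def)
qed

section \<open>Second derivatives and integrals of derivatives\<close>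

lemma has_derivative_line:
  assumes "f differentiable (at (x + t *\<^sub>R v))"
  shows "((\<lambda>t. f (x + t *\<^sub>R v)) has_vector_derivative frechet_derivative f (at (x + t *\<^sub>R v)) v) (at t)"
proof -
  have "((\<lambda>t. x + t *\<^sub>R v) has_derivative (\<lambda>h. h *\<^sub>R v)) (at t)"
    by (auto intro!: derivative_eq_intros)
  from diff_chain_at[OF this differentiable_at_has_frechet_derivative[OF assms]]
  have "((\<lambda>t. f (x + t *\<^sub>R v)) has_derivative (\<lambda>h. frechet_derivative f (at (x + t *\<^sub>R v)) (h *\<^sub>R v))) (at t)"
    by (simp add: o_def)
  then show ?thesis
    unfolding has_vector_derivative_def
    by (simp add: linear_scale[OF linear_frechet_derivative[OF assms]])
qed

lemma mvt_line:
  fixes f :: "'a::real_normed_vector \<Rightarrow> real"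
  assumes "h > 0" "\<And>t. 0 \<le> t \<Longrightarrow> t \<le> h \<Longrightarrow> f differentiable (at (x + t *\<^sub>R v))"
  shows "\<exists>t. 0 < t \<and> t < h \<and> f (x + h *\<^sub>R v) - f x = h * frechet_derivative f (at (x + t *\<^sub>R v)) v"
proof -
  have "\<exists>t. 0 < t \<and> t < h \<and> f (x + h *\<^sub>R v) - f (x + 0 *\<^sub>R v)
      = (h - 0) * frechet_derivative f (at (x + t *\<^sub>R v)) v"
    by (rule MVT2[OF assms(1)])
       (simp_all add: has_real_derivative_iff_has_vector_derivative has_derivative_line assms(2))
  then show ?thesis by simp
qed

text \<open>The mean value theorem, applied first in direction \<open>u\<close> to the difference \<open>f (y + h v) - f y\<close>
  and then in direction \<open>v\<close>. The left hand side is symmetric in \<open>u\<close> and \<open>v\<close>, whence the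
  symmetry of the second derivative as \<open>h\<close> tends to 0.\<close>

lemma second_difference_eq:
  fixes f :: "'a::real_normed_vector \<Rightarrow> real"
  assumes "smooth_on (ball x r) f" "h > 0" "h * (norm u + norm v) < r"
  shows "\<exists>y. dist y x \<le> h * (norm u + norm v) \<and>
    f (x + h *\<^sub>R u + h *\<^sub>R v) - f (x + h *\<^sub>R u) - f (x + h *\<^sub>R v) + f x
     = h * (h * frechet_derivative (\<lambda>y. frechet_derivative f (at y) u) (at y) v)"
proof -
  have d: "dist (x + s *\<^sub>R u + t *\<^sub>R v) x \<le> h * (norm u + norm v)"
    if "0 \<le> s" "s \<le> h" "0 \<le> t" "t \<le> h" for s t
  proof -
    have "norm (s *\<^sub>R u + t *\<^sub>R v) \<le> s * norm u + t * norm v"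
      using that norm_triangle_ineq[of "s *\<^sub>R u" "t *\<^sub>R v"] by simp
    also have "\<dots> \<le> h * norm u + h * norm v"
      using that by (intro add_mono mult_right_mono) auto
    finally show ?thesis by (simp add: dist_norm algebra_simps)
  qed
  have b: "x + s *\<^sub>R u + t *\<^sub>R v \<in> ball x r"
    if "0 \<le> s" "s \<le> h" "0 \<le> t" "t \<le> h" for s t
    using d[OF that] assms(3) by (simp add: dist_commute)
  have f: "f differentiable (at y)" if "y \<in> ball x r" for y
    using smooth_on_imp_differentiable[OF assms(1) that] .
  let ?\<phi> = "\<lambda>y. f (y + h *\<^sub>R v) - f y"
  have h: "(?\<phi> has_derivative (\<lambda>w. frechet_derivative f (at (y + h *\<^sub>R v)) w - frechet_derivative f (at y) w)) (at y)"
    if "y \<in> ball x r" "y + h *\<^sub>R v \<in> ball x r" for y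
  proof (rule has_derivative_diff)
    have "((\<lambda>y. y + h *\<^sub>R v) has_derivative (\<lambda>w. w)) (at y)"
      by (auto intro!: derivative_eq_intros)
    from diff_chain_at[OF this differentiable_at_has_frechet_derivative[OF f[OF that(2)]]]
    show "((\<lambda>y. f (y + h *\<^sub>R v)) has_derivative frechet_derivative f (at (y + h *\<^sub>R v))) (at y)"
      by (simp add: o_def)
  qed (rule differentiable_at_has_frechet_derivative[OF f[OF that(1)]])
  have "\<exists>s. 0 < s \<and> s < h \<and> ?\<phi> (x + h *\<^sub>R u) - ?\<phi> x = h * frechet_derivative ?\<phi> (at (x + s *\<^sub>R u)) u"
  proof (rule mvt_line[OF assms(2)])
    fix s assume "0 \<le> s" "s \<le> h"
    then show "?\<phi> differentiable (at (x + s *\<^sub>R u))"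
      using h[of "x + s *\<^sub>R u"] b[of s 0] b[of s h] assms(2) by (auto simp: differentiable_def)
  qed
  then obtain s where s: "0 < s" "s < h"
    "?\<phi> (x + h *\<^sub>R u) - ?\<phi> x = h * frechet_derivative ?\<phi> (at (x + s *\<^sub>R u)) u" by blast
  have e: "frechet_derivative ?\<phi> (at (x + s *\<^sub>R u)) u =
      frechet_derivative f (at (x + s *\<^sub>R u + h *\<^sub>R v)) u - frechet_derivative f (at (x + s *\<^sub>R u)) u"
    using frechet_derivative_at[OF h[of "x + s *\<^sub>R u"]] b[of s 0] b[of s h] assms(2) s
    by (auto dest: fun_cong[where x=u])
  have "\<exists>t. 0 < t \<and> t < h \<and>
      frechet_derivative f (at (x + s *\<^sub>R u + h *\<^sub>R v)) u - frechet_derivative f (at (x + s *\<^sub>R u)) u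
      = h * frechet_derivative (\<lambda>y. frechet_derivative f (at y) u) (at (x + s *\<^sub>R u + t *\<^sub>R v)) v"
  proof (rule mvt_line[OF assms(2)])
    fix t assume "0 \<le> t" "t \<le> h"
    then show "(\<lambda>y. frechet_derivative f (at y) u) differentiable (at (x + s *\<^sub>R u + t *\<^sub>R v))"
      using s b[of s t]
      by (intro smooth_on_imp_differentiable[OF smooth_on_frechet_derivative[OF assms(1)]]) auto
  qed
  then obtain t where t: "0 < t" "t < h" 
      "frechet_derivative f (at (x + s *\<^sub>R u + h *\<^sub>R v)) u - frechet_derivative f (at (x + s *\<^sub>R u)) u
      = h * frechet_derivative (\<lambda>y. frechet_derivative f (at y) u) (at (x + s *\<^sub>R u + t *\<^sub>R v)) v"
    by blast
  show ?thesis
    using s t e d[of s t] by (intro exI[of _ "x + s *\<^sub>R u + t *\<^sub>R v"]) (simp add: algebra_simps)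
qed

lemma second_derivative_symmetric_real:
  fixes f :: "'a::real_normed_vector \<Rightarrow> real"
  assumes "open S" "smooth_on S f" "x \<in> S"
  shows "frechet_derivative (\<lambda>y. frechet_derivative f (at y) u) (at x) v
       = frechet_derivative (\<lambda>y. frechet_derivative f (at y) v) (at x) u"
proof (rule ccontr)
  let ?A = "\<lambda>y. frechet_derivative (\<lambda>y. frechet_derivative f (at y) u) (at y) v"
  let ?B = "\<lambda>y. frechet_derivative (\<lambda>y. frechet_derivative f (at y) v) (at y) u"
  assume "?A x \<noteq> ?B x"
  define e where "e = \<bar>?A x - ?B x\<bar> / 2"
  have "e > 0" using \<open>?A x \<noteq> ?B x\<close> by (simp add: e_def)
  obtain r where r: "r > 0" "ball x r \<subseteq> S" using assms open_contains_ball by blast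
  have "continuous_on S ?A" "continuous_on S ?B"
    by (intro smooth_on_imp_continuous_on smooth_on_frechet_derivative assms)+
  then have "isCont ?A x" "isCont ?B x" using assms continuous_on_eq_continuous_at by blast+
  then obtain d1 d2 where d: "d1 > 0" "d2 > 0"
      "\<And>y. dist y x < d1 \<Longrightarrow> dist (?A y) (?A x) < e" "\<And>y. dist y x < d2 \<Longrightarrow> dist (?B y) (?B x) < e"
    unfolding continuous_at_eps_delta using \<open>e > 0\<close> by metis
  define m where "m = Min {d1, d2, r}"
  have m: "m > 0" "m \<le> d1" "m \<le> d2" "m \<le> r" using d r by (auto simp: m_def)
  define h where "h = m / (norm u + norm v + 1)"
  have n: "0 < norm u + norm v + 1" by (smt (verit) norm_ge_zero)
  have h: "h > 0" "h * (norm u + norm v) < m"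
  proof -
    show "h > 0" unfolding h_def using m n by simp
    then have "h * (norm u + norm v) < h * (norm u + norm v + 1)" by simp
    also have "\<dots> = m" unfolding h_def using n by simp
    finally show "h * (norm u + norm v) < m" .
  qed
  have sm: "smooth_on (ball x r) f" using smooth_on_subset[OF assms(2) r(2)] .
  obtain y where y: "dist y x \<le> h * (norm u + norm v)"
    "f (x + h *\<^sub>R u + h *\<^sub>R v) - f (x + h *\<^sub>R u) - f (x + h *\<^sub>R v) + f x = h * (h * ?A y)"
    using second_difference_eq[OF sm h(1), of u v] h m by auto
  obtain z where z: "dist z x \<le> h * (norm v + norm u)"
    "f (x + h *\<^sub>R v + h *\<^sub>R u) - f (x + h *\<^sub>R v) - f (x + h *\<^sub>R u) + f x = h * (h * ?B z)"
    using second_difference_eq[OF sm h(1), of v u] h m by (auto simp: add.commute)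
  have "h * (h * ?A y) = h * (h * ?B z)"
    unfolding y(2)[symmetric] z(2)[symmetric] by (simp add: algebra_simps)
  then have "?A y = ?B z" using h by simp
  moreover have "dist (?A y) (?A x) < e" "dist (?B z) (?B x) < e"
    using y z h m by (intro d; simp add: add.commute)+
  ultimately have "\<bar>?A x - ?B x\<bar> < 2 * e" unfolding dist_real_def by linarith
  then show False by (simp add: e_def)
qed

lemma frechet_derivative_bounded_linear:
  assumes "bounded_linear L" "f differentiable (at x)"
  shows "frechet_derivative (\<lambda>x. L (f x)) (at x) v = L (frechet_derivative f (at x) v)"
  using frechet_derivative_at[OF bounded_linear.has_derivative[OF assms(1)
      differentiable_at_has_frechet_derivative[OF assms(2)]]] by (metis (no_types))

lemma second_derivative_symmetric:
  fixes f :: "'a::real_normed_vector \<Rightarrow> 'b::euclidean_space"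
  assumes "open S" "smooth_on S f" "x \<in> S"
  shows "frechet_derivative (\<lambda>y. frechet_derivative f (at y) u) (at x) v
       = frechet_derivative (\<lambda>y. frechet_derivative f (at y) v) (at x) u"
proof (rule euclidean_eqI)
  fix b :: 'b
  have L: "bounded_linear (\<lambda>z. z \<bullet> b)" by (rule bounded_linear_inner_left)
  have e: "frechet_derivative (\<lambda>y. frechet_derivative f (at y) u) (at x) v \<bullet> b
      = frechet_derivative (\<lambda>y. frechet_derivative (\<lambda>y. f y \<bullet> b) (at y) u) (at x) v" for u v
  proof -
    have "frechet_derivative (\<lambda>y. frechet_derivative f (at y) u) (at x) v \<bullet> b
      = frechet_derivative (\<lambda>y. frechet_derivative f (at y) u \<bullet> b) (at x) v"
      by (rule frechet_derivative_bounded_linear[OF L, symmetric])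
         (rule smooth_on_imp_differentiable[OF smooth_on_frechet_derivative[OF assms(2)] assms(3)])
    also have "frechet_derivative (\<lambda>y. frechet_derivative f (at y) u \<bullet> b) (at x)
      = frechet_derivative (\<lambda>y. frechet_derivative (\<lambda>y. f y \<bullet> b) (at y) u) (at x)"
    proof (rule frechet_derivative_transform_within_open[OF _ assms(1,3)])
      show "(\<lambda>y. frechet_derivative f (at y) u \<bullet> b) differentiable (at x)"
        by (rule smooth_on_imp_differentiable[OF smooth_on_bounded_linear[OF L assms(1)
              smooth_on_frechet_derivative[OF assms(2)]] assms(3)])
      fix y assume "y \<in> S"
      then show "frechet_derivative f (at y) u \<bullet> b = frechet_derivative (\<lambda>y. f y \<bullet> b) (at y) u"
        using frechet_derivative_bounded_linear[OF L smooth_on_imp_differentiable[OF assms(2)]] by simp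
    qed
    finally show ?thesis .
  qed
  show "frechet_derivative (\<lambda>y. frechet_derivative f (at y) u) (at x) v \<bullet> b =
        frechet_derivative (\<lambda>y. frechet_derivative f (at y) v) (at x) u \<bullet> b"
    unfolding e
    by (rule second_derivative_symmetric_real[OF assms(1) smooth_on_bounded_linear[OF L assms(1,2)] assms(3)])
qed

text \<open>The difference quotients \<open>(F (x + h e) - F x) / h\<close> have integral 0, by translation invariance,
  and converge boundedly to the derivative.\<close>

lemma integral_frechet_derivative_eq_0:
  fixes F :: "'a::euclidean_space \<Rightarrow> real"
  assumes diff: "\<And>x. F differentiable (at x)"
    and cont: "continuous_on UNIV (\<lambda>x. frechet_derivative F (at x) e)"
    and K: "compact K" "\<And>x. x \<notin> K \<Longrightarrow> F x = 0"
  shows "((\<lambda>x. frechet_derivative F (at x) e) has_integral 0) UNIV"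
proof -
  let ?D = "\<lambda>x. frechet_derivative F (at x) e"
  have D0: "?D x = 0" if "x \<notin> K" for x
  proof -
    have "((\<lambda>x. 0) has_derivative (\<lambda>x. 0)) (at x)" by simp
    then have "(F has_derivative (\<lambda>x. 0)) (at x)"
      by (rule has_derivative_transform_within_open[where s="-K"])
         (use K that compact_imp_closed in auto)
    then show ?thesis using frechet_derivative_at by metis
  qed
  have contF: "continuous_on T F" for T
    by (intro differentiable_imp_continuous_on) (simp add: differentiable_on_def diff differentiable_at_withinI)
  have "bounded (?D ` K)"
    by (intro compact_imp_bounded compact_continuous_image K continuous_on_subset[OF cont]) auto
  then obtain B where B: "\<And>x. x \<in> K \<Longrightarrow> norm (?D x) \<le> B" by (auto simp: bounded_iff)
  have B': "norm (?D x) \<le> \<bar>B\<bar>" for x using B[of x] D0[of x] by (cases "x \<in> K") auto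
  obtain a where a: "K \<subseteq> cbox (-a) a" using bounded_subset_cbox_symmetric[OF compact_imp_bounded[OF K(1)]] .
  \<comment> \<open>A box large enough to contain all the supports of the translates by \<open>t e\<close> with \<open>0 \<le> t \<le> 1\<close>.\<close>
  let ?K' = "(\<lambda>(x, t). x - t *\<^sub>R e) ` (cbox (-a) a \<times> {0..1::real})"
  have "compact ?K'"
    by (intro compact_continuous_image compact_Times compact_cbox compact_Icc)
       (auto simp: case_prod_beta intro!: continuous_intros)
  then obtain c where c: "?K' \<subseteq> cbox (-c) c" using bounded_subset_cbox_symmetric compact_imp_bounded by metis
  have sub: "cbox (-a) a \<subseteq> cbox (-c + t *\<^sub>R e) (c + t *\<^sub>R e)" if "0 \<le> t" "t \<le> 1" for t
  proof
    fix x assume "x \<in> cbox (-a) a"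
    then have "x - t *\<^sub>R e \<in> cbox (-c) c" using c that by force
    then show "x \<in> cbox (-c + t *\<^sub>R e) (c + t *\<^sub>R e)" by (auto simp: mem_box algebra_simps)
  qed
  define I where "I = integral (cbox (-a) a) F"
  have "(F has_integral I) (cbox (-a) a)"
    unfolding I_def by (intro integrable_integral integrable_continuous contF)
  then have I: "(F has_integral I) (cbox (-c + t *\<^sub>R e) (c + t *\<^sub>R e))" if "0 \<le> t" "t \<le> 1" for t
    by (rule has_integral_on_superset) (use a K sub[OF that] in auto)
  define h where "h n = inverse (real (Suc n))" for n
  have h: "0 < h n" "h n \<le> 1" for n by (auto simp: h_def field_simps)
  define q where "q n x = (F (x + h n *\<^sub>R e) - F x) / h n" for n x
  have q: "(q n has_integral 0) (cbox (-c) c)" for n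
  proof -
    have "((F \<circ> (+) (h n *\<^sub>R e)) has_integral I) (cbox (-c) c)"
      unfolding has_integral_shift_cbox_iff using I[of "h n"] h[of n] by simp
    from has_integral_divide[OF has_integral_diff[OF this, of F I], of "h n"]
    show ?thesis using I[of 0] by (simp add: q_def[abs_def] o_def add.commute)
  qed
  have lim: "(\<lambda>n. q n x) \<longlonglongrightarrow> ?D x" for x
  proof -
    have v: "((\<lambda>t. F (x + t *\<^sub>R e)) has_vector_derivative frechet_derivative F (at (x + 0 *\<^sub>R e)) e) (at 0)"
      by (rule has_derivative_line) (rule diff)
    then have "((\<lambda>t. (F (x + t *\<^sub>R e) - F x) / t) \<longlongrightarrow> ?D x) (at 0)"
      by (simp add: has_real_derivative_iff_has_vector_derivative[symmetric] DERIV_def)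
    moreover have "filterlim h (at 0) sequentially"
      unfolding h_def filterlim_at using LIMSEQ_inverse_real_of_nat by auto
    ultimately show ?thesis unfolding q_def by (rule filterlim_compose)
  qed
  have bd: "norm (q n x) \<le> \<bar>B\<bar>" for n x
  proof -
    obtain t where "F (x + h n *\<^sub>R e) - F x = h n * ?D (x + t *\<^sub>R e)"
      using mvt_line[OF h(1), of n F x e] diff by blast
    then show ?thesis using B'[of "x + t *\<^sub>R e"] h(1)[of n] by (simp add: q_def)
  qed
  have "(?D has_integral 0) (cbox (-c) c)"
    by (rule has_integral_dominated_convergence[OF q integrable_const[of "\<bar>B\<bar>"]])
       (use bd lim in auto)
  then show ?thesis
    by (rule has_integral_on_superset) (use D0 a sub[of 0] in auto)
qed

section \<open>Charts and partitions of unity\<close>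

locale closed_3manifold =
  fixes M :: "'a topology" and \<A> :: "'a chart set"
  assumes closed_oriented: "closed_oriented_3manifold M \<A>"
begin

lemma compact_space: "compact_space M" and Hausdorff_space: "Hausdorff_space M"
  and atlas: "oriented_atlas M \<A>"
  using closed_oriented by (auto simp: closed_oriented_3manifold_def)

lemma is_chart: "c \<in> \<A> \<Longrightarrow> is_chart M c"
  using atlas by (simp add: oriented_atlas_def)

lemma openin_chart_dom: "c \<in> \<A> \<Longrightarrow> openin M (chart_dom c)"
  and open_chart_img: "c \<in> \<A> \<Longrightarrow> open (chart_img c)"
  and homeomorphic_chart: "c \<in> \<A> \<Longrightarrow>
    homeomorphic_map (subtopology M (chart_dom c)) (top_of_set (chart_img c)) (chart_map c)"
  using is_chart by (auto simp: is_chart_def)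

lemma chart_dom_subset: "c \<in> \<A> \<Longrightarrow> chart_dom c \<subseteq> topspace M"
  using openin_chart_dom openin_subset by blast

lemma topspace_subtopology_chart_dom:
  "c \<in> \<A> \<Longrightarrow> topspace (subtopology M (chart_dom c)) = chart_dom c"
  using chart_dom_subset[of c] by (auto simp: topspace_subtopology)

lemma inj_on_chart: "c \<in> \<A> \<Longrightarrow> inj_on (chart_map c) (chart_dom c)"
  using homeomorphic_chart[unfolded homeomorphic_eq_everything_map] topspace_subtopology_chart_dom
  by metis

lemma chart_inv_chart_map [simp]:
  "c \<in> \<A> \<Longrightarrow> p \<in> chart_dom c \<Longrightarrow> chart_inv c (chart_map c p) = p"
  using inj_on_chart by (simp add: chart_inv_def inv_into_f_f)

lemma chart_inv_in_dom [simp]: "x \<in> chart_img c \<Longrightarrow> chart_inv c x \<in> chart_dom c"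
  unfolding chart_inv_def chart_img_def by (rule inv_into_into)

lemma chart_map_chart_inv [simp]: "x \<in> chart_img c \<Longrightarrow> chart_map c (chart_inv c x) = x"
  unfolding chart_inv_def chart_img_def by (rule f_inv_into_f)

lemma chart_map_in_img [simp]: "p \<in> chart_dom c \<Longrightarrow> chart_map c p \<in> chart_img c"
  by (simp add: chart_img_def)

lemma continuous_map_chart:
  "c \<in> \<A> \<Longrightarrow> continuous_map (subtopology M (chart_dom c)) euclidean (chart_map c)"
  using homeomorphic_imp_continuous_map[OF homeomorphic_chart]
  by (simp add: continuous_map_in_subtopology)

lemma open_chart_image:
  assumes "c \<in> \<A>" "openin M U" "U \<subseteq> chart_dom c"
  shows "open (chart_map c ` U)"
proof -
  have "openin (subtopology M (chart_dom c)) U"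
    using assms openin_open_subtopology[OF openin_chart_dom[OF assms(1)]] by blast
  then have "openin (top_of_set (chart_img c)) (chart_map c ` U)"
    using homeomorphic_imp_open_map[OF homeomorphic_chart[OF assms(1)]] by (simp add: open_map_def)
  then show ?thesis using openin_open_trans open_chart_img[OF assms(1)] by blast
qed

lemma openin_chart_preimage:
  assumes "c \<in> \<A>" "open V" shows "openin M {p \<in> chart_dom c. chart_map c p \<in> V}"
proof -
  have "openin (subtopology M (chart_dom c)) {p \<in> chart_dom c. chart_map c p \<in> V}"
    using openin_continuous_map_preimage[OF continuous_map_chart[OF assms(1)], of V] assms(2)
    unfolding topspace_subtopology_chart_dom[OF assms(1)] by simp
  then show ?thesis unfolding openin_open_subtopology[OF openin_chart_dom[OF assms(1)]] by simp
qed

lemma compact_chart_image: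
  assumes "c \<in> \<A>" "closedin M K" "K \<subseteq> chart_dom c"
  shows "compact (chart_map c ` K)"
proof -
  have "compactin (subtopology M (chart_dom c)) K"
    using closedin_compact_space[OF compact_space assms(2)] assms(3) by (simp add: compactin_subtopology)
  from image_compactin[OF this continuous_map_chart[OF assms(1)]] show ?thesis by simp
qed

lemma closedin_chart_inv_image:
  assumes "c \<in> \<A>" "compact K" "K \<subseteq> chart_img c"
  shows "closedin M (chart_inv c ` K)"
proof -
  have "chart_map c ` (chart_inv c ` K) = K"
    using assms(3) by (force simp: image_image)
  then have "compactin (subtopology M (chart_dom c)) (chart_inv c ` K)"
    unfolding homeomorphic_map_compactness_eq[OF homeomorphic_chart[OF assms(1)]]
      topspace_subtopology_chart_dom[OF assms(1)]
    using assms by (auto simp: compactin_subtopology)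
  then show ?thesis
    using compactin_imp_closedin[OF Hausdorff_space] by (simp add: compactin_subtopology)
qed

lemma chart_overlap_iff:
  assumes "c \<in> \<A>"
  shows "x \<in> chart_overlap c c' \<longleftrightarrow> x \<in> chart_img c \<and> chart_inv c x \<in> chart_dom c'"
proof
  assume "x \<in> chart_overlap c c'"
  then show "x \<in> chart_img c \<and> chart_inv c x \<in> chart_dom c'"
    using assms by (auto simp: chart_overlap_def)
next
  assume "x \<in> chart_img c \<and> chart_inv c x \<in> chart_dom c'"
  then show "x \<in> chart_overlap c c'"
    unfolding chart_overlap_def by (intro image_eqI[where x="chart_inv c x"]) auto
qed

lemma open_chart_overlap: "c \<in> \<A> \<Longrightarrow> c' \<in> \<A> \<Longrightarrow> open (chart_overlap c c')"
  unfolding chart_overlap_def by (intro open_chart_image openin_Int openin_chart_dom) auto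

lemma chart_overlap_subset: "chart_overlap c c' \<subseteq> chart_img c"
  by (auto simp: chart_overlap_def)

lemma transition_in_overlap:
  "c \<in> \<A> \<Longrightarrow> c' \<in> \<A> \<Longrightarrow> x \<in> chart_overlap c c' \<Longrightarrow> transition c c' x \<in> chart_overlap c' c"
  by (auto simp: chart_overlap_iff transition_def)

lemma transition_in_img:
  "c \<in> \<A> \<Longrightarrow> c' \<in> \<A> \<Longrightarrow> x \<in> chart_overlap c c' \<Longrightarrow> transition c c' x \<in> chart_img c'"
  using transition_in_overlap chart_overlap_subset by blast

lemma chart_inv_transition:
  "c \<in> \<A> \<Longrightarrow> c' \<in> \<A> \<Longrightarrow> x \<in> chart_overlap c c' \<Longrightarrow> chart_inv c' (transition c c' x) = chart_inv c x"
  by (simp add: chart_overlap_iff transition_def)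

lemma transition_transition:
  "c \<in> \<A> \<Longrightarrow> c' \<in> \<A> \<Longrightarrow> x \<in> chart_overlap c c' \<Longrightarrow> transition c' c (transition c c' x) = x"
  using chart_inv_transition[of c c' x] by (simp add: transition_def chart_overlap_iff)

lemma transition_image:
  assumes "c \<in> \<A>" "c' \<in> \<A>" shows "transition c c' ` chart_overlap c c' = chart_overlap c' c"
proof
  show "transition c c' ` chart_overlap c c' \<subseteq> chart_overlap c' c"
    using assms transition_in_overlap by blast
  show "chart_overlap c' c \<subseteq> transition c c' ` chart_overlap c c'"
  proof
    fix y assume y: "y \<in> chart_overlap c' c"
    then show "y \<in> transition c c' ` chart_overlap c c'"
      using assms transition_in_overlap transition_transition
      by (intro image_eqI[where x="transition c' c y"]) auto
  qed
qed

lemma inj_on_transition: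
  assumes "c \<in> \<A>" "c' \<in> \<A>" shows "inj_on (transition c c') (chart_overlap c c')"
  by (rule inj_on_inverseI[where g="transition c' c"]) (use assms transition_transition in auto)

lemma smooth_on_transition:
  "c \<in> \<A> \<Longrightarrow> c' \<in> \<A> \<Longrightarrow> smooth_on (chart_overlap c c') (transition c c')"
  using atlas by (simp add: oriented_atlas_def)

lemma det_transition:
  "c \<in> \<A> \<Longrightarrow> c' \<in> \<A> \<Longrightarrow> x \<in> chart_overlap c c' \<Longrightarrow>
    det (matrix (frechet_derivative (transition c c') (at x))) > 0"
  using atlas by (simp add: oriented_atlas_def)

lemma transition_has_derivative:
  "c \<in> \<A> \<Longrightarrow> c' \<in> \<A> \<Longrightarrow> x \<in> chart_overlap c c' \<Longrightarrow>
    (transition c c' has_derivative frechet_derivative (transition c c') (at x)) (at x)"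
  using smooth_on_has_derivative[OF smooth_on_transition] .

text \<open>A bump function around a point, subordinate to one chart. It is smooth in every other chart
  \<open>c'\<close> because it is either a bump function composed with a transition map or vanishes near the
  point in question; the latter uses that \<open>K\<close> is closed, which holds because it is compact and \<open>M\<close>
  is Hausdorff.\<close>

lemma exists_manifold_bump:
  assumes "p \<in> topspace M"
  shows "\<exists>c\<in>\<A>. \<exists>b K. (\<forall>c'\<in>\<A>. smooth_on (chart_img c') (b \<circ> chart_inv c')) \<and>
    (\<forall>q. 0 \<le> b q) \<and> b p > (0::real) \<and> closedin M K \<and> K \<subseteq> chart_dom c \<and>
    {q. b q \<noteq> 0} \<subseteq> K \<and> openin M {q. b q > 0}"
proof -
  from assms atlas obtain c where c: "c \<in> \<A>" "p \<in> chart_dom c"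
    unfolding oriented_atlas_def by blast
  let ?x = "chart_map c p"
  obtain r where r: "r > 0" "cball ?x r \<subseteq> chart_img c"
    using open_chart_img[OF c(1)] chart_map_in_img[OF c(2)] open_contains_cball by blast
  obtain B where B: "smooth_on UNIV B" "\<And>y. 0 \<le> B y" "\<And>y. B y \<noteq> (0::real) \<longleftrightarrow> y \<in> ball ?x r"
    using exists_smooth_bump[OF r(1)] by blast
  have B': "B y > 0 \<longleftrightarrow> y \<in> ball ?x r" for y
    using B(2)[of y] B(3)[of y] by linarith
  define b where "b q = (if q \<in> chart_dom c then B (chart_map c q) else 0)" for q
  define K where "K = chart_inv c ` cball ?x r"
  have K: "closedin M K" unfolding K_def by (rule closedin_chart_inv_image[OF c(1) compact_cball r(2)])
  have Kdom: "K \<subseteq> chart_dom c" unfolding K_def using r(2) by auto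
  have bK: "{q. b q \<noteq> 0} \<subseteq> K"
  proof
    fix q assume "q \<in> {q. b q \<noteq> 0}"
    then have "q \<in> chart_dom c" "chart_map c q \<in> cball ?x r"
      using B(3) by (auto simp: b_def split: if_splits)
    then show "q \<in> K" unfolding K_def using c(1) by (intro image_eqI[where x="chart_map c q"]) auto
  qed
  have "{q. b q > 0} = {q \<in> chart_dom c. chart_map c q \<in> ball ?x r}"
    using B' by (auto simp: b_def)
  then have op: "openin M {q. b q > 0}" using openin_chart_preimage[OF c(1) open_ball] by simp
  have sm: "smooth_on (chart_img c') (b \<circ> chart_inv c')" if c': "c' \<in> \<A>" for c'
  proof (rule smooth_on_locally)
    fix y assume y: "y \<in> chart_img c'"
    show "\<exists>U. open U \<and> y \<in> U \<and> smooth_on U (b \<circ> chart_inv c')"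
    proof (cases "chart_inv c' y \<in> chart_dom c")
      case True
      have "smooth_on (chart_overlap c' c) (\<lambda>z. B (transition c' c z))"
        by (rule smooth_on_compose[OF open_chart_overlap[OF c' c(1)] smooth_on_transition[OF c' c(1)] B(1)]) simp
      then have "smooth_on (chart_overlap c' c) (b \<circ> chart_inv c')"
        by (rule smooth_on_cong[OF _ open_chart_overlap[OF c' c(1)]])
           (use c' in \<open>auto simp: b_def transition_def chart_overlap_iff\<close>)
      moreover have "y \<in> chart_overlap c' c" using True y chart_overlap_iff[OF c'] by simp
      ultimately show ?thesis using open_chart_overlap[OF c' c(1)] by blast
    next
      case False
      define U where "U = chart_map c' ` (chart_dom c' - K)"
      have "openin M (chart_dom c' - K)" by (rule openin_diff[OF openin_chart_dom[OF c'] K])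
      then have U: "open U" unfolding U_def by (rule open_chart_image[OF c']) auto
      have "b (chart_inv c' z) = 0" if "z \<in> U" for z
        using that bK c' by (auto simp: U_def)
      then have "smooth_on U (b \<circ> chart_inv c')"
        by (intro smooth_on_cong[OF smooth_on_const[of U 0] U]) simp
      moreover have "y \<in> U" unfolding U_def
        using y False Kdom by (intro image_eqI[where x="chart_inv c' y"]) auto
      ultimately show ?thesis using U by blast
    qed
  qed
  have "b p > 0" using B' r(1) c(2) by (simp add: b_def)
  moreover have "\<forall>q. 0 \<le> b q" using B(2) by (simp add: b_def)
  ultimately show ?thesis
    using sm K Kdom bK op by (intro bexI[OF _ c(1)] exI[of _ b] exI[of _ K]) simp
qed

text \<open>Compactness yields finitely many bumps without common zero. Those subordinate to the
  same chart are added up, and the result is divided by the sum of all.\<close>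

lemma partition_of_unity_exists: "\<exists>P. partition_of_unity M \<A> P"
proof -
  define Q where "Q p c b K \<longleftrightarrow> c \<in> \<A> \<and>
    (\<forall>c'\<in>\<A>. smooth_on (chart_img c') (b \<circ> chart_inv c')) \<and>
    (\<forall>q. 0 \<le> b q) \<and> b p > (0::real) \<and> closedin M K \<and> K \<subseteq> chart_dom c \<and>
    {q. b q \<noteq> 0} \<subseteq> K \<and> openin M {q. b q > 0}" for p c b K
  have "\<forall>p\<in>topspace M. \<exists>t. Q p (fst t) (fst (snd t)) (snd (snd t))"
  proof
    fix p assume "p \<in> topspace M"
    then obtain c b K where "Q p c b K" using exists_manifold_bump[of p] unfolding Q_def by auto
    then show "\<exists>t. Q p (fst t) (fst (snd t)) (snd (snd t))"
      by (intro exI[of _ "(c, b, K)"]) simp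
  qed
  from bchoice[OF this] obtain T
    where T: "\<And>p. p \<in> topspace M \<Longrightarrow> Q p (fst (T p)) (fst (snd (T p))) (snd (snd (T p)))" by auto
  define ch b K where defs: "ch p = fst (T p)" "b p = fst (snd (T p))" "K p = snd (snd (T p))" for p
  have Q: "Q p (ch p) (b p) (K p)" if "p \<in> topspace M" for p
    using T[OF that] by (simp add: defs)
  have ch: "ch p \<in> \<A>" and nn: "0 \<le> b p q" and pos: "b p p > 0"
    and K: "closedin M (K p)" "K p \<subseteq> chart_dom (ch p)" "{q. b p q \<noteq> 0} \<subseteq> K p"
    and op: "openin M {q. b p q > 0}" if "p \<in> topspace M" for p q
    using Q[OF that] unfolding Q_def by simp_all
  have sm: "smooth_on (chart_img c') (b p \<circ> chart_inv c')" if "p \<in> topspace M" "c' \<in> \<A>" for p c'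
    using Q[OF that(1)] that(2) unfolding Q_def by simp
  let ?U = "\<lambda>p. {q. b p q > 0}"
  have "topspace M \<subseteq> \<Union> (?U ` topspace M)" using pos by auto
  then obtain \<F> where \<F>: "finite \<F>" "\<F> \<subseteq> ?U ` topspace M" "topspace M \<subseteq> \<Union>\<F>"
    using compact_space[unfolded compact_space_alt, rule_format, of "?U ` topspace M"] op by blast
  then obtain F where F: "finite F" "F \<subseteq> topspace M" "\<F> = ?U ` F"
    by (meson finite_subset_image)
  define S where "S q = (\<Sum>p\<in>F. b p q)" for q
  have S: "S q > 0" if q: "q \<in> topspace M" for q
  proof -
    obtain p where "p \<in> F" "b p q > 0" using \<F>(3) F(3) q by blast
    then show ?thesis unfolding S_def using F nn by (intro sum_pos2[of F p]) auto
  qed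
  define \<rho> where "\<rho> c q = (\<Sum>p\<in>{p\<in>F. ch p = c}. b p q) / S q" for c q
  have "partition_of_unity M \<A> (ch ` F, \<rho>)"
    unfolding partition_of_unity_def prod.case
  proof (intro conjI ballI)
    show "finite (ch ` F)" "ch ` F \<subseteq> \<A>" using F ch by auto
  next
    fix c c' assume "c \<in> ch ` F" "c' \<in> \<A>"
    have S': "smooth_on (chart_img c') (\<lambda>x. S (chart_inv c' x))"
      unfolding S_def using sm[of _ c', unfolded o_def] F \<open>c' \<in> \<A>\<close>
      by (intro smooth_on_sum open_chart_img) auto
    have "smooth_on (chart_img c') (\<lambda>x. \<Sum>p\<in>{p\<in>F. ch p = c}. b p (chart_inv c' x))"
      using sm[of _ c', unfolded o_def] F \<open>c' \<in> \<A>\<close>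
      by (intro smooth_on_sum open_chart_img) auto
    from smooth_on_divide[OF open_chart_img[OF \<open>c' \<in> \<A>\<close>] this S']
    show "smooth_on (chart_img c') (\<rho> c \<circ> chart_inv c')"
      unfolding \<rho>_def o_def using S chart_dom_subset[OF \<open>c' \<in> \<A>\<close>]
      by (simp add: less_imp_neq[symmetric] subset_iff)
  next
    fix c q assume "c \<in> ch ` F" "q \<in> topspace M"
    then show "0 \<le> \<rho> c q" unfolding \<rho>_def using S[of q] nn F
      by (intro divide_nonneg_pos sum_nonneg) auto
  next
    fix c assume "c \<in> ch ` F"
    have "{q \<in> topspace M. \<rho> c q \<noteq> 0} \<subseteq> (\<Union>p\<in>{p\<in>F. ch p = c}. K p)"
    proof
      fix q assume "q \<in> {q \<in> topspace M. \<rho> c q \<noteq> 0}"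
      then have "\<rho> c q \<noteq> 0" by simp
      have "\<exists>p\<in>F. ch p = c \<and> b p q \<noteq> 0"
      proof (rule ccontr)
        assume "\<not> (\<exists>p\<in>F. ch p = c \<and> b p q \<noteq> 0)"
        then have "(\<Sum>p\<in>{p\<in>F. ch p = c}. b p q) = 0" by (intro sum.neutral) auto
        then show False using \<open>\<rho> c q \<noteq> 0\<close> by (simp add: \<rho>_def)
      qed
      then obtain p where "p \<in> F" "ch p = c" "b p q \<noteq> 0" by blast
      then show "q \<in> (\<Union>p\<in>{p\<in>F. ch p = c}. K p)" using K(3)[of p] F(2) by blast
    qed
    moreover have "closedin M (\<Union>p\<in>{p\<in>F. ch p = c}. K p)"
      using F K(1) by (intro closedin_Union) auto
    ultimately have "M closure_of {q \<in> topspace M. \<rho> c q \<noteq> 0} \<subseteq> (\<Union>p\<in>{p\<in>F. ch p = c}. K p)"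
      by (rule closure_of_minimal)
    also have "\<dots> \<subseteq> chart_dom c" using K(2) F by auto
    finally show "M closure_of {q \<in> topspace M. \<rho> c q \<noteq> 0} \<subseteq> chart_dom c" .
  next
    fix q assume "q \<in> topspace M"
    have "(\<Sum>c\<in>ch ` F. \<rho> c q) = (\<Sum>c\<in>ch ` F. \<Sum>p\<in>{p\<in>F. ch p = c}. b p q) / S q"
      unfolding \<rho>_def by (simp add: sum_divide_distrib)
    also have "(\<Sum>c\<in>ch ` F. \<Sum>p\<in>{p\<in>F. ch p = c}. b p q) = S q"
      unfolding S_def by (rule sum.image_gen[OF F(1), symmetric])
    finally show "(\<Sum>c\<in>ch ` F. \<rho> c q) = 1" using S[OF \<open>q \<in> topspace M\<close>] by simp
  qed
  then show ?thesis by blast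
qed

end

section \<open>Calculus of differential forms\<close>

lemma frechet_derivative_add:
  "f differentiable (at x) \<Longrightarrow> g differentiable (at x) \<Longrightarrow>
    frechet_derivative (\<lambda>y. f y + g y) (at x) v
      = frechet_derivative f (at x) v + frechet_derivative g (at x) v"
  by (subst frechet_derivative_at[symmetric, OF has_derivative_add])
     (auto intro: differentiable_at_has_frechet_derivative)

lemma frechet_derivative_diff:
  "f differentiable (at x) \<Longrightarrow> g differentiable (at x) \<Longrightarrow>
    frechet_derivative (\<lambda>y. f y - g y) (at x) v
      = frechet_derivative f (at x) v - frechet_derivative g (at x) v"
  by (subst frechet_derivative_at[symmetric, OF has_derivative_diff])
     (auto intro: differentiable_at_has_frechet_derivative)

lemma frechet_derivative_mult:
  fixes f g :: "'a::real_normed_vector \<Rightarrow> 'b::real_normed_algebra"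
  shows "f differentiable (at x) \<Longrightarrow> g differentiable (at x) \<Longrightarrow>
    frechet_derivative (\<lambda>y. f y * g y) (at x) v
      = f x * frechet_derivative g (at x) v + frechet_derivative f (at x) v * g x"
  by (subst frechet_derivative_at[symmetric, OF has_derivative_mult])
     (auto intro: differentiable_at_has_frechet_derivative)

lemma frechet_derivative_cong_open:
  assumes "open S" "x \<in> S" "\<And>y. y \<in> S \<Longrightarrow> f y = g y" "f differentiable (at x)"
  shows "frechet_derivative f (at x) = frechet_derivative g (at x)"
  by (rule frechet_derivative_transform_within_open[OF assms(4,1,2,3)])

abbreviation "e1 \<equiv> axis 1 1 :: real^3"
abbreviation "e2 \<equiv> axis 2 1 :: real^3"
abbreviation "e3 \<equiv> axis 3 1 :: real^3"

lemma vector_3_expand: "(v::real^3) = v$1 *\<^sub>R e1 + v$2 *\<^sub>R e2 + v$3 *\<^sub>R e3"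
  by (simp add: vec_eq_iff forall_3 axis_def)

lemma linear_expand:
  fixes f :: "real^3 \<Rightarrow> 'b::real_algebra_1"
  assumes "linear f"
  shows "f v = of_real (v$1) * f e1 + of_real (v$2) * f e2 + of_real (v$3) * f e3"
proof -
  have "f v = f (v$1 *\<^sub>R e1 + v$2 *\<^sub>R e2 + v$3 *\<^sub>R e3)" using vector_3_expand[of v] by simp
  also have "\<dots> = v$1 *\<^sub>R f e1 + v$2 *\<^sub>R f e2 + v$3 *\<^sub>R f e3"
    by (simp only: linear_add[OF assms] linear_scale[OF assms])
  finally show ?thesis by (simp add: scaleR_conv_of_real)
qed

text \<open>The wedge product of three linear forms.\<close>

definition triple :: "('v \<Rightarrow> 'b::comm_ring) \<Rightarrow> ('v \<Rightarrow> 'b) \<Rightarrow> ('v \<Rightarrow> 'b) \<Rightarrow> 'v \<Rightarrow> 'v \<Rightarrow> 'v \<Rightarrow> 'b" where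
  "triple p a b u v w = p u * (a v * b w - a w * b v) + p v * (a w * b u - a u * b w)
     + p w * (a u * b v - a v * b u)"

lemma wedge12_wedge11: "wedge12 p (wedge11 a b) c x = triple (p c x) (a c x) (b c x)"
  by (simp add: fun_eq_iff wedge12_def wedge11_def triple_def)

text \<open>The coefficient with respect to \<open>dx \<and> dy \<and> dz\<close>, which is the integrand in \<open>manifold_integral\<close>.\<close>

definition coeff3 :: "('a, 'b) form3 \<Rightarrow> 'a chart \<Rightarrow> real^3 \<Rightarrow> 'b" where
  "coeff3 \<Omega> c x = \<Omega> c x e1 e2 e3"

text \<open>A 3-form is multiplied by the determinant under pullback. This makes the quotient of two
  3-forms a function on the manifold, and it is the transformation law that the change of
  variables in integrals requires.\<close>

lemma triple_linear_image:
  fixes p a b :: "real^3 \<Rightarrow> 'b::real_normed_field"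
  assumes "linear p" "linear a" "linear b"
  shows "triple p a b (D e1) (D e2) (D e3) = of_real (det (matrix D)) * triple p a b e1 e2 e3"
  unfolding triple_def linear_expand[OF assms(1), of "D _"] linear_expand[OF assms(2), of "D _"]
    linear_expand[OF assms(3), of "D _"] det_3
  by (simp add: matrix_def) algebra

text \<open>An alternating trilinear form on a 3-dimensional space is determined by its value on one basis;
  here it is a product of a linear and an alternating bilinear form.\<close>

lemma wedge_proportional:
  fixes p q r s :: "real^3 \<Rightarrow> 'b::real_normed_field" and \<sigma> :: "real^3 \<Rightarrow> real^3 \<Rightarrow> 'b"
  assumes "linear p" "linear q" "linear r" "linear s"
    and "\<And>u. linear (\<sigma> u)" "\<And>u v. \<sigma> u v = - \<sigma> v u"
  shows "(s u * \<sigma> v w + s v * \<sigma> w u + s w * \<sigma> u v) * triple p q r e1 e2 e3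
    = (s e1 * \<sigma> e2 e3 + s e2 * \<sigma> e3 e1 + s e3 * \<sigma> e1 e2) * triple p q r u v w"
proof -
  have z: "\<sigma> u u = 0" for u using assms(6)[of u u] by (simp add: eq_neg_iff_add_eq_0 flip: mult_2)
  have s: "\<sigma> u v = (of_real (u$1) * of_real (v$2) - of_real (u$2) * of_real (v$1)) * \<sigma> e1 e2
     + (of_real (u$2) * of_real (v$3) - of_real (u$3) * of_real (v$2)) * \<sigma> e2 e3
     + (of_real (u$3) * of_real (v$1) - of_real (u$1) * of_real (v$3)) * \<sigma> e3 e1" for u v
  proof -
    have e: "\<sigma> u e = - (of_real (u$1) * \<sigma> e e1 + of_real (u$2) * \<sigma> e e2 + of_real (u$3) * \<sigma> e e3)" for e
      unfolding assms(6)[of u e] by (subst linear_expand[OF assms(5)]) simp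
    have E: "\<sigma> u e1 = of_real (u$3) * \<sigma> e3 e1 - of_real (u$2) * \<sigma> e1 e2"
      "\<sigma> u e2 = of_real (u$1) * \<sigma> e1 e2 - of_real (u$3) * \<sigma> e2 e3"
      "\<sigma> u e3 = of_real (u$2) * \<sigma> e2 e3 - of_real (u$1) * \<sigma> e3 e1"
      unfolding e[of e1] e[of e2] e[of e3]
      using z[of e1] z[of e2] z[of e3] assms(6)[of e2 e1] assms(6)[of e3 e2] assms(6)[of e1 e3] by simp_all
    show ?thesis
      unfolding linear_expand[OF assms(5)[of u], of v] E by (simp add: algebra_simps)
  qed
  show ?thesis
    unfolding triple_def s[of u v] s[of v w] s[of w u] linear_expand[OF assms(1), of u]
      linear_expand[OF assms(1), of v] linear_expand[OF assms(1), of w]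
      linear_expand[OF assms(2), of u]
      linear_expand[OF assms(2), of v] linear_expand[OF assms(2), of w]
      linear_expand[OF assms(3), of u]
      linear_expand[OF assms(3), of v] linear_expand[OF assms(3), of w]
      linear_expand[OF assms(4), of u]
      linear_expand[OF assms(4), of v] linear_expand[OF assms(4), of w]
    by algebra
qed

lemma triple_cramer:
  fixes p q r s :: "real^3 \<Rightarrow> 'b::real_normed_field"
  assumes "linear p" "linear q" "linear r" "linear s"
  shows "s u * triple p q r e1 e2 e3
    = triple s q r e1 e2 e3 * p u + triple p s r e1 e2 e3 * q u + triple p q s e1 e2 e3 * r u"
  unfolding triple_def linear_expand[OF assms(1), of u] linear_expand[OF assms(2), of u]
    linear_expand[OF assms(3), of u] linear_expand[OF assms(4), of u]
  by algebra

text \<open>Independence of three forms can be tested on the standard basis. In \<open>triple_linear_image\<close> only the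
  values of \<open>D\<close> on that basis occur.\<close>

lemma triple_nonzero_frame:
  fixes p q r :: "real^3 \<Rightarrow> 'b::real_normed_field"
  assumes "linear p" "linear q" "linear r" "triple p q r u v w \<noteq> 0"
  shows "triple p q r e1 e2 e3 \<noteq> 0"
proof
  assume "triple p q r e1 e2 e3 = 0"
  define D where "D z = (if z = e1 then u else if z = e2 then v else w)" for z :: "real^3"
  have "e1 \<noteq> e2" "e1 \<noteq> e3" "e2 \<noteq> e3" by (simp_all add: axis_eq_axis)
  then have "triple p q r u v w = triple p q r (D e1) (D e2) (D e3)" by (simp add: D_def)
  also have "\<dots> = 0" using triple_linear_image[OF assms(1-3), of D] \<open>triple p q r e1 e2 e3 = 0\<close> by simp
  finally show False using assms(4) by simp
qed

text \<open>A smooth function on the manifold, given by its representatives in the charts.\<close>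

definition scalar_field :: "'a chart set \<Rightarrow> ('a chart \<Rightarrow> real^3 \<Rightarrow> 'b::real_normed_field) \<Rightarrow> bool" where
  "scalar_field \<A> f \<longleftrightarrow> (\<forall>c\<in>\<A>. smooth_on (chart_img c) (f c)) \<and>
     (\<forall>c\<in>\<A>. \<forall>c'\<in>\<A>. \<forall>x\<in>chart_overlap c c'. f c' (transition c c' x) = f c x)"

definition grad :: "('a chart \<Rightarrow> real^3 \<Rightarrow> 'b::real_normed_field) \<Rightarrow> ('a, 'b) form1" where
  "grad f = (\<lambda>c x v. frechet_derivative (f c) (at x) v)"

definition add_form :: "('a, 'b::real_normed_field) form1 \<Rightarrow> ('a, 'b) form1 \<Rightarrow> ('a, 'b) form1" where
  "add_form a b = (\<lambda>c x v. a c x v + b c x v)"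

definition scale_form ::
  "('a chart \<Rightarrow> real^3 \<Rightarrow> 'b::real_normed_field) \<Rightarrow> ('a, 'b) form1 \<Rightarrow> ('a, 'b) form1" where
  "scale_form f a = (\<lambda>c x v. f c x * a c x v)"

definition map_form :: "('b \<Rightarrow> 'd) \<Rightarrow> ('a, 'b) form1 \<Rightarrow> ('a, 'd) form1" where
  "map_form L a = (\<lambda>c x v. L (a c x v))"

context closed_3manifold
begin

lemma one_form_linear: "one_form \<A> a \<Longrightarrow> c \<in> \<A> \<Longrightarrow> x \<in> chart_img c \<Longrightarrow> linear (a c x)"
  and one_form_smooth: "one_form \<A> a \<Longrightarrow> c \<in> \<A> \<Longrightarrow> smooth_on (chart_img c) (\<lambda>x. a c x v)"
  and one_form_natural: "one_form \<A> a \<Longrightarrow> c \<in> \<A> \<Longrightarrow> c' \<in> \<A> \<Longrightarrow> x \<in> chart_overlap c c' \<Longrightarrow>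
     a c' (transition c c' x) (frechet_derivative (transition c c') (at x) v) = a c x v"
  by (simp_all add: one_form_def)

lemma one_form_differentiable:
  "one_form \<A> a \<Longrightarrow> c \<in> \<A> \<Longrightarrow> x \<in> chart_img c \<Longrightarrow> (\<lambda>x. a c x v) differentiable (at x)"
  using smooth_on_imp_differentiable[OF one_form_smooth] .

lemma one_formI:
  assumes "\<And>c x. c \<in> \<A> \<Longrightarrow> x \<in> chart_img c \<Longrightarrow> linear (a c x)"
    and "\<And>c v. c \<in> \<A> \<Longrightarrow> smooth_on (chart_img c) (\<lambda>x. a c x v)"
    and "\<And>c c' x v. c \<in> \<A> \<Longrightarrow> c' \<in> \<A> \<Longrightarrow> x \<in> chart_overlap c c' \<Longrightarrow>
     a c' (transition c c' x) (frechet_derivative (transition c c') (at x) v) = a c x v"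
  shows "one_form \<A> a"
  unfolding one_form_def using assms by simp

lemma scalar_fieldI:
  assumes "\<And>c. c \<in> \<A> \<Longrightarrow> smooth_on (chart_img c) (f c)"
    and "\<And>c c' x. c \<in> \<A> \<Longrightarrow> c' \<in> \<A> \<Longrightarrow> x \<in> chart_overlap c c' \<Longrightarrow> f c' (transition c c' x) = f c x"
  shows "scalar_field \<A> f"
  unfolding scalar_field_def using assms by simp

lemma scalar_field_smooth: "scalar_field \<A> f \<Longrightarrow> c \<in> \<A> \<Longrightarrow> smooth_on (chart_img c) (f c)"
  and scalar_field_natural: "scalar_field \<A> f \<Longrightarrow> c \<in> \<A> \<Longrightarrow> c' \<in> \<A> \<Longrightarrow> x \<in> chart_overlap c c' \<Longrightarrow>
    f c' (transition c c' x) = f c x"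
  by (simp_all add: scalar_field_def)

lemma scalar_field_differentiable:
  "scalar_field \<A> f \<Longrightarrow> c \<in> \<A> \<Longrightarrow> x \<in> chart_img c \<Longrightarrow> f c differentiable (at x)"
  using smooth_on_imp_differentiable[OF scalar_field_smooth] .

lemma scalar_field_const: "scalar_field \<A> (\<lambda>c x. k)"
  by (simp add: scalar_field_def smooth_on_const)

lemma one_form_add: "one_form \<A> a \<Longrightarrow> one_form \<A> b \<Longrightarrow> one_form \<A> (add_form a b)"
  by (rule one_formI)
     (simp_all add: add_form_def linear_compose_add one_form_linear one_form_natural
        smooth_on_add[OF open_chart_img one_form_smooth one_form_smooth])

lemma one_form_scale:
  assumes "scalar_field \<A> f" "one_form \<A> a"
  shows "one_form \<A> (scale_form f a)"
proof (rule one_formI)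
  fix c x assume "c \<in> \<A>" "x \<in> chart_img c"
  then have "linear (a c x)" using assms one_form_linear by blast
  then show "linear (scale_form f a c x)"
    by (simp add: linear_iff scale_form_def algebra_simps)
qed (use assms in \<open>simp_all add: scale_form_def one_form_natural scalar_field_natural
    smooth_on_mult[OF open_chart_img scalar_field_smooth one_form_smooth]\<close>)

lemma one_form_map:
  assumes "bounded_linear L" "one_form \<A> a" shows "one_form \<A> (map_form L a)"
proof (rule one_formI)
  fix c x assume "c \<in> \<A>" "x \<in> chart_img c"
  then have "linear (a c x)" using assms one_form_linear by blast
  from linear_compose[OF this bounded_linear.linear[OF assms(1)]]
  show "linear (map_form L a c x)" by (simp add: o_def map_form_def)
qed (use assms in \<open>simp_all add: map_form_def one_form_natural
    smooth_on_bounded_linear[OF assms(1) open_chart_img one_form_smooth]\<close>)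

lemma one_form_grad:
  assumes "scalar_field \<A> f" shows "one_form \<A> (grad f)"
proof (rule one_formI)
  fix c x assume "c \<in> \<A>" "x \<in> chart_img c"
  then show "linear (grad f c x)"
    unfolding grad_def by (rule linear_frechet_derivative[OF scalar_field_differentiable[OF assms]])
next
  fix c v assume "c \<in> \<A>"
  then show "smooth_on (chart_img c) (\<lambda>x. grad f c x v)"
    unfolding grad_def using smooth_on_frechet_derivative scalar_field_smooth[OF assms] by blast
next
  fix c c' x v assume c: "c \<in> \<A>" "c' \<in> \<A>" "x \<in> chart_overlap c c'"
  let ?\<tau> = "transition c c'"
  have f: "f c differentiable (at x)" and f': "f c' differentiable (at (?\<tau> x))"
    using scalar_field_differentiable[OF assms] c transition_in_img chart_overlap_subset by blast+
  have "frechet_derivative (f c) (at x) = frechet_derivative (\<lambda>x. f c' (?\<tau> x)) (at x)"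
    by (rule frechet_derivative_cong_open[OF open_chart_overlap[OF c(1,2)] c(3) _ f])
       (use scalar_field_natural[OF assms c(1,2)] in simp)
  also have "\<dots> = (\<lambda>v. frechet_derivative (f c') (at (?\<tau> x)) (frechet_derivative ?\<tau> (at x) v))"
    using frechet_derivative_at[OF diff_chain_at[OF transition_has_derivative[OF c]
        differentiable_at_has_frechet_derivative[OF f']]] by (simp add: o_def)
  finally show "grad f c' (?\<tau> x) (frechet_derivative ?\<tau> (at x) v) = grad f c x v"
    by (simp add: grad_def)
qed

lemma triple_natural:
  assumes "one_form \<A> p" "one_form \<A> a" "one_form \<A> b" "c \<in> \<A>" "c' \<in> \<A>" "x \<in> chart_overlap c c'"
  shows "triple (p c x) (a c x) (b c x) e1 e2 e3
    = of_real (det (matrix (frechet_derivative (transition c c') (at x))))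
      * triple (p c' (transition c c' x)) (a c' (transition c c' x)) (b c' (transition c c' x)) e1 e2 e3"
    (is "_ = of_real (det (matrix ?D)) * _")
proof -
  have "transition c c' x \<in> chart_img c'" using transition_in_img assms by blast
  then have lin: "linear (p c' (transition c c' x))" "linear (a c' (transition c c' x))"
    "linear (b c' (transition c c' x))" using one_form_linear assms by blast+
  have "triple (p c x) (a c x) (b c x) e1 e2 e3
     = triple (p c' (transition c c' x)) (a c' (transition c c' x)) (b c' (transition c c' x))
         (?D e1) (?D e2) (?D e3)"
    unfolding triple_def using assms by (simp add: one_form_natural)
  also have "\<dots> = of_real (det (matrix ?D))
      * triple (p c' (transition c c' x)) (a c' (transition c c' x)) (b c' (transition c c' x)) e1 e2 e3"
    by (rule triple_linear_image[OF lin])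
  finally show ?thesis .
qed

lemma smooth_on_triple:
  assumes "one_form \<A> p" "one_form \<A> a" "one_form \<A> b" "c \<in> \<A>"
  shows "smooth_on (chart_img c) (\<lambda>x. triple (p c x) (a c x) (b c x) u v w)"
  unfolding triple_def
  by (intro smooth_on_add smooth_on_mult smooth_on_diff one_form_smooth open_chart_img assms)

text \<open>Coefficients of a 1-form with respect to a coframe are quotients of 3-forms by Cramer's rule
  (\<open>triple_cramer\<close>). Obtaining them in this way gives their smoothness and their independence
  of the chart at once.\<close>

lemma scalar_field_triple_ratio:
  assumes "one_form \<A> p" "one_form \<A> q" "one_form \<A> r" "one_form \<A> a" "one_form \<A> b" "one_form \<A> d"
    and "\<And>c x. c \<in> \<A> \<Longrightarrow> x \<in> chart_img c \<Longrightarrow> triple (a c x) (b c x) (d c x) e1 e2 e3 \<noteq> 0"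
  shows "scalar_field \<A> (\<lambda>c x. triple (p c x) (q c x) (r c x) e1 e2 e3
     / triple (a c x) (b c x) (d c x) e1 e2 e3)"
proof (rule scalar_fieldI)
  fix c assume "c \<in> \<A>"
  then show "smooth_on (chart_img c) (\<lambda>x. triple (p c x) (q c x) (r c x) e1 e2 e3
     / triple (a c x) (b c x) (d c x) e1 e2 e3)"
    by (intro smooth_on_divide smooth_on_triple open_chart_img assms)
next
  fix c c' x assume c: "c \<in> \<A>" "c' \<in> \<A>" "x \<in> chart_overlap c c'"
  show "triple (p c' (transition c c' x)) (q c' (transition c c' x)) (r c' (transition c c' x)) e1 e2 e3
     / triple (a c' (transition c c' x)) (b c' (transition c c' x)) (d c' (transition c c' x)) e1 e2 e3
    = triple (p c x) (q c x) (r c x) e1 e2 e3 / triple (a c x) (b c x) (d c x) e1 e2 e3"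
    unfolding triple_natural[OF assms(1-3) c] triple_natural[OF assms(4-6) c]
    using det_transition[OF c] by simp
qed

lemma ext_d_linear:
  assumes "one_form \<A> a" "c \<in> \<A>" "x \<in> chart_img c" shows "linear (ext_d a c x u)"
proof -
  note lin = one_form_linear[OF assms(1,2)] and diff = one_form_differentiable[OF assms]
  have 1: "linear (\<lambda>v. frechet_derivative (\<lambda>y. a c y u) (at x) v)"
    using linear_frechet_derivative[OF diff] .
  have 2: "linear (\<lambda>v. frechet_derivative (\<lambda>y. a c y v) (at x) u)"
  proof (rule linearI)
    fix v w
    have "frechet_derivative (\<lambda>y. a c y (v + w)) (at x) = frechet_derivative (\<lambda>y. a c y v + a c y w) (at x)"
      by (rule frechet_derivative_cong_open[OF open_chart_img[OF assms(2)] assms(3) _ diff])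
         (simp add: lin linear_add)
    then show "frechet_derivative (\<lambda>y. a c y (v + w)) (at x) u
      = frechet_derivative (\<lambda>y. a c y v) (at x) u + frechet_derivative (\<lambda>y. a c y w) (at x) u"
      by (simp add: frechet_derivative_add diff)
  next
    fix k v
    have "frechet_derivative (\<lambda>y. a c y (k *\<^sub>R v)) (at x) = frechet_derivative (\<lambda>y. k *\<^sub>R a c y v) (at x)"
      by (rule frechet_derivative_cong_open[OF open_chart_img[OF assms(2)] assms(3) _ diff])
         (simp add: lin linear_scale)
    then show "frechet_derivative (\<lambda>y. a c y (k *\<^sub>R v)) (at x) u
      = k *\<^sub>R frechet_derivative (\<lambda>y. a c y v) (at x) u"
      by (simp add: frechet_derivative_bounded_linear[OF bounded_linear_scaleR_right diff])
  qed
  show ?thesis unfolding ext_d_def by (rule linear_compose_sub[OF 2 1])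
qed

lemma ext_d_antisym: "ext_d a c x u v = - ext_d a c x v u"
  by (simp add: ext_d_def)

lemma ext_d_add:
  assumes "one_form \<A> a" "one_form \<A> b" "c \<in> \<A>" "x \<in> chart_img c"
  shows "ext_d (add_form a b) c x u v = ext_d a c x u v + ext_d b c x u v"
  unfolding ext_d_def add_form_def
  by (simp add: frechet_derivative_add one_form_differentiable assms)

lemma ext_d_scale:
  assumes "scalar_field \<A> f" "one_form \<A> a" "c \<in> \<A>" "x \<in> chart_img c"
  shows "ext_d (scale_form f a) c x u v = wedge11 (grad f) a c x u v + f c x * ext_d a c x u v"
  unfolding ext_d_def scale_form_def wedge11_def grad_def
  by (simp add: frechet_derivative_mult one_form_differentiable scalar_field_differentiable assms
      algebra_simps)

lemma ext_d_map:
  assumes "bounded_linear L" "one_form \<A> a" "c \<in> \<A>" "x \<in> chart_img c"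
  shows "ext_d (map_form L a) c x u v = L (ext_d a c x u v)"
  unfolding ext_d_def map_form_def
  by (simp add: frechet_derivative_bounded_linear[OF assms(1)] one_form_differentiable assms
      linear_diff[OF bounded_linear.linear[OF assms(1)]])

lemma ext_d_grad:
  fixes f :: "'a chart \<Rightarrow> real^3 \<Rightarrow> 'b::{real_normed_field, euclidean_space}"
  assumes "scalar_field \<A> f" "c \<in> \<A>" "x \<in> chart_img c"
  shows "ext_d (grad f) c x u v = 0"
  unfolding ext_d_def grad_def
  using second_derivative_symmetric[OF open_chart_img[OF assms(2)] scalar_field_smooth[OF assms(1,2)] assms(3)]
  by simp

lemma ext_d_cong:
  assumes "\<And>x v. x \<in> chart_img c \<Longrightarrow> a c x v = b c x v" "one_form \<A> a" "c \<in> \<A>" "x \<in> chart_img c"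
  shows "ext_d a c x u v = ext_d b c x u v"
proof -
  have "frechet_derivative (\<lambda>y. a c y w) (at x) = frechet_derivative (\<lambda>y. b c y w) (at x)" for w
    by (rule frechet_derivative_cong_open[OF open_chart_img[OF assms(3)] assms(4) _
          one_form_differentiable[OF assms(2-4)]]) (rule assms(1))
  then show ?thesis by (simp add: ext_d_def)
qed

lemma continuous_on_wedge_ext_d:
  assumes "one_form \<A> a" "one_form \<A> b" "c \<in> \<A>"
  shows "continuous_on (chart_img c) (coeff3 (wedge12 a (ext_d b)) c)"
  unfolding coeff3_def wedge12_def ext_d_def
  by (intro smooth_on_imp_continuous_on smooth_on_mult smooth_on_add smooth_on_diff open_chart_img
      smooth_on_frechet_derivative one_form_smooth assms)

text \<open>If \<open>d\<omega> = p \<and> q\<close>, then \<open>0 = d(d\<omega>) = dp \<and> q - p \<and> dq\<close>, by the symmetry of second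
  derivatives.\<close>

lemma ext_d_ext_d:
  fixes \<omega> p q :: "('a, 'b::{real_normed_field, euclidean_space}) form1"
  assumes "one_form \<A> \<omega>" "one_form \<A> p" "one_form \<A> q"
    and "field_eq \<A> (ext_d \<omega>) (wedge11 p q)" and c: "c \<in> \<A>" "x \<in> chart_img c"
  shows "coeff3 (wedge12 q (ext_d p)) c x = coeff3 (wedge12 p (ext_d q)) c x"
proof -
  let ?D = "\<lambda>f v. frechet_derivative f (at x) v"
  note op = open_chart_img[OF c(1)]
  have dd: "?D (\<lambda>y. ext_d \<omega> c y u v) w
     = ?D (\<lambda>y. frechet_derivative (\<lambda>z. \<omega> c z v) (at y) u) w - ?D (\<lambda>y. frechet_derivative (\<lambda>z. \<omega> c z u) (at y) v) w"
    for u v w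
    unfolding ext_d_def
    by (intro frechet_derivative_diff smooth_on_imp_differentiable[OF smooth_on_frechet_derivative[OF
          one_form_smooth[OF assms(1) c(1)]] c(2)])
  have sym: "?D (\<lambda>y. frechet_derivative (\<lambda>z. \<omega> c z v) (at y) u) w = ?D (\<lambda>y. frechet_derivative (\<lambda>z. \<omega> c z v) (at y) w) u"
    for u v w by (rule second_derivative_symmetric[OF op one_form_smooth[OF assms(1) c(1)] c(2)])
  have "?D (\<lambda>y. ext_d \<omega> c y e2 e3) e1 + ?D (\<lambda>y. ext_d \<omega> c y e3 e1) e2 + ?D (\<lambda>y. ext_d \<omega> c y e1 e2) e3 = 0"
    unfolding dd using sym[of e3 e2 e1] sym[of e1 e3 e2] sym[of e2 e3 e1] by (simp add: algebra_simps)
  moreover have "?D (\<lambda>y. ext_d \<omega> c y u v) w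
     = (p c x u * ?D (\<lambda>y. q c y v) w + ?D (\<lambda>y. p c y u) w * q c x v)
       - (p c x v * ?D (\<lambda>y. q c y u) w + ?D (\<lambda>y. p c y v) w * q c x u)" for u v w
  proof -
    have "smooth_on (chart_img c) (\<lambda>y. ext_d \<omega> c y u v)"
      unfolding ext_d_def
      by (intro smooth_on_diff op smooth_on_frechet_derivative one_form_smooth assms)
    then have "?D (\<lambda>y. ext_d \<omega> c y u v) = ?D (\<lambda>y. p c y u * q c y v - p c y v * q c y u)"
      using assms(4) c
      by (intro frechet_derivative_cong_open[OF op c(2)] smooth_on_imp_differentiable)
         (auto simp: field_eq_def wedge11_def)
    then show ?thesis
      by (simp add: frechet_derivative_diff frechet_derivative_mult one_form_differentiable assms
          differentiable_mult)
  qed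
  ultimately show ?thesis
    unfolding coeff3_def wedge12_def ext_d_def by (simp add: algebra_simps)
qed

end

lemma (in closed_3manifold) scalar_field_arith:
  assumes "scalar_field \<A> f" "scalar_field \<A> g"
  shows "scalar_field \<A> (\<lambda>c x. f c x + g c x)" "scalar_field \<A> (\<lambda>c x. f c x - g c x)"
    "scalar_field \<A> (\<lambda>c x. f c x * g c x)"
  using assms unfolding scalar_field_def
  by (auto intro: smooth_on_add smooth_on_diff smooth_on_mult open_chart_img)

lemma (in closed_3manifold) scalar_field_inverse:
  assumes "scalar_field \<A> f" "\<And>c x. c \<in> \<A> \<Longrightarrow> x \<in> chart_img c \<Longrightarrow> f c x \<noteq> 0"
  shows "scalar_field \<A> (\<lambda>c x. inverse (f c x))"
  using assms unfolding scalar_field_def by (auto intro: smooth_on_inverse open_chart_img)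

lemma (in closed_3manifold) scalar_field_map:
  assumes "bounded_linear L" "scalar_field \<A> f"
  shows "scalar_field \<A> (\<lambda>c x. L (f c x))"
  using assms unfolding scalar_field_def by (auto intro: smooth_on_bounded_linear open_chart_img)

text \<open>This is \<open>d(df / f) = - (df \<and> df) / f\<^sup>2 = 0\<close>.\<close>

lemma (in closed_3manifold) ext_d_log_deriv:
  fixes f :: "'a chart \<Rightarrow> real^3 \<Rightarrow> 'b::{real_normed_field, euclidean_space}"
  assumes f: "scalar_field \<A> f" and nz: "\<And>c x. c \<in> \<A> \<Longrightarrow> x \<in> chart_img c \<Longrightarrow> f c x \<noteq> 0"
    and c: "c \<in> \<A>" "x \<in> chart_img c"
  shows "ext_d (scale_form (\<lambda>c x. inverse (f c x)) (grad f)) c x u v = 0"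
proof -
  note inv = scalar_field_inverse[OF f nz]
  have "grad (\<lambda>c x. inverse (f c x)) c x v = - (inverse (f c x) * grad f c x v * inverse (f c x))" for v
    unfolding grad_def
    using frechet_derivative_at[OF Deriv.has_derivative_inverse[OF nz[OF c]
        differentiable_at_has_frechet_derivative[OF scalar_field_differentiable[OF f c]]]]
    by (metis (no_types, lifting))
  moreover have "ext_d (scale_form (\<lambda>c x. inverse (f c x)) (grad f)) c x u v
      = wedge11 (grad (\<lambda>c x. inverse (f c x))) (grad f) c x u v + inverse (f c x) * ext_d (grad f) c x u v"
    by (rule ext_d_scale[OF inv one_form_grad[OF f] c])
  ultimately show ?thesis using ext_d_grad[OF f c] by (simp add: wedge11_def)
qed

section \<open>Stokes' theorem\<close>

lemma continuous_on_extend_by_zero: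
  fixes f :: "'a::t2_space \<Rightarrow> 'b::real_normed_vector"
  assumes "open U" "compact K" "continuous_on U f" "\<And>x. x \<in> U - K \<Longrightarrow> f x = 0" "K \<subseteq> U"
  shows "continuous_on UNIV (\<lambda>x. if x \<in> U then f x else 0)" (is "continuous_on _ ?g")
proof -
  have K: "open (-K)" using compact_imp_closed[OF assms(2)] by (rule open_Compl)
  have "continuous_on U ?g" using assms(3) by (rule continuous_on_eq) simp
  moreover have "continuous_on (-K) ?g"
    by (rule continuous_on_eq[OF continuous_on_const[of _ 0]]) (use assms(4) in auto)
  ultimately have "continuous_on (U \<union> -K) ?g" by (intro continuous_on_open_Un assms(1) K)
  moreover have "U \<union> -K = UNIV" using assms(5) by blast
  ultimately show ?thesis by simp
qed

lemma absolutely_integrable_compact_support: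
  fixes f :: "'a::euclidean_space \<Rightarrow> 'b::euclidean_space"
  assumes "open U" "compact K" "continuous_on U f" "\<And>x. x \<in> U - K \<Longrightarrow> f x = 0" "K \<subseteq> U"
  shows "f absolutely_integrable_on U"
proof -
  let ?g = "\<lambda>x. if x \<in> U then f x else 0"
  obtain a where a: "K \<subseteq> cbox (-a) a"
    using bounded_subset_cbox_symmetric[OF compact_imp_bounded[OF assms(2)]] .
  have "?g absolutely_integrable_on cbox (-a) a"
    by (intro absolutely_integrable_continuous continuous_on_subset[OF continuous_on_extend_by_zero[OF assms]]) auto
  then have "(\<lambda>x. if x \<in> cbox (-a) a then ?g x else 0) absolutely_integrable_on UNIV"
    by (simp only: absolutely_integrable_restrict_UNIV)
  also have "(\<lambda>x. if x \<in> cbox (-a) a then ?g x else 0) = ?g"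
    using assms(4) a by (auto simp: fun_eq_iff)
  finally show ?thesis by (simp only: absolutely_integrable_restrict_UNIV)
qed

text \<open>The function is only defined on \<open>U\<close>; extended by zero it is smooth everywhere.\<close>

lemma integral_derivative_compact_support:
  fixes f :: "'a::euclidean_space \<Rightarrow> real"
  assumes "open U" "compact K" "smooth_on U f" "\<And>x. x \<in> U - K \<Longrightarrow> f x = 0" "K \<subseteq> U"
  shows "((\<lambda>x. frechet_derivative f (at x) v) has_integral 0) U"
proof -
  let ?g = "\<lambda>x. if x \<in> U then f x else 0"
  have "smooth_on UNIV ?g"
  proof (rule smooth_on_locally)
    fix x :: 'a
    show "\<exists>W. open W \<and> x \<in> W \<and> smooth_on W ?g"
    proof (cases "x \<in> U")
      case True
      have "smooth_on U ?g" by (rule smooth_on_cong[OF assms(3,1)]) simp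
      then show ?thesis using assms(1) True by blast
    next
      case False
      have "open (-K)" using compact_imp_closed[OF assms(2)] by (rule open_Compl)
      moreover have "smooth_on (-K) ?g"
        by (rule smooth_on_cong[OF smooth_on_const[of _ 0] \<open>open (-K)\<close>]) (use assms(4) in auto)
      moreover have "x \<in> -K" using False assms(5) by blast
      ultimately show ?thesis by blast
    qed
  qed
  then have "((\<lambda>x. frechet_derivative ?g (at x) v) has_integral 0) UNIV"
    by (intro integral_frechet_derivative_eq_0[where K=K] assms(2) smooth_on_imp_differentiable
        smooth_on_imp_continuous_on smooth_on_frechet_derivative) (use assms(4) in auto)
  moreover have "frechet_derivative ?g (at x) v = (if x \<in> U then frechet_derivative f (at x) v else 0)" for x
  proof (cases "x \<in> U")
    case True
    then show ?thesis
      using frechet_derivative_cong_open[OF assms(1) True, of f ?g] smooth_on_imp_differentiable[OF assms(3)]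
      by simp
  next
    case False
    have "open (-K)" using compact_imp_closed[OF assms(2)] by (rule open_Compl)
    then have "frechet_derivative (\<lambda>x. 0::real) (at x) = frechet_derivative ?g (at x)"
      by (rule frechet_derivative_cong_open) (use False assms in auto)
    then show ?thesis using False by (simp add: fun_eq_iff)
  qed
  ultimately show ?thesis by (simp add: has_integral_restrict_UNIV)
qed

lemma integral_eq_superset:
  fixes f :: "'a::euclidean_space \<Rightarrow> 'b::banach"
  assumes "S \<subseteq> T" "\<And>x. x \<in> T - S \<Longrightarrow> f x = 0"
  shows "integral S f = integral T f"
proof -
  have "(\<lambda>x. if x \<in> S then f x else 0) = (\<lambda>x. if x \<in> T then f x else 0)"
    using assms by (auto simp: fun_eq_iff)
  then show ?thesis
    by (metis Henstock_Kurzweil_Integration.integral_restrict_UNIV)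
qed

lemma absolutely_integrable_superset:
  fixes f :: "'a::euclidean_space \<Rightarrow> 'b::euclidean_space"
  assumes "S \<subseteq> T" "\<And>x. x \<in> T - S \<Longrightarrow> f x = 0"
  shows "f absolutely_integrable_on S \<longleftrightarrow> f absolutely_integrable_on T"
proof -
  have "(\<lambda>x. if x \<in> S then f x else 0) = (\<lambda>x. if x \<in> T then f x else 0)"
    using assms by (auto simp: fun_eq_iff)
  then show ?thesis
    by (metis absolutely_integrable_restrict_UNIV)
qed

text \<open>A real function is regarded as a function with values in \<open>\<real>\<^sup>1\<close>, to which the change of
  variables for vector-valued functions applies.\<close>

lemma integral_change_of_variables:
  fixes f :: "real^3 \<Rightarrow> real" and g :: "real^3 \<Rightarrow> real^3"
  assumes "open S" "\<And>x. x \<in> S \<Longrightarrow> (g has_derivative g' x) (at x)" "inj_on g S"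
    and "f absolutely_integrable_on g ` S"
  shows "integral S (\<lambda>x. \<bar>det (matrix (g' x))\<bar> * f (g x)) = integral (g ` S) f"
proof -
  let ?f = "\<lambda>x. vec (f x) :: real^1"
  have S: "S \<in> sets lebesgue" using borel_open[OF assms(1)] by (simp add: sets_completionI_sets)
  have d: "(g has_derivative g' x) (at x within S)" if "x \<in> S" for x
    using assms(2)[OF that] by (rule has_derivative_at_withinI)
  have "?f absolutely_integrable_on g ` S"
    using assms(4) by (simp add: absolutely_integrable_on_1_iff)
  then have "integral S (\<lambda>x. \<bar>det (matrix (g' x))\<bar> *\<^sub>R ?f (g x)) = integral (g ` S) ?f"
    using has_absolute_integral_change_of_variables[OF S d assms(3), of ?f "integral (g ` S) ?f"] by blast
  then show ?thesis by (simp add: integral_on_1_eq vec_eq_iff)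
qed

context closed_3manifold
begin

text \<open>The partition of unity that \<open>manifold_integral\<close> picks.\<close>

definition "pou_charts = fst (SOME P. partition_of_unity M \<A> P)"
definition "pou_fun = snd (SOME P. partition_of_unity M \<A> P)"

definition pou :: "'a chart \<Rightarrow> 'a chart \<Rightarrow> real^3 \<Rightarrow> real" where
  "pou d = (\<lambda>c x. pou_fun d (chart_inv c x))"

definition pou_support :: "'a chart \<Rightarrow> 'a chart \<Rightarrow> (real^3) set" where
  "pou_support d c = chart_map c ` (chart_dom c \<inter> M closure_of {p \<in> topspace M. pou_fun d p \<noteq> 0})"

lemma partition_of_unity_pou: "partition_of_unity M \<A> (pou_charts, pou_fun)"
  using someI_ex[OF partition_of_unity_exists] by (simp add: pou_charts_def pou_fun_def)

lemma finite_pou_charts: "finite pou_charts" and pou_charts_subset: "d \<in> pou_charts \<Longrightarrow> d \<in> \<A>"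
  using partition_of_unity_pou by (auto simp: partition_of_unity_def)

lemma manifold_integral_eq:
  "manifold_integral M \<A> \<Omega>
    = (\<Sum>d\<in>pou_charts. integral (chart_img d) (\<lambda>x. pou d d x *\<^sub>R coeff3 \<Omega> d x))"
  by (simp add: manifold_integral_def pou_charts_def pou_def pou_fun_def coeff3_def case_prod_beta)

lemma smooth_on_pou: "d \<in> pou_charts \<Longrightarrow> c \<in> \<A> \<Longrightarrow> smooth_on (chart_img c) (pou d c)"
  using partition_of_unity_pou unfolding partition_of_unity_def prod.case pou_def o_def by blast

lemma scalar_field_pou: "d \<in> pou_charts \<Longrightarrow> scalar_field \<A> (pou d)"
  by (rule scalar_fieldI) (simp_all add: smooth_on_pou, simp add: pou_def chart_inv_transition)

lemma sum_pou: "c \<in> \<A> \<Longrightarrow> x \<in> chart_img c \<Longrightarrow> (\<Sum>d\<in>pou_charts. pou d c x) = 1"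
  using partition_of_unity_pou chart_dom_subset[of c] chart_inv_in_dom[of x c]
  unfolding partition_of_unity_def prod.case pou_def by blast

lemma pou_closure_subset:
  "d \<in> pou_charts \<Longrightarrow> M closure_of {p \<in> topspace M. pou_fun d p \<noteq> 0} \<subseteq> chart_dom d"
  using partition_of_unity_pou unfolding partition_of_unity_def prod.case by blast

lemma pou_eq_0:
  assumes "c \<in> \<A>" "x \<in> chart_img c" "x \<notin> pou_support d c" shows "pou d c x = 0"
proof (rule ccontr)
  assume n: "pou d c x \<noteq> 0"
  have t: "chart_inv c x \<in> topspace M"
    using chart_dom_subset[OF assms(1)] chart_inv_in_dom[OF assms(2)] by blast
  have "{p \<in> topspace M. pou_fun d p \<noteq> 0} \<subseteq> M closure_of {p \<in> topspace M. pou_fun d p \<noteq> 0}"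
    by (rule closure_of_subset) auto
  then have "chart_inv c x \<in> M closure_of {p \<in> topspace M. pou_fun d p \<noteq> 0}"
    using n t by (auto simp: pou_def)
  then have "x \<in> pou_support d c"
    unfolding pou_support_def using assms(2) by (intro image_eqI[where x="chart_inv c x"]) auto
  then show False using assms(3) by simp
qed

lemma open_pou_support_complement:
  assumes "c \<in> \<A>" shows "open (chart_img c - pou_support d c)"
proof -
  let ?C = "M closure_of {p \<in> topspace M. pou_fun d p \<noteq> 0}"
  have "chart_img c - pou_support d c = chart_map c ` (chart_dom c - ?C)"
    unfolding chart_img_def pou_support_def using inj_on_chart[OF assms] by (auto simp: inj_on_def)
  moreover have "open (chart_map c ` (chart_dom c - ?C))"
    by (rule open_chart_image[OF assms openin_diff[OF openin_chart_dom[OF assms] closedin_closure_of]]) auto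
  ultimately show ?thesis by simp
qed

text \<open>The support is closed, so the function vanishes in a neighbourhood of every point outside it.\<close>

lemma grad_pou_eq_0:
  assumes "c \<in> \<A>" "x \<in> chart_img c" "x \<notin> pou_support d c" shows "grad (pou d) c x v = 0"
proof -
  have "frechet_derivative (\<lambda>x. 0::real) (at x) = frechet_derivative (pou d c) (at x)"
    by (rule frechet_derivative_cong_open[OF open_pou_support_complement[OF assms(1)]])
       (use assms(2,3) pou_eq_0[OF assms(1), of _ d] in auto)
  then show ?thesis by (simp add: grad_def fun_eq_iff)
qed

lemma compact_pou_support: "d \<in> pou_charts \<Longrightarrow> compact (pou_support d d)"
  and pou_support_subset: "d \<in> pou_charts \<Longrightarrow> pou_support d d \<subseteq> chart_img d"
  and pou_support_overlap: "d \<in> pou_charts \<Longrightarrow> c \<in> \<A> \<Longrightarrow> pou_support d c \<subseteq> chart_overlap c d"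
proof -
  assume d: "d \<in> pou_charts"
  note sub = pou_closure_subset[OF d]
  have "chart_dom d \<inter> M closure_of {p \<in> topspace M. pou_fun d p \<noteq> 0} = M closure_of {p \<in> topspace M. pou_fun d p \<noteq> 0}"
    using sub by blast
  then show "compact (pou_support d d)"
    unfolding pou_support_def using compact_chart_image[OF pou_charts_subset[OF d] closedin_closure_of sub] by simp
  show "pou_support d d \<subseteq> chart_img d" by (auto simp: pou_support_def)
  show "pou_support d c \<subseteq> chart_overlap c d" if "c \<in> \<A>"
    unfolding pou_support_def chart_overlap_def using sub by blast
qed

lemma absolutely_integrable_pou:
  fixes f :: "real^3 \<Rightarrow> 'b::euclidean_space"
  assumes "d \<in> pou_charts" "continuous_on (chart_img d) f"
    and "\<And>x. x \<in> chart_img d - pou_support d d \<Longrightarrow> f x = 0"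
  shows "f absolutely_integrable_on chart_img d"
  using absolutely_integrable_compact_support[OF open_chart_img compact_pou_support] assms
    pou_charts_subset pou_support_subset by blast

text \<open>The divergence of \<open>\<rho> (a \<times> b)\<close> integrates to 0 over the chart that contains the support of \<open>\<rho>\<close>.\<close>

lemma stokes_in_chart:
  fixes a b :: "('a, real) form1"
  assumes a: "one_form \<A> a" and b: "one_form \<A> b" and d: "d \<in> pou_charts"
  shows "integral (chart_img d) (\<lambda>x. pou d d x * coeff3 (wedge12 a (ext_d b)) d x)
    - integral (chart_img d) (\<lambda>x. pou d d x * coeff3 (wedge12 b (ext_d a)) d x)
    = integral (chart_img d) (\<lambda>x. triple (grad (pou d) d x) (a d x) (b d x) e1 e2 e3)"
proof -
  note dA = pou_charts_subset[OF d]
  note op = open_chart_img[OF dA]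
  note sm = smooth_on_pou[OF d dA] one_form_smooth[OF a dA] one_form_smooth[OF b dA]
  define F where "F u v = (\<lambda>x. pou d d x * (a d x u * b d x v - a d x v * b d x u))" for u v
  have F: "((\<lambda>x. frechet_derivative (F u v) (at x) w) has_integral 0) (chart_img d)" for u v w
  proof (rule integral_derivative_compact_support[OF op compact_pou_support[OF d]])
    show "smooth_on (chart_img d) (F u v)"
      unfolding F_def by (intro smooth_on_mult smooth_on_diff op sm)
    show "F u v x = 0" if "x \<in> chart_img d - pou_support d d" for x
      using pou_eq_0[OF dA] that by (simp add: F_def)
  qed (rule pou_support_subset[OF d])
  let ?D = "\<lambda>x. frechet_derivative (F e2 e3) (at x) e1 + frechet_derivative (F e3 e1) (at x) e2
    + frechet_derivative (F e1 e2) (at x) e3"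
  have D: "(?D has_integral 0) (chart_img d)"
    using has_integral_add[OF has_integral_add[OF F[of e2 e3 e1] F[of e3 e1 e2]] F[of e1 e2 e3]] by simp
  let ?P = "\<lambda>x. pou d d x * coeff3 (wedge12 a (ext_d b)) d x"
  let ?Q = "\<lambda>x. pou d d x * coeff3 (wedge12 b (ext_d a)) d x"
  let ?T = "\<lambda>x. triple (grad (pou d) d x) (a d x) (b d x) e1 e2 e3"
  have dF: "frechet_derivative (F u v) (at x) w =
      pou d d x * ((a d x u * frechet_derivative (\<lambda>y. b d y v) (at x) w
           + frechet_derivative (\<lambda>y. a d y u) (at x) w * b d x v)
         - (a d x v * frechet_derivative (\<lambda>y. b d y u) (at x) w
           + frechet_derivative (\<lambda>y. a d y v) (at x) w * b d x u))
      + grad (pou d) d x w * (a d x u * b d x v - a d x v * b d x u)"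
    if x: "x \<in> chart_img d" for x u v w
    unfolding F_def grad_def
    by (simp add: frechet_derivative_mult frechet_derivative_diff differentiable_mult differentiable_diff
        sm[THEN smooth_on_imp_differentiable, OF x])
  have eq: "?D x = ?T x - (?P x - ?Q x)" if x: "x \<in> chart_img d" for x
    unfolding dF[OF x] coeff3_def wedge12_def ext_d_def triple_def by (simp add: algebra_simps)
  have "?P absolutely_integrable_on chart_img d" "?Q absolutely_integrable_on chart_img d"
    using continuous_on_wedge_ext_d[OF a b dA] continuous_on_wedge_ext_d[OF b a dA]
      pou_eq_0[OF dA, of _ d] smooth_on_imp_continuous_on[OF sm(1)]
    by (auto intro!: absolutely_integrable_pou[OF d] continuous_on_mult)
  then have PQ: "?P integrable_on chart_img d" "?Q integrable_on chart_img d"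
    by (simp_all add: absolutely_integrable_on_def)
  have "(?T has_integral (0 + (integral (chart_img d) ?P - integral (chart_img d) ?Q))) (chart_img d)"
    by (rule has_integral_eq[OF _ has_integral_add[OF D has_integral_diff[OF
            integrable_integral[OF PQ(1)] integrable_integral[OF PQ(2)]]]])
       (use eq in simp)
  then show ?thesis by (simp add: integral_unique)
qed

text \<open>The remaining terms cancel in the sum over the charts: inserting \<open>1 = \<Sum> \<rho>\<^sub>c\<close>, each of them becomes
  an integral over an overlap, which can be computed in either chart; and \<open>\<Sum> d\<rho>\<^sub>d = 0\<close>.\<close>

lemma integral_overlap:
  fixes a b :: "('a, real) form1"
  assumes "one_form \<A> a" "one_form \<A> b" and c: "c \<in> pou_charts" and d: "d \<in> pou_charts"
  shows "integral (chart_img d) (\<lambda>x. pou c d x * triple (grad (pou d) d x) (a d x) (b d x) e1 e2 e3)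
    = integral (chart_img c) (\<lambda>x. pou c c x * triple (grad (pou d) c x) (a c x) (b c x) e1 e2 e3)"
    (is "integral _ (?f d) = integral _ (?f c)")
proof -
  note cA = pou_charts_subset[OF c] and dA = pou_charts_subset[OF d]
  note forms = one_form_grad[OF scalar_field_pou[OF d]] assms(1,2)
  have z: "?f c x = 0" if "x \<in> chart_img c - chart_overlap c d" for x
  proof -
    have "x \<notin> pou_support d c" using pou_support_overlap[OF d cA] that by blast
    then show ?thesis using grad_pou_eq_0[OF cA, of x d] that by (simp add: triple_def)
  qed
  have z': "?f d x = 0" if "x \<in> chart_img d - chart_overlap d c" for x
  proof -
    have "x \<notin> pou_support c d" using pou_support_overlap[OF c dA] that by blast
    then show ?thesis using pou_eq_0[OF dA, of x c] that by simp
  qed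
  have "?f c absolutely_integrable_on chart_img c"
  proof (rule absolutely_integrable_pou[OF c])
    show "continuous_on (chart_img c) (?f c)"
      by (intro smooth_on_imp_continuous_on smooth_on_mult smooth_on_pou smooth_on_triple
          open_chart_img c cA forms)
  qed (use pou_eq_0[OF cA] in simp)
  moreover have "?f c absolutely_integrable_on chart_overlap c d \<longleftrightarrow> ?f c absolutely_integrable_on chart_img c"
    by (rule absolutely_integrable_superset[OF chart_overlap_subset]) (rule z)
  ultimately have "?f c absolutely_integrable_on chart_overlap c d" by simp
  then have i: "?f c absolutely_integrable_on transition d c ` chart_overlap d c"
    unfolding transition_image[OF dA cA] .
  have "integral (chart_img d) (?f d) = integral (chart_overlap d c) (?f d)"
    by (rule integral_eq_superset[OF chart_overlap_subset, symmetric]) (rule z')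
  also have "\<dots> = integral (chart_overlap d c)
      (\<lambda>x. \<bar>det (matrix (frechet_derivative (transition d c) (at x)))\<bar> * ?f c (transition d c x))"
  proof (rule integral_cong)
    fix x assume x: "x \<in> chart_overlap d c"
    show "?f d x = \<bar>det (matrix (frechet_derivative (transition d c) (at x)))\<bar> * ?f c (transition d c x)"
      using triple_natural[OF forms dA cA x] scalar_field_natural[OF scalar_field_pou[OF c] dA cA x]
        det_transition[OF dA cA x] by simp
  qed
  also have "\<dots> = integral (transition d c ` chart_overlap d c) (?f c)"
    by (rule integral_change_of_variables[OF open_chart_overlap[OF dA cA]
          transition_has_derivative[OF dA cA] inj_on_transition[OF dA cA] i])
  also have "\<dots> = integral (chart_img c) (?f c)"
    unfolding transition_image[OF dA cA]
    by (rule integral_eq_superset[OF chart_overlap_subset]) (rule z)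
  finally show ?thesis .
qed

text \<open>Stokes' theorem for the 2-form \<open>a \<and> b\<close>, since \<open>d(a \<and> b) = b \<and> da - a \<and> db\<close>.\<close>

lemma stokes_real:
  fixes a b :: "('a, real) form1"
  assumes a: "one_form \<A> a" and b: "one_form \<A> b"
  shows "manifold_integral M \<A> (wedge12 a (ext_d b)) = manifold_integral M \<A> (wedge12 b (ext_d a))"
proof -
  let ?T = "\<lambda>d c x. triple (grad (pou d) c x) (a c x) (b c x) e1 e2 e3"
  have cont: "continuous_on (chart_img c) (\<lambda>x. pou k c x * ?T d c x)"
    if "d \<in> pou_charts" "k \<in> pou_charts" "c \<in> \<A>" for c d k
    by (intro smooth_on_imp_continuous_on smooth_on_mult smooth_on_pou smooth_on_triple
          open_chart_img one_form_grad scalar_field_pou that assms)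
  have int1: "(\<lambda>x. pou k d x * ?T d d x) integrable_on chart_img d"
    if "d \<in> pou_charts" "k \<in> pou_charts" for d k
  proof -
    have "(\<lambda>x. pou k d x * ?T d d x) absolutely_integrable_on chart_img d"
      by (rule absolutely_integrable_pou[OF that(1) cont[OF that pou_charts_subset[OF that(1)]]])
         (use grad_pou_eq_0[OF pou_charts_subset[OF that(1)]] in \<open>simp add: triple_def\<close>)
    then show ?thesis by (simp add: absolutely_integrable_on_def)
  qed
  have int2: "(\<lambda>x. pou c c x * ?T d c x) integrable_on chart_img c"
    if "d \<in> pou_charts" "c \<in> pou_charts" for d c
  proof -
    have "(\<lambda>x. pou c c x * ?T d c x) absolutely_integrable_on chart_img c"
      by (rule absolutely_integrable_pou[OF that(2) cont[OF that pou_charts_subset[OF that(2)]]])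
         (use pou_eq_0[OF pou_charts_subset[OF that(2)]] in simp)
    then show ?thesis by (simp add: absolutely_integrable_on_def)
  qed
  have sum0: "(\<Sum>d\<in>pou_charts. grad (pou d) c x v) = 0" if "c \<in> \<A>" "x \<in> chart_img c" for c x v
  proof -
    have diff: "pou d c differentiable (at x)" if "d \<in> pou_charts" for d
      using smooth_on_imp_differentiable[OF smooth_on_pou] that \<open>c \<in> \<A>\<close> \<open>x \<in> chart_img c\<close> by blast
    have "((\<lambda>y. \<Sum>d\<in>pou_charts. pou d c y) has_derivative (\<lambda>v. \<Sum>d\<in>pou_charts. grad (pou d) c x v)) (at x)"
      unfolding grad_def by (intro has_derivative_sum differentiable_at_has_frechet_derivative diff)
    then have "((\<lambda>y. 1) has_derivative (\<lambda>v. \<Sum>d\<in>pou_charts. grad (pou d) c x v)) (at x)"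
      by (rule has_derivative_transform_within_open[OF _ open_chart_img[OF that(1)] that(2)])
         (use sum_pou[OF that(1)] in simp)
    from has_derivative_unique[OF this has_derivative_const] show ?thesis by (simp add: fun_eq_iff)
  qed
  have "manifold_integral M \<A> (wedge12 a (ext_d b)) - manifold_integral M \<A> (wedge12 b (ext_d a))
     = (\<Sum>d\<in>pou_charts. integral (chart_img d) (?T d d))"
    unfolding manifold_integral_eq by (simp add: sum_subtractf[symmetric] stokes_in_chart[OF a b])
  also have "\<dots> = (\<Sum>d\<in>pou_charts. \<Sum>c\<in>pou_charts. integral (chart_img d) (\<lambda>x. pou c d x * ?T d d x))"
  proof (rule sum.cong[OF refl])
    fix d assume d: "d \<in> pou_charts"
    have "integral (chart_img d) (?T d d) = integral (chart_img d) (\<lambda>x. \<Sum>c\<in>pou_charts. pou c d x * ?T d d x)"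
      by (rule integral_cong)
         (simp add: sum_distrib_right[symmetric] sum_pou[OF pou_charts_subset[OF d]])
    also have "\<dots> = (\<Sum>c\<in>pou_charts. integral (chart_img d) (\<lambda>x. pou c d x * ?T d d x))"
      by (rule Henstock_Kurzweil_Integration.integral_sum[OF finite_pou_charts int1[OF d]])
    finally show "integral (chart_img d) (?T d d) = \<dots>" .
  qed
  also have "\<dots> = (\<Sum>d\<in>pou_charts. \<Sum>c\<in>pou_charts. integral (chart_img c) (\<lambda>x. pou c c x * ?T d c x))"
    by (intro sum.cong refl integral_overlap a b)
  also have "\<dots> = (\<Sum>c\<in>pou_charts. \<Sum>d\<in>pou_charts. integral (chart_img c) (\<lambda>x. pou c c x * ?T d c x))"
    by (rule sum.swap)
  also have "\<dots> = (\<Sum>c\<in>pou_charts. 0)"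
  proof (rule sum.cong[OF refl])
    fix c assume c: "c \<in> pou_charts"
    have "(\<Sum>d\<in>pou_charts. integral (chart_img c) (\<lambda>x. pou c c x * ?T d c x))
      = integral (chart_img c) (\<lambda>x. \<Sum>d\<in>pou_charts. pou c c x * ?T d c x)"
      by (rule Henstock_Kurzweil_Integration.integral_sum[OF finite_pou_charts int2[OF _ c], symmetric])
    also have "\<dots> = integral (chart_img c) (\<lambda>x. 0)"
      by (rule integral_cong)
         (simp add: triple_def sum_distrib_left[symmetric] sum_distrib_right[symmetric] sum.distrib
           sum0[OF pou_charts_subset[OF c]])
    finally show "(\<Sum>d\<in>pou_charts. integral (chart_img c) (\<lambda>x. pou c c x * ?T d c x)) = 0" by simp
  qed
  finally show ?thesis by simp
qed

end

context closed_3manifold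
begin

lemma manifold_integral_cong:
  assumes "\<And>c x. c \<in> \<A> \<Longrightarrow> x \<in> chart_img c \<Longrightarrow> coeff3 \<Omega> c x = coeff3 \<Omega>' c x"
  shows "manifold_integral M \<A> \<Omega> = manifold_integral M \<A> \<Omega>'"
  unfolding manifold_integral_eq
  by (intro sum.cong refl integral_cong) (simp add: assms pou_charts_subset)

lemma integrable_pou_scaleR:
  fixes f :: "real^3 \<Rightarrow> 'b::euclidean_space"
  assumes "d \<in> pou_charts" "continuous_on (chart_img d) f"
  shows "(\<lambda>x. pou d d x *\<^sub>R f x) integrable_on chart_img d"
proof -
  note dA = pou_charts_subset[OF assms(1)]
  have "(\<lambda>x. pou d d x *\<^sub>R f x) absolutely_integrable_on chart_img d"
    using pou_eq_0[OF dA, of _ d] smooth_on_imp_continuous_on[OF smooth_on_pou[OF assms(1) dA]] assms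
    by (intro absolutely_integrable_pou[OF assms(1)] continuous_on_scaleR) auto
  then show ?thesis by (simp add: absolutely_integrable_on_def)
qed

lemma manifold_integral_map:
  fixes \<Omega> :: "('a, 'b::{banach, real_normed_field, euclidean_space}) form3"
    and L :: "'b \<Rightarrow> 'd::{banach, real_normed_field}"
  assumes "bounded_linear L" "\<And>c. c \<in> \<A> \<Longrightarrow> continuous_on (chart_img c) (coeff3 \<Omega> c)"
  shows "manifold_integral M \<A> (\<lambda>c x u v w. L (\<Omega> c x u v w)) = L (manifold_integral M \<A> \<Omega>)"
proof -
  have "integral (chart_img d) (\<lambda>x. pou d d x *\<^sub>R L (coeff3 \<Omega> d x))
     = L (integral (chart_img d) (\<lambda>x. pou d d x *\<^sub>R coeff3 \<Omega> d x))" if "d \<in> pou_charts" for d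
    using integral_linear[OF integrable_pou_scaleR[OF that assms(2)[OF pou_charts_subset[OF that]]] assms(1)]
    by (simp add: o_def linear_scale[OF bounded_linear.linear[OF assms(1)]])
  then show ?thesis
    unfolding manifold_integral_eq linear_sum[OF bounded_linear.linear[OF assms(1)]]
    by (intro sum.cong refl) (simp add: coeff3_def)
qed

lemma manifold_integral_add:
  fixes \<Omega> \<Omega>' :: "('a, 'b::{banach, real_normed_field, euclidean_space}) form3"
  assumes "\<And>c. c \<in> \<A> \<Longrightarrow> continuous_on (chart_img c) (coeff3 \<Omega> c)"
    and "\<And>c. c \<in> \<A> \<Longrightarrow> continuous_on (chart_img c) (coeff3 \<Omega>' c)"
  shows "manifold_integral M \<A> (\<lambda>c x u v w. \<Omega> c x u v w + \<Omega>' c x u v w)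
    = manifold_integral M \<A> \<Omega> + manifold_integral M \<A> \<Omega>'"
proof -
  have "integral (chart_img d) (\<lambda>x. pou d d x *\<^sub>R (coeff3 \<Omega> d x + coeff3 \<Omega>' d x))
     = integral (chart_img d) (\<lambda>x. pou d d x *\<^sub>R coeff3 \<Omega> d x)
       + integral (chart_img d) (\<lambda>x. pou d d x *\<^sub>R coeff3 \<Omega>' d x)" if "d \<in> pou_charts" for d
    unfolding scaleR_add_right using assms[OF pou_charts_subset[OF that]]
    by (intro Henstock_Kurzweil_Integration.integral_add integrable_pou_scaleR that) auto
  then show ?thesis
    unfolding manifold_integral_eq sum.distrib[symmetric]
    by (intro sum.cong refl) (simp add: coeff3_def)
qed

text \<open>Both sides are complex bilinear in \<open>(a, b)\<close>, so the real case applies to the real and imaginary parts.\<close>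

lemma stokes_complex:
  fixes a b :: "('a, complex) form1"
  assumes a: "one_form \<A> a" and b: "one_form \<A> b"
  shows "manifold_integral M \<A> (wedge12 a (ext_d b)) = manifold_integral M \<A> (wedge12 b (ext_d a))"
proof -
  note forms = one_form_map[OF bounded_linear_Re] one_form_map[OF bounded_linear_Im]
  let ?R = "map_form Re :: ('a, complex) form1 \<Rightarrow> ('a, real) form1"
  let ?I = "map_form Im :: ('a, complex) form1 \<Rightarrow> ('a, real) form1"
  have neg: "manifold_integral M \<A> (\<lambda>c x u v w. - \<Omega> c x u v w) = - manifold_integral M \<A> \<Omega>"
    if "\<And>c. c \<in> \<A> \<Longrightarrow> continuous_on (chart_img c) (coeff3 \<Omega> c)" for \<Omega> :: "('a, real) form3"
    using manifold_integral_map[OF bounded_linear_minus[OF bounded_linear_ident] that] .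
  have Re: "Re (manifold_integral M \<A> (wedge12 a (ext_d b)))
      = manifold_integral M \<A> (wedge12 (?R a) (ext_d (?R b))) - manifold_integral M \<A> (wedge12 (?I a) (ext_d (?I b)))"
    if a: "one_form \<A> a" and b: "one_form \<A> b" for a b :: "('a, complex) form1"
  proof -
    note c1 = continuous_on_wedge_ext_d[OF forms(1)[OF a] forms(1)[OF b]]
      and c2 = continuous_on_wedge_ext_d[OF forms(2)[OF a] forms(2)[OF b]]
    have "Re (manifold_integral M \<A> (wedge12 a (ext_d b)))
      = manifold_integral M \<A> (\<lambda>c x u v w. Re (wedge12 a (ext_d b) c x u v w))"
      by (rule manifold_integral_map[OF bounded_linear_Re continuous_on_wedge_ext_d[OF a b], symmetric])
    also have "\<dots> = manifold_integral M \<A> (\<lambda>c x u v w. wedge12 (?R a) (ext_d (?R b)) c x u v w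
        + - wedge12 (?I a) (ext_d (?I b)) c x u v w)"
      by (rule manifold_integral_cong)
         (simp only: coeff3_def wedge12_def ext_d_map[OF bounded_linear_Re b]
            ext_d_map[OF bounded_linear_Im b], simp add: map_form_def)
    also have "\<dots> = manifold_integral M \<A> (wedge12 (?R a) (ext_d (?R b)))
       + manifold_integral M \<A> (\<lambda>c x u v w. - wedge12 (?I a) (ext_d (?I b)) c x u v w)"
      by (rule manifold_integral_add[OF c1])
         (use c2 in \<open>auto simp: coeff3_def intro!: continuous_on_minus\<close>)
    also have "manifold_integral M \<A> (\<lambda>c x u v w. - wedge12 (?I a) (ext_d (?I b)) c x u v w)
       = - manifold_integral M \<A> (wedge12 (?I a) (ext_d (?I b)))"
      by (rule neg[OF c2])
    finally show ?thesis by simp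
  qed
  have Im: "Im (manifold_integral M \<A> (wedge12 a (ext_d b)))
      = manifold_integral M \<A> (wedge12 (?R a) (ext_d (?I b))) + manifold_integral M \<A> (wedge12 (?I a) (ext_d (?R b)))"
    if a: "one_form \<A> a" and b: "one_form \<A> b" for a b :: "('a, complex) form1"
  proof -
    have "Im (manifold_integral M \<A> (wedge12 a (ext_d b)))
      = manifold_integral M \<A> (\<lambda>c x u v w. Im (wedge12 a (ext_d b) c x u v w))"
      by (rule manifold_integral_map[OF bounded_linear_Im continuous_on_wedge_ext_d[OF a b], symmetric])
    also have "\<dots> = manifold_integral M \<A> (\<lambda>c x u v w. wedge12 (?R a) (ext_d (?I b)) c x u v w
        + wedge12 (?I a) (ext_d (?R b)) c x u v w)"
      by (rule manifold_integral_cong)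
         (simp only: coeff3_def wedge12_def ext_d_map[OF bounded_linear_Re b]
            ext_d_map[OF bounded_linear_Im b], simp add: map_form_def)
    also have "\<dots> = manifold_integral M \<A> (wedge12 (?R a) (ext_d (?I b)))
       + manifold_integral M \<A> (wedge12 (?I a) (ext_d (?R b)))"
      by (intro manifold_integral_add continuous_on_wedge_ext_d forms a b)
    finally show ?thesis .
  qed
  show ?thesis
    by (rule complex_eqI)
       (simp_all add: Re[OF a b] Re[OF b a] Im[OF a b] Im[OF b a] stokes_real[OF forms(1)[OF a] forms(1)[OF b]]
          stokes_real[OF forms(2)[OF a] forms(2)[OF b]] stokes_real[OF forms(1)[OF a] forms(2)[OF b]]
          stokes_real[OF forms(2)[OF a] forms(1)[OF b]])
qed

text \<open>By Stokes' theorem, \<open>a \<and> da\<close> changes by \<open>2 h \<and> da + h \<and> dh\<close> up to an exact form when \<open>a\<close>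
  is replaced by \<open>a + h\<close>.\<close>

lemma manifold_integral_shift:
  fixes a h :: "('a, 'b::{banach, real_normed_field, euclidean_space}) form1"
  assumes a: "one_form \<A> a" and h: "one_form \<A> h"
    and stokes: "manifold_integral M \<A> (wedge12 a (ext_d h)) = manifold_integral M \<A> (wedge12 h (ext_d a))"
    and hh: "\<And>c x. c \<in> \<A> \<Longrightarrow> x \<in> chart_img c \<Longrightarrow> coeff3 (wedge12 h (ext_d h)) c x = 0"
    and ha: "(\<forall>c\<in>\<A>. \<forall>x\<in>chart_img c. coeff3 (wedge12 h (ext_d a)) c x = 0)
       \<or> (\<forall>c\<in>\<A>. \<forall>x\<in>chart_img c. coeff3 (wedge12 a (ext_d h)) c x = 0)"
  shows "manifold_integral M \<A> (wedge12 (add_form a h) (ext_d (add_form a h)))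
    = manifold_integral M \<A> (wedge12 a (ext_d a))"
proof -
  have z: "manifold_integral M \<A> \<Omega> = 0"
    if "\<And>c x. c \<in> \<A> \<Longrightarrow> x \<in> chart_img c \<Longrightarrow> coeff3 \<Omega> c x = 0" for \<Omega> :: "('a, 'b) form3"
  proof -
    have "manifold_integral M \<A> \<Omega> = manifold_integral M \<A> (\<lambda>c x u v w. 0)"
      by (rule manifold_integral_cong) (simp add: that, simp add: coeff3_def)
    also have "\<dots> = 0" unfolding manifold_integral_eq by (simp add: coeff3_def)
    finally show ?thesis .
  qed
  have z1: "manifold_integral M \<A> (wedge12 h (ext_d a)) = 0"
    using ha
  proof
    assume "\<forall>c\<in>\<A>. \<forall>x\<in>chart_img c. coeff3 (wedge12 h (ext_d a)) c x = 0"
    then show ?thesis by (intro z) auto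
  next
    assume "\<forall>c\<in>\<A>. \<forall>x\<in>chart_img c. coeff3 (wedge12 a (ext_d h)) c x = 0"
    then have "manifold_integral M \<A> (wedge12 a (ext_d h)) = 0" by (intro z) auto
    then show ?thesis using stokes by simp
  qed
  have "manifold_integral M \<A> (wedge12 (add_form a h) (ext_d (add_form a h)))
    = manifold_integral M \<A> (\<lambda>c x u v w. wedge12 a (ext_d a) c x u v w
        + (wedge12 a (ext_d h) c x u v w + wedge12 h (ext_d a) c x u v w))"
  proof (rule manifold_integral_cong)
    fix c x assume c: "c \<in> \<A>" "x \<in> chart_img c"
    have "coeff3 (wedge12 (add_form a h) (ext_d (add_form a h))) c x
      = coeff3 (\<lambda>c x u v w. wedge12 a (ext_d a) c x u v w
        + (wedge12 a (ext_d h) c x u v w + wedge12 h (ext_d a) c x u v w)) c x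
        + coeff3 (wedge12 h (ext_d h)) c x"
      unfolding coeff3_def wedge12_def ext_d_add[OF a h c] by (simp add: add_form_def algebra_simps)
    then show "coeff3 (wedge12 (add_form a h) (ext_d (add_form a h))) c x
      = coeff3 (\<lambda>c x u v w. wedge12 a (ext_d a) c x u v w
        + (wedge12 a (ext_d h) c x u v w + wedge12 h (ext_d a) c x u v w)) c x"
      using hh[OF c] by simp
  qed
  also have "\<dots> = manifold_integral M \<A> (wedge12 a (ext_d a))
     + manifold_integral M \<A> (\<lambda>c x u v w. wedge12 a (ext_d h) c x u v w + wedge12 h (ext_d a) c x u v w)"
  proof (rule manifold_integral_add)
    fix c assume "c \<in> \<A>"
    have "continuous_on (chart_img c) (\<lambda>x. coeff3 (wedge12 a (ext_d h)) c x + coeff3 (wedge12 h (ext_d a)) c x)"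
      by (intro continuous_on_add continuous_on_wedge_ext_d a h \<open>c \<in> \<A>\<close>)
    then show "continuous_on (chart_img c)
       (coeff3 (\<lambda>c x u v w. wedge12 a (ext_d h) c x u v w + wedge12 h (ext_d a) c x u v w) c)"
      by (simp add: coeff3_def)
  qed (rule continuous_on_wedge_ext_d[OF a a])
  also have "manifold_integral M \<A> (\<lambda>c x u v w. wedge12 a (ext_d h) c x u v w + wedge12 h (ext_d a) c x u v w)
     = manifold_integral M \<A> (wedge12 a (ext_d h)) + manifold_integral M \<A> (wedge12 h (ext_d a))"
    by (intro manifold_integral_add continuous_on_wedge_ext_d a h)
  finally show ?thesis using stokes z1 by simp
qed

end

section \<open>The volume of the vector field\<close>

text \<open>The part of a Cartan structure that is left after forgetting the vector field: a coframe that
  satisfies the structure equations. Unlike the vector field, with \<open>\<alpha>(X) = 1\<close>, it is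
  preserved by the change of sign in \<open>cartan_frame_flip\<close>.\<close>

locale cartan_frame = closed_3manifold M \<A>
  for M :: "'a topology" and \<A> :: "'a chart set" +
  fixes w1 w2 al :: "('a, real) form1"
  assumes w1: "one_form \<A> w1" and w2: "one_form \<A> w2" and al: "one_form \<A> al"
    and d_w1: "field_eq \<A> (ext_d w1) (wedge11 w2 al)"
    and d_w2: "field_eq \<A> (ext_d w2) (wedge11 al w1)"
    and frame: "\<And>c x. c \<in> \<A> \<Longrightarrow> x \<in> chart_img c \<Longrightarrow> triple (w1 c x) (w2 c x) (al c x) e1 e2 e3 \<noteq> 0"
begin

lemma d_w1_eq: "c \<in> \<A> \<Longrightarrow> x \<in> chart_img c \<Longrightarrow> ext_d w1 c x u v = w2 c x u * al c x v - w2 c x v * al c x u"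
  and d_w2_eq: "c \<in> \<A> \<Longrightarrow> x \<in> chart_img c \<Longrightarrow> ext_d w2 c x u v = al c x u * w1 c x v - al c x v * w1 c x u"
  using d_w1 d_w2 by (simp_all add: field_eq_def wedge11_def)

text \<open>Apply \<open>d(d\<omega>\<^sub>i) = 0\<close> to the structure equations.\<close>

lemma w1_d_al: "c \<in> \<A> \<Longrightarrow> x \<in> chart_img c \<Longrightarrow> coeff3 (wedge12 w1 (ext_d al)) c x = 0"
  and w2_d_al: "c \<in> \<A> \<Longrightarrow> x \<in> chart_img c \<Longrightarrow> coeff3 (wedge12 w2 (ext_d al)) c x = 0"
proof -
  assume c: "c \<in> \<A>" "x \<in> chart_img c"
  have "coeff3 (wedge12 w1 (ext_d al)) c x = coeff3 (wedge12 al (ext_d w1)) c x"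
    by (rule ext_d_ext_d[OF w2 al w1 d_w2 c])
  also have "\<dots> = 0" unfolding coeff3_def wedge12_def d_w1_eq[OF c] by (simp add: algebra_simps)
  finally show "coeff3 (wedge12 w1 (ext_d al)) c x = 0" .
  have "coeff3 (wedge12 al (ext_d w2)) c x = coeff3 (wedge12 w2 (ext_d al)) c x"
    by (rule ext_d_ext_d[OF w1 w2 al d_w1 c])
  moreover have "coeff3 (wedge12 al (ext_d w2)) c x = 0"
    unfolding coeff3_def wedge12_def d_w2_eq[OF c] by (simp add: algebra_simps)
  ultimately show "coeff3 (wedge12 w2 (ext_d al)) c x = 0" by simp
qed

context
  fixes X :: "'a vfield"
  assumes w1_X: "field_eq \<A> (pair1 w1 X) (\<lambda>c x. 0)" and w2_X: "field_eq \<A> (pair1 w2 X) (\<lambda>c x. 0)"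
    and al_X: "field_eq \<A> (pair1 al X) (\<lambda>c x. 1)"
begin

lemma pairs: "c \<in> \<A> \<Longrightarrow> x \<in> chart_img c \<Longrightarrow> w1 c x (X c x) = 0"
    "c \<in> \<A> \<Longrightarrow> x \<in> chart_img c \<Longrightarrow> w2 c x (X c x) = 0"
    "c \<in> \<A> \<Longrightarrow> x \<in> chart_img c \<Longrightarrow> al c x (X c x) = 1"
  using w1_X w2_X al_X by (simp_all add: field_eq_def pair1_def)

text \<open>In dimension 3, a 3-form is a multiple of \<open>w1 \<and> w2 \<and> al\<close> at each point, and the contraction of the
  latter with \<open>X\<close> is \<open>w1 \<and> w2 \<noteq> 0\<close>. So a 3-form that is annihilated by \<open>X\<close> vanishes.\<close>

lemma wedge_eq_0:
  assumes c: "c \<in> \<A>" "x \<in> chart_img c" and "linear s" "s (X c x) = 0"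
    and "\<And>u. linear (\<sigma> u)" "\<And>u v. \<sigma> u v = - \<sigma> v u" "\<And>v. \<sigma> (X c x) v = 0"
  shows "s e1 * \<sigma> e2 e3 + s e2 * \<sigma> e3 e1 + s e3 * \<sigma> e1 e2 = (0::real)"
proof -
  note lin = one_form_linear[OF w1 c] one_form_linear[OF w2 c] one_form_linear[OF al c]
  have "\<exists>v w. w1 c x v * w2 c x w - w1 c x w * w2 c x v \<noteq> 0"
  proof (rule ccontr)
    assume "\<nexists>v w. w1 c x v * w2 c x w - w1 c x w * w2 c x v \<noteq> 0"
    then have p: "w1 c x v * w2 c x w = w1 c x w * w2 c x v" for v w by simp
    have "triple (w1 c x) (w2 c x) (al c x) e1 e2 e3 = 0"
      unfolding triple_def using p[of e1 e2] p[of e2 e3] p[of e3 e1] by algebra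
    then show False using frame[OF c] by simp
  qed
  then obtain v w where vw: "w1 c x v * w2 c x w - w1 c x w * w2 c x v \<noteq> 0" by blast
  have "triple (w1 c x) (w2 c x) (al c x) (X c x) v w = w1 c x v * w2 c x w - w1 c x w * w2 c x v"
    using pairs[OF c] by (simp add: triple_def)
  moreover have "(s e1 * \<sigma> e2 e3 + s e2 * \<sigma> e3 e1 + s e3 * \<sigma> e1 e2)
      * triple (w1 c x) (w2 c x) (al c x) (X c x) v w = 0"
  proof -
    have "\<sigma> w (X c x) = 0" using assms(6)[of w "X c x"] assms(7)[of w] by simp
    then show ?thesis
      using wedge_proportional[OF lin assms(3,5,6), of "X c x" v w] assms(4,7) by simp
  qed
  ultimately show ?thesis using vw by simp
qed

text \<open>As \<open>w1 \<and> dal = 0\<close> and \<open>w1\<close> annihilates \<open>X\<close>, contraction with \<open>X\<close> gives \<open>w1 \<and> \<phi> = 0\<close> for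
  \<open>\<phi> = i\<^sub>X dal\<close>, and likewise for \<open>w2\<close>. A form proportional to two independent ones is zero.\<close>

lemma interior_d_al: 
  assumes c: "c \<in> \<A>" "x \<in> chart_img c" shows "ext_d al c x (X c x) v = 0"
proof -
  note lin = one_form_linear[OF w1 c] one_form_linear[OF w2 c] one_form_linear[OF al c]
  let ?\<phi> = "ext_d al c x (X c x)"
  have p: "s u * ?\<phi> v = s v * ?\<phi> u"
    if "linear s" "s (X c x) = 0" "s e1 * ext_d al c x e2 e3 + s e2 * ext_d al c x e3 e1 + s e3 * ext_d al c x e1 e2 = 0"
    for s u v
  proof -
    have "s (X c x) * ext_d al c x v u + s v * ext_d al c x u (X c x) + s u * ext_d al c x (X c x) v = 0"
      using wedge_proportional[OF lin that(1) ext_d_linear[OF al c] ext_d_antisym, of "X c x" v u] that(3)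
        frame[OF c] by simp
    then show ?thesis using that(2) ext_d_antisym[of al c x u "X c x"] by simp
  qed
  have p1: "w1 c x u * ?\<phi> v = w1 c x v * ?\<phi> u" for u v
    using p[OF lin(1) pairs(1)[OF c]] w1_d_al[OF c] by (simp add: coeff3_def wedge12_def)
  have p2: "w2 c x u * ?\<phi> v = w2 c x v * ?\<phi> u" for u v
    using p[OF lin(2) pairs(2)[OF c]] w2_d_al[OF c] by (simp add: coeff3_def wedge12_def)
  have "triple ?\<phi> (w2 c x) (al c x) e1 e2 e3 = 0"
    unfolding triple_def using p2[of e1 e2] p2[of e2 e3] p2[of e3 e1] by algebra
  moreover have "triple (w1 c x) ?\<phi> (al c x) e1 e2 e3 = 0"
    unfolding triple_def using p1[of e1 e2] p1[of e2 e3] p1[of e3 e1] by algebra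
  moreover have "triple (w1 c x) (w2 c x) ?\<phi> e1 e2 e3 = 0"
    unfolding triple_def using p1[of e1 e2] p1[of e2 e3] p1[of e3 e1] by algebra
  ultimately have "?\<phi> v * triple (w1 c x) (w2 c x) (al c x) e1 e2 e3 = 0"
    using triple_cramer[OF lin ext_d_linear[OF al c], of "X c x" v] by simp
  then show ?thesis using frame[OF c] by simp
qed

text \<open>The difference \<open>h\<close> of two admissible forms satisfies \<open>h(X) = 0\<close> and \<open>i\<^sub>X dh = 0\<close>, so \<open>h \<and> dh\<close> and
  \<open>h \<and> dal\<close> are annihilated by \<open>X\<close> and hence zero.\<close>

lemma vol_eq: "vol M \<A> X = manifold_integral M \<A> (wedge12 al (ext_d al))"
  unfolding vol_def
proof (rule the_equality)
  show "\<exists>\<beta>. one_form \<A> \<beta> \<and> field_eq \<A> (pair1 \<beta> X) (\<lambda>c x. 1) \<and>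
     field_eq \<A> (interior_prod X (ext_d \<beta>)) zero1 \<and>
     manifold_integral M \<A> (wedge12 al (ext_d al)) = manifold_integral M \<A> (wedge12 \<beta> (ext_d \<beta>))"
    using al al_X interior_d_al by (intro exI[of _ al]) (simp add: field_eq_def interior_prod_def fun_eq_iff)
next
  fix r :: real assume "\<exists>\<beta>. one_form \<A> \<beta> \<and> field_eq \<A> (pair1 \<beta> X) (\<lambda>c x. 1) \<and>
     field_eq \<A> (interior_prod X (ext_d \<beta>)) zero1 \<and> r = manifold_integral M \<A> (wedge12 \<beta> (ext_d \<beta>))"
  then obtain \<beta> where \<beta>: "one_form \<A> \<beta>" "field_eq \<A> (pair1 \<beta> X) (\<lambda>c x. 1)"
     "field_eq \<A> (interior_prod X (ext_d \<beta>)) zero1" "r = manifold_integral M \<A> (wedge12 \<beta> (ext_d \<beta>))"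
    by blast
  have m: "one_form \<A> (map_form uminus al)"
    by (rule one_form_map[OF bounded_linear_minus[OF bounded_linear_ident] al])
  define h where "h = add_form \<beta> (map_form uminus al)"
  have h: "one_form \<A> h" unfolding h_def by (rule one_form_add[OF \<beta>(1) m])
  have dh: "ext_d h c x u v = ext_d \<beta> c x u v - ext_d al c x u v" if "c \<in> \<A>" "x \<in> chart_img c" for c x u v
    unfolding h_def ext_d_add[OF \<beta>(1) m that]
      ext_d_map[OF bounded_linear_minus[OF bounded_linear_ident] al that] by simp
  have "\<beta> = add_form al h" by (simp add: h_def add_form_def map_form_def fun_eq_iff)
  have hX: "h c x (X c x) = 0" and dhX: "ext_d h c x (X c x) v = 0"
    if c: "c \<in> \<A>" "x \<in> chart_img c" for c x v
    using \<beta>(2,3) pairs(3)[OF c] interior_d_al[OF c] c unfolding dh[OF c]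
    by (simp_all add: h_def add_form_def map_form_def field_eq_def pair1_def interior_prod_def)
  have "manifold_integral M \<A> (wedge12 (add_form al h) (ext_d (add_form al h)))
    = manifold_integral M \<A> (wedge12 al (ext_d al))"
  proof (rule manifold_integral_shift[OF al h stokes_real[OF al h]])
    fix c x assume c: "c \<in> \<A>" "x \<in> chart_img c"
    show "coeff3 (wedge12 h (ext_d h)) c x = 0"
      unfolding coeff3_def wedge12_def
      by (rule wedge_eq_0[OF c one_form_linear[OF h c] hX[OF c] ext_d_linear[OF h c] ext_d_antisym dhX[OF c]])
  next
    have "coeff3 (wedge12 h (ext_d al)) c x = 0" if c: "c \<in> \<A>" "x \<in> chart_img c" for c x
      unfolding coeff3_def wedge12_def
      by (rule wedge_eq_0[OF c one_form_linear[OF h c] hX[OF c] ext_d_linear[OF al c] ext_d_antisym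
            interior_d_al[OF c]])
    then show "(\<forall>c\<in>\<A>. \<forall>x\<in>chart_img c. coeff3 (wedge12 h (ext_d al)) c x = 0) \<or>
      (\<forall>c\<in>\<A>. \<forall>x\<in>chart_img c. coeff3 (wedge12 al (ext_d h)) c x = 0)" by blast
  qed
  then show "r = manifold_integral M \<A> (wedge12 al (ext_d al))"
    using \<beta>(4) \<open>\<beta> = add_form al h\<close> by simp
qed

end

end

section \<open>The Bott invariant\<close>

context cartan_frame
begin

text \<open>In this section, \<open>\<theta>\<close> is \<open>w1 + i w2\<close> and \<open>\<theta>'\<close> is its conjugate.\<close>

definition "W1 = map_form complex_of_real w1"
definition "iW2 = map_form (\<lambda>r. \<i> * complex_of_real r) w2"
definition "iAl = map_form (\<lambda>r. \<i> * complex_of_real r) al"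
definition "\<theta> = add_form W1 iW2"
definition "\<theta>' = add_form W1 (map_form uminus iW2)"

lemma bounded_linear_i_of_real: "bounded_linear (\<lambda>r. \<i> * complex_of_real r)"
  by (rule bounded_linear_const_mult[OF bounded_linear_of_real])

lemma one_form_W1: "one_form \<A> W1" and one_form_iW2: "one_form \<A> iW2" and one_form_iAl: "one_form \<A> iAl"
  unfolding W1_def iW2_def iAl_def
  by (rule one_form_map[OF bounded_linear_of_real w1], rule one_form_map[OF bounded_linear_i_of_real w2],
      rule one_form_map[OF bounded_linear_i_of_real al])

lemma one_form_miW2: "one_form \<A> (map_form uminus iW2)"
  by (rule one_form_map[OF bounded_linear_minus[OF bounded_linear_ident] one_form_iW2])

lemma one_form_\<theta>: "one_form \<A> \<theta>" and one_form_\<theta>': "one_form \<A> \<theta>'"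
  unfolding \<theta>_def \<theta>'_def by (intro one_form_add one_form_W1 one_form_iW2 one_form_miW2)+

lemma \<theta>_eq: "\<theta> c x v = of_real (w1 c x v) + \<i> * of_real (w2 c x v)"
  and \<theta>'_eq: "\<theta>' c x v = of_real (w1 c x v) - \<i> * of_real (w2 c x v)"
  and iAl_eq: "iAl c x v = \<i> * of_real (al c x v)"
  by (simp_all add: \<theta>_def \<theta>'_def W1_def iW2_def iAl_def add_form_def map_form_def)

lemma d_iAl: "c \<in> \<A> \<Longrightarrow> x \<in> chart_img c \<Longrightarrow> ext_d iAl c x u v = \<i> * of_real (ext_d al c x u v)"
  unfolding iAl_def by (rule ext_d_map[OF bounded_linear_i_of_real al])

lemma d_W1: "c \<in> \<A> \<Longrightarrow> x \<in> chart_img c \<Longrightarrow> ext_d W1 c x u v = of_real (ext_d w1 c x u v)"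
  unfolding W1_def by (rule ext_d_map[OF bounded_linear_of_real w1])

lemma d_iW2: "c \<in> \<A> \<Longrightarrow> x \<in> chart_img c \<Longrightarrow> ext_d iW2 c x u v = \<i> * of_real (ext_d w2 c x u v)"
  unfolding iW2_def by (rule ext_d_map[OF bounded_linear_i_of_real w2])

lemma i_i: "\<i> * (\<i> * z) = - z"
  by (simp add: mult.assoc[symmetric])

lemma d_\<theta>:
  assumes "c \<in> \<A>" "x \<in> chart_img c"
  shows "ext_d \<theta> c x u v = iAl c x u * \<theta> c x v - iAl c x v * \<theta> c x u"
  unfolding \<theta>_def ext_d_add[OF one_form_W1 one_form_iW2 assms] d_W1[OF assms] d_iW2[OF assms]
    d_w1_eq[OF assms] d_w2_eq[OF assms]
  by (simp add: W1_def iW2_def iAl_def add_form_def map_form_def algebra_simps i_i)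

lemma d_\<theta>':
  assumes "c \<in> \<A>" "x \<in> chart_img c"
  shows "ext_d \<theta>' c x u v = - (iAl c x u * \<theta>' c x v - iAl c x v * \<theta>' c x u)"
  unfolding \<theta>'_def ext_d_add[OF one_form_W1 one_form_miW2 assms]
    ext_d_map[OF bounded_linear_minus[OF bounded_linear_ident] one_form_iW2 assms] d_W1[OF assms] d_iW2[OF assms]
    d_w1_eq[OF assms] d_w2_eq[OF assms]
  by (simp add: W1_def iW2_def iAl_def add_form_def map_form_def algebra_simps i_i)

lemma \<theta>'_d_iAl:
  assumes "c \<in> \<A>" "x \<in> chart_img c" shows "coeff3 (wedge12 \<theta>' (ext_d iAl)) c x = 0"
proof -
  have "coeff3 (wedge12 \<theta>' (ext_d iAl)) c x = \<i> * of_real (coeff3 (wedge12 w1 (ext_d al)) c x)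
      + of_real (coeff3 (wedge12 w2 (ext_d al)) c x)"
    unfolding coeff3_def wedge12_def d_iAl[OF assms] \<theta>'_eq by (simp add: algebra_simps i_i)
  then show ?thesis using w1_d_al[OF assms] w2_d_al[OF assms] by simp
qed

lemma frame_\<theta>:
  assumes "c \<in> \<A>" "x \<in> chart_img c" shows "triple (\<theta> c x) (\<theta>' c x) (iAl c x) e1 e2 e3 \<noteq> 0"
proof -
  have "triple (\<theta> c x) (\<theta>' c x) (iAl c x) e1 e2 e3 = 2 * of_real (triple (w1 c x) (w2 c x) (al c x) e1 e2 e3)"
    unfolding triple_def \<theta>_eq \<theta>'_eq iAl_eq by (simp add: algebra_simps i_i)
  then show ?thesis using frame[OF assms] by simp
qed

text \<open>A transversely holomorphic structure \<open>\<omega> = k\<^sub>1 w1 + k\<^sub>2 w2\<close>. The last assumption says that the coefficient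
  \<open>f\<close> of \<open>\<theta>\<close> in \<open>\<omega> = f \<theta> + g \<theta>'\<close> is nowhere zero.\<close>

context
  fixes \<omega> :: "('a, complex) form1" and k1 k2 :: "'a chart \<Rightarrow> real^3 \<Rightarrow> complex"
  assumes \<omega>: "one_form \<A> \<omega>" and integrable: "field_eq \<A> (wedge12 \<omega> (ext_d \<omega>)) zero3"
    and k1: "scalar_field \<A> k1" and k2: "scalar_field \<A> k2"
    and \<omega>_eq: "\<And>c x v. c \<in> \<A> \<Longrightarrow> x \<in> chart_img c \<Longrightarrow>
      \<omega> c x v = k1 c x * of_real (w1 c x v) + k2 c x * of_real (w2 c x v)"
    and positive: "\<And>c x. c \<in> \<A> \<Longrightarrow> x \<in> chart_img c \<Longrightarrow> k1 c x - \<i> * k2 c x \<noteq> 0"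
begin

text \<open>These are \<open>f\<close> and the Beltrami coefficient \<open>\<mu> = g / f\<close>.\<close>

definition "f = (\<lambda>c x. (k1 c x - \<i> * k2 c x) * (1 / 2))"
definition "\<mu> = (\<lambda>c x. (k1 c x + \<i> * k2 c x) * inverse (k1 c x - \<i> * k2 c x))"

lemma scalar_field_f: "scalar_field \<A> f" and scalar_field_\<mu>: "scalar_field \<A> \<mu>"
  unfolding f_def \<mu>_def
  by (intro scalar_field_arith scalar_field_inverse scalar_field_const k1 k2 positive; assumption)+

lemma f_nonzero: "c \<in> \<A> \<Longrightarrow> x \<in> chart_img c \<Longrightarrow> f c x \<noteq> 0"
  using positive by (simp add: f_def)

text \<open>The normalised form \<open>\<omega> / f\<close>.\<close>

definition "\<omega>n = add_form \<theta> (scale_form \<mu> \<theta>')"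

lemma one_form_\<omega>n: "one_form \<A> \<omega>n"
  unfolding \<omega>n_def by (intro one_form_add one_form_scale one_form_\<theta> one_form_\<theta>' scalar_field_\<mu>)

lemma \<omega>_eq_scale: "c \<in> \<A> \<Longrightarrow> x \<in> chart_img c \<Longrightarrow> \<omega> c x v = scale_form f \<omega>n c x v"
  unfolding \<omega>_eq scale_form_def \<omega>n_def add_form_def \<theta>_eq \<theta>'_eq f_def \<mu>_def
  using positive[of c x] by (simp add: field_simps i_i)

lemma d_\<omega>n:
  assumes "c \<in> \<A>" "x \<in> chart_img c"
  shows "ext_d \<omega>n c x u v = iAl c x u * \<theta> c x v - iAl c x v * \<theta> c x u
    + (grad \<mu> c x u * \<theta>' c x v - grad \<mu> c x v * \<theta>' c x u
      - \<mu> c x * (iAl c x u * \<theta>' c x v - iAl c x v * \<theta>' c x u))"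
  unfolding \<omega>n_def ext_d_add[OF one_form_\<theta> one_form_scale[OF scalar_field_\<mu> one_form_\<theta>'] assms]
    ext_d_scale[OF scalar_field_\<mu> one_form_\<theta>' assms] d_\<theta>[OF assms] d_\<theta>'[OF assms]
  by (simp add: wedge11_def algebra_simps)

lemma d_\<omega>:
  assumes "c \<in> \<A>" "x \<in> chart_img c"
  shows "ext_d \<omega> c x u v = grad f c x u * \<omega>n c x v - grad f c x v * \<omega>n c x u + f c x * ext_d \<omega>n c x u v"
proof -
  have "ext_d \<omega> c x u v = ext_d (scale_form f \<omega>n) c x u v"
    by (rule ext_d_cong[OF _ \<omega> assms]) (rule \<omega>_eq_scale[OF assms(1)])
  then show ?thesis
    unfolding ext_d_scale[OF scalar_field_f one_form_\<omega>n assms] by (simp add: wedge11_def)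
qed

text \<open>The coefficient of \<open>\<theta>\<close> in \<open>d\<mu>\<close>.\<close>

definition "\<mu>\<^sub>\<theta> = (\<lambda>c x. triple (grad \<mu> c x) (\<theta>' c x) (iAl c x) e1 e2 e3
     / triple (\<theta> c x) (\<theta>' c x) (iAl c x) e1 e2 e3)"

lemma scalar_field_\<mu>\<^sub>\<theta>: "scalar_field \<A> \<mu>\<^sub>\<theta>"
  unfolding \<mu>\<^sub>\<theta>_def
  by (rule scalar_field_triple_ratio[OF one_form_grad[OF scalar_field_\<mu>] one_form_\<theta>' one_form_iAl
        one_form_\<theta> one_form_\<theta>' one_form_iAl frame_\<theta>])

text \<open>Formal integrability prescribes the derivative of \<open>\<mu>\<close> along the foliation, because
  \<open>\<omega> \<and> d\<omega> = f\<^sup>2 (2\<mu> - m) \<theta> \<and> \<theta>' \<and> i al\<close>, where \<open>m\<close> is the coefficient of \<open>i al\<close> in \<open>d\<mu>\<close>.\<close>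

lemma grad_\<mu>:
  assumes c: "c \<in> \<A>" "x \<in> chart_img c"
  shows "\<exists>b. \<forall>v. grad \<mu> c x v = \<mu>\<^sub>\<theta> c x * \<theta> c x v + b * \<theta>' c x v + 2 * \<mu> c x * iAl c x v"
proof -
  let ?T = "triple (\<theta> c x) (\<theta>' c x) (iAl c x) e1 e2 e3"
  define b where "b = triple (\<theta> c x) (grad \<mu> c x) (iAl c x) e1 e2 e3 / ?T"
  define m where "m = triple (\<theta> c x) (\<theta>' c x) (grad \<mu> c x) e1 e2 e3 / ?T"
  have g: "grad \<mu> c x v = \<mu>\<^sub>\<theta> c x * \<theta> c x v + b * \<theta>' c x v + m * iAl c x v" for v
    using triple_cramer[OF one_form_linear[OF one_form_\<theta> c] one_form_linear[OF one_form_\<theta>' c]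
        one_form_linear[OF one_form_iAl c] one_form_linear[OF one_form_grad[OF scalar_field_\<mu>] c], of v]
      frame_\<theta>[OF c]
    by (simp add: \<mu>\<^sub>\<theta>_def b_def m_def field_simps)
  have "coeff3 (wedge12 \<omega> (ext_d \<omega>)) c x = 0"
    using integrable c by (simp add: field_eq_def coeff3_def)
  moreover have "coeff3 (wedge12 \<omega> (ext_d \<omega>)) c x = f c x * f c x * ((2 * \<mu> c x - m) * ?T)"
    unfolding coeff3_def wedge12_def d_\<omega>[OF c] \<omega>_eq_scale[OF c] d_\<omega>n[OF c] g triple_def
    unfolding scale_form_def \<omega>n_def add_form_def by algebra
  ultimately have "m = 2 * \<mu> c x" using f_nonzero[OF c] frame_\<theta>[OF c] by simp
  then show ?thesis using g by blast
qed

definition "dlog = scale_form (\<lambda>c x. inverse (f c x)) (grad f)"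
definition "\<gamma> = scale_form (\<lambda>c x. - \<mu>\<^sub>\<theta> c x) \<theta>'"
definition "\<alpha>0 = add_form (add_form iAl dlog) \<gamma>"

lemma one_form_dlog: "one_form \<A> dlog"
  unfolding dlog_def by (intro one_form_scale one_form_grad scalar_field_inverse scalar_field_f f_nonzero)

lemma scalar_field_minus_\<mu>\<^sub>\<theta>: "scalar_field \<A> (\<lambda>c x. - \<mu>\<^sub>\<theta> c x)"
  by (rule scalar_field_map[OF bounded_linear_minus[OF bounded_linear_ident] scalar_field_\<mu>\<^sub>\<theta>])

lemma one_form_\<gamma>: "one_form \<A> \<gamma>"
  unfolding \<gamma>_def by (rule one_form_scale[OF scalar_field_minus_\<mu>\<^sub>\<theta> one_form_\<theta>'])

lemma one_form_base: "one_form \<A> (add_form iAl dlog)"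
  by (intro one_form_add one_form_iAl one_form_dlog)

lemma one_form_\<alpha>0: "one_form \<A> \<alpha>0"
  unfolding \<alpha>0_def by (intro one_form_add one_form_base one_form_\<gamma>)

lemma d_dlog: "c \<in> \<A> \<Longrightarrow> x \<in> chart_img c \<Longrightarrow> ext_d dlog c x u v = 0"
  unfolding dlog_def by (rule ext_d_log_deriv[OF scalar_field_f f_nonzero])

text \<open>With the value of \<open>d\<mu>\<close> from \<open>grad_\<mu>\<close>, the normalised form satisfies
  \<open>d(\<theta> + \<mu> \<theta>') = i al \<and> (\<theta> + \<mu> \<theta>') + \<mu>\<^sub>\<theta> \<theta> \<and> \<theta>'\<close>, and the last term is \<open>(- \<mu>\<^sub>\<theta> \<theta>') \<and> (\<theta> + \<mu> \<theta>')\<close>.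
  The factor \<open>f\<close> adds \<open>df/f\<close> to the connection form.\<close>

lemma d_\<omega>_\<alpha>0: "field_eq \<A> (ext_d \<omega>) (wedge11 \<alpha>0 \<omega>)"
  unfolding field_eq_def
proof (intro ballI ext)
  fix c x u v assume c: "c \<in> \<A>" "x \<in> chart_img c"
  obtain b where g: "grad \<mu> c x v = \<mu>\<^sub>\<theta> c x * \<theta> c x v + b * \<theta>' c x v + 2 * \<mu> c x * iAl c x v" for v
    using grad_\<mu>[OF c] by blast
  have l: "dlog c x v * f c x = grad f c x v" for v
    using f_nonzero[OF c] by (simp add: dlog_def scale_form_def)
  show "ext_d \<omega> c x u v = wedge11 \<alpha>0 \<omega> c x u v"
    unfolding wedge11_def d_\<omega>[OF c] \<omega>_eq_scale[OF c] d_\<omega>n[OF c] g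
    unfolding scale_form_def \<alpha>0_def \<omega>n_def \<gamma>_def add_form_def l[symmetric] by algebra
qed

text \<open>This holds because \<open>\<theta>' \<and> d\<theta>' = 0\<close>.\<close>

lemma \<gamma>_d_\<gamma>:
  assumes c: "c \<in> \<A>" "x \<in> chart_img c" shows "coeff3 (wedge12 \<gamma> (ext_d \<gamma>)) c x = 0"
proof -
  have d_\<gamma>: "ext_d \<gamma> c x u v = grad (\<lambda>c x. - \<mu>\<^sub>\<theta> c x) c x u * \<theta>' c x v - grad (\<lambda>c x. - \<mu>\<^sub>\<theta> c x) c x v * \<theta>' c x u
     + \<mu>\<^sub>\<theta> c x * (iAl c x u * \<theta>' c x v - iAl c x v * \<theta>' c x u)" for u v
    unfolding \<gamma>_def ext_d_scale[OF scalar_field_minus_\<mu>\<^sub>\<theta> one_form_\<theta>' c] d_\<theta>'[OF c]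
    by (simp add: wedge11_def algebra_simps)
  show ?thesis
    unfolding coeff3_def wedge12_def d_\<gamma> by (simp add: \<gamma>_def scale_form_def algebra_simps)
qed

text \<open>Two applications of \<open>manifold_integral_shift\<close> remove first \<open>- \<mu>\<^sub>\<theta> \<theta>'\<close> and then \<open>df/f\<close>. For the former, \<open>h \<and> da\<close>
  vanishes, for the latter \<open>a \<and> dh\<close>.\<close>

lemma integral_\<alpha>0:
  "manifold_integral M \<A> (wedge12 \<alpha>0 (ext_d \<alpha>0)) = - of_real (manifold_integral M \<A> (wedge12 al (ext_d al)))"
proof -
  have "manifold_integral M \<A> (wedge12 \<alpha>0 (ext_d \<alpha>0))
     = manifold_integral M \<A> (wedge12 (add_form iAl dlog) (ext_d (add_form iAl dlog)))"
    unfolding \<alpha>0_def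
  proof (rule manifold_integral_shift[OF one_form_base one_form_\<gamma> stokes_complex[OF one_form_base one_form_\<gamma>] \<gamma>_d_\<gamma>])
    have "coeff3 (wedge12 \<gamma> (ext_d (add_form iAl dlog))) c x = 0" if c: "c \<in> \<A>" "x \<in> chart_img c" for c x
    proof -
      have "coeff3 (wedge12 \<gamma> (ext_d (add_form iAl dlog))) c x = - \<mu>\<^sub>\<theta> c x * coeff3 (wedge12 \<theta>' (ext_d iAl)) c x"
        unfolding coeff3_def wedge12_def ext_d_add[OF one_form_iAl one_form_dlog c] d_dlog[OF c] \<gamma>_def
        by (simp add: scale_form_def algebra_simps)
      then show ?thesis using \<theta>'_d_iAl[OF c] by simp
    qed
    then show "(\<forall>c\<in>\<A>. \<forall>x\<in>chart_img c. coeff3 (wedge12 \<gamma> (ext_d (add_form iAl dlog))) c x = 0) \<or>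
      (\<forall>c\<in>\<A>. \<forall>x\<in>chart_img c. coeff3 (wedge12 (add_form iAl dlog) (ext_d \<gamma>)) c x = 0)" by blast
  qed
  also have "\<dots> = manifold_integral M \<A> (wedge12 iAl (ext_d iAl))"
  proof (rule manifold_integral_shift[OF one_form_iAl one_form_dlog stokes_complex[OF one_form_iAl one_form_dlog]])
    show "coeff3 (wedge12 dlog (ext_d dlog)) c x = 0" if "c \<in> \<A>" "x \<in> chart_img c" for c x
      unfolding coeff3_def wedge12_def d_dlog[OF that] by simp
    have "coeff3 (wedge12 iAl (ext_d dlog)) c x = 0" if "c \<in> \<A>" "x \<in> chart_img c" for c x
      unfolding coeff3_def wedge12_def d_dlog[OF that] by simp
    then show "(\<forall>c\<in>\<A>. \<forall>x\<in>chart_img c. coeff3 (wedge12 dlog (ext_d iAl)) c x = 0) \<or>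
      (\<forall>c\<in>\<A>. \<forall>x\<in>chart_img c. coeff3 (wedge12 iAl (ext_d dlog)) c x = 0)" by blast
  qed
  also have "\<dots> = manifold_integral M \<A> (\<lambda>c x u v w. - complex_of_real (wedge12 al (ext_d al) c x u v w))"
    by (rule manifold_integral_cong)
       (simp only: coeff3_def wedge12_def d_iAl iAl_eq, simp add: algebra_simps i_i)
  also have "\<dots> = - of_real (manifold_integral M \<A> (wedge12 al (ext_d al)))"
    by (rule manifold_integral_map[OF bounded_linear_minus[OF bounded_linear_of_real]
          continuous_on_wedge_ext_d[OF al al]])
  finally show ?thesis .
qed

lemma \<omega>_nonzero:
  assumes c: "c \<in> \<A>" "x \<in> chart_img c" shows "\<exists>v. \<omega> c x v \<noteq> 0"
proof (rule ccontr)
  assume "\<nexists>v. \<omega> c x v \<noteq> 0"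
  then have z: "k1 c x * of_real (w1 c x v) + k2 c x * of_real (w2 c x v) = 0" for v
    using \<omega>_eq[OF c] by simp
  let ?T = "complex_of_real (triple (w1 c x) (w2 c x) (al c x) e1 e2 e3)"
  have "k1 c x * ?T = 0" "k2 c x * ?T = 0"
    unfolding triple_def using z[of e1] z[of e2] z[of e3] by (simp_all, algebra+)
  then have "k1 c x = 0" "k2 c x = 0" using frame[OF c] by simp_all
  then show False using positive[OF c] by simp
qed

text \<open>Apply \<open>d(d\<omega>) = 0\<close> to \<open>d\<omega> = \<beta> \<and> \<omega>\<close>.\<close>

lemma \<omega>_d_connection:
  assumes "one_form \<A> \<beta>" "field_eq \<A> (ext_d \<omega>) (wedge11 \<beta> \<omega>)" "c \<in> \<A>" "x \<in> chart_img c"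
  shows "coeff3 (wedge12 \<omega> (ext_d \<beta>)) c x = 0"
proof -
  have "coeff3 (wedge12 \<omega> (ext_d \<beta>)) c x = coeff3 (wedge12 \<beta> (ext_d \<omega>)) c x"
    by (rule ext_d_ext_d[OF \<omega> assms(1) \<omega> assms(2-4)])
  also have "\<dots> = 0"
    using assms(2-4) by (simp add: field_eq_def coeff3_def wedge12_def wedge11_def algebra_simps)
  finally show ?thesis .
qed

text \<open>Two connection forms differ by a form \<open>h\<close> with \<open>h \<and> \<omega> = 0\<close>, that is, \<open>h = k \<omega>\<close> at each point.
  Hence \<open>h \<and> \<sigma>\<close> vanishes whenever \<open>\<omega> \<and> \<sigma>\<close> does.\<close>

lemma bott_invariant_eq:
  "bott_invariant M \<A> \<omega> = - of_real (manifold_integral M \<A> (wedge12 al (ext_d al)))"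
  unfolding bott_invariant_def
proof (rule the_equality)
  show "\<exists>\<alpha>. one_form \<A> \<alpha> \<and> field_eq \<A> (ext_d \<omega>) (wedge11 \<alpha> \<omega>) \<and>
     - of_real (manifold_integral M \<A> (wedge12 al (ext_d al))) = manifold_integral M \<A> (wedge12 \<alpha> (ext_d \<alpha>))"
    using one_form_\<alpha>0 d_\<omega>_\<alpha>0 integral_\<alpha>0 by (intro exI[of _ \<alpha>0]) simp
next
  fix z :: complex
  assume "\<exists>\<alpha>. one_form \<A> \<alpha> \<and> field_eq \<A> (ext_d \<omega>) (wedge11 \<alpha> \<omega>) \<and>
     z = manifold_integral M \<A> (wedge12 \<alpha> (ext_d \<alpha>))"
  then obtain \<beta> where \<beta>: "one_form \<A> \<beta>" "field_eq \<A> (ext_d \<omega>) (wedge11 \<beta> \<omega>)"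
    "z = manifold_integral M \<A> (wedge12 \<beta> (ext_d \<beta>))" by blast
  have m: "one_form \<A> (map_form uminus \<alpha>0)"
    by (rule one_form_map[OF bounded_linear_minus[OF bounded_linear_ident] one_form_\<alpha>0])
  define h where "h = add_form \<beta> (map_form uminus \<alpha>0)"
  have h: "one_form \<A> h" unfolding h_def by (rule one_form_add[OF \<beta>(1) m])
  have dh: "ext_d h c x u v = ext_d \<beta> c x u v - ext_d \<alpha>0 c x u v" if "c \<in> \<A>" "x \<in> chart_img c" for c x u v
    unfolding h_def ext_d_add[OF \<beta>(1) m that]
      ext_d_map[OF bounded_linear_minus[OF bounded_linear_ident] one_form_\<alpha>0 that] by simp
  have "\<beta> = add_form \<alpha>0 h" by (simp add: h_def add_form_def map_form_def fun_eq_iff)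
  have hw: "h c x u * \<omega> c x v = h c x v * \<omega> c x u" if "c \<in> \<A>" "x \<in> chart_img c" for c x u v
  proof -
    have "wedge11 \<beta> \<omega> c x u v = wedge11 \<alpha>0 \<omega> c x u v"
      using \<beta>(2) d_\<omega>_\<alpha>0 that by (simp add: field_eq_def)
    then show ?thesis by (simp add: h_def add_form_def map_form_def wedge11_def algebra_simps)
  qed
  have h_prop: "\<exists>k. \<forall>u. h c x u = k * \<omega> c x u" if c: "c \<in> \<A>" "x \<in> chart_img c" for c x
  proof -
    obtain v where v: "\<omega> c x v \<noteq> 0" using \<omega>_nonzero[OF c] by blast
    then show ?thesis
      using hw[OF c, of _ v] by (intro exI[of _ "h c x v / \<omega> c x v"]) (simp add: field_simps)
  qed
  have hd: "coeff3 (wedge12 h \<sigma>) c x = 0"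
    if c: "c \<in> \<A>" "x \<in> chart_img c" and "coeff3 (wedge12 \<omega> \<sigma>) c x = 0" for c x and \<sigma> :: "('a, complex) form2"
  proof -
    obtain k where "\<And>u. h c x u = k * \<omega> c x u" using h_prop[OF c] by blast
    then have "coeff3 (wedge12 h \<sigma>) c x = k * coeff3 (wedge12 \<omega> \<sigma>) c x"
      by (simp add: coeff3_def wedge12_def algebra_simps)
    then show ?thesis using that(3) by simp
  qed
  have "manifold_integral M \<A> (wedge12 (add_form \<alpha>0 h) (ext_d (add_form \<alpha>0 h)))
    = manifold_integral M \<A> (wedge12 \<alpha>0 (ext_d \<alpha>0))"
  proof (rule manifold_integral_shift[OF one_form_\<alpha>0 h stokes_complex[OF one_form_\<alpha>0 h]])
    fix c x assume c: "c \<in> \<A>" "x \<in> chart_img c"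
    have "coeff3 (wedge12 \<omega> (ext_d h)) c x
      = coeff3 (wedge12 \<omega> (ext_d \<beta>)) c x - coeff3 (wedge12 \<omega> (ext_d \<alpha>0)) c x"
      unfolding coeff3_def wedge12_def dh[OF c] by (simp add: algebra_simps)
    then have "coeff3 (wedge12 \<omega> (ext_d h)) c x = 0"
      using \<omega>_d_connection[OF \<beta>(1,2) c] \<omega>_d_connection[OF one_form_\<alpha>0 d_\<omega>_\<alpha>0 c] by simp
    then show "coeff3 (wedge12 h (ext_d h)) c x = 0" by (rule hd[OF c])
  next
    have "coeff3 (wedge12 h (ext_d \<alpha>0)) c x = 0" if c: "c \<in> \<A>" "x \<in> chart_img c" for c x
      by (rule hd[OF c \<omega>_d_connection[OF one_form_\<alpha>0 d_\<omega>_\<alpha>0 c]])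
    then show "(\<forall>c\<in>\<A>. \<forall>x\<in>chart_img c. coeff3 (wedge12 h (ext_d \<alpha>0)) c x = 0) \<or>
      (\<forall>c\<in>\<A>. \<forall>x\<in>chart_img c. coeff3 (wedge12 \<alpha>0 (ext_d h)) c x = 0)" by blast
  qed
  then show "z = - of_real (manifold_integral M \<A> (wedge12 al (ext_d al)))"
    using \<beta>(3) \<open>\<beta> = add_form \<alpha>0 h\<close> integral_\<alpha>0 by simp
qed

end

end

section \<open>The orientation of the transverse structure\<close>

context closed_3manifold
begin

text \<open>By continuity, a nowhere zero function has constant sign near each point.\<close>

lemma scalar_field_sgn:
  fixes s :: "'a chart \<Rightarrow> real^3 \<Rightarrow> real"
  assumes s: "scalar_field \<A> s" and nz: "\<And>c x. c \<in> \<A> \<Longrightarrow> x \<in> chart_img c \<Longrightarrow> s c x \<noteq> 0"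
  shows "scalar_field \<A> (\<lambda>c x. sgn (s c x))"
    and "c \<in> \<A> \<Longrightarrow> x \<in> chart_img c \<Longrightarrow> grad (\<lambda>c x. sgn (s c x)) c x v = 0"
proof -
  have loc: "\<exists>U k. open U \<and> x \<in> U \<and> (\<forall>y\<in>U. sgn (s c y) = k)"
    if c: "c \<in> \<A>" "x \<in> chart_img c" for c x
  proof -
    have cont: "continuous_on (chart_img c) (s c)"
      by (rule smooth_on_imp_continuous_on[OF scalar_field_smooth[OF s c(1)]])
    let ?V = "if s c x > 0 then {0<..} else {..<0::real}"
    have "open (chart_img c \<inter> s c -` ?V)"
      by (rule continuous_open_preimage[OF cont open_chart_img[OF c(1)]]) simp
    then show ?thesis
      using c nz[OF c] by (intro exI[of _ "chart_img c \<inter> s c -` ?V"] exI[of _ "sgn (s c x)"])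
        (auto split: if_splits)
  qed
  show "scalar_field \<A> (\<lambda>c x. sgn (s c x))"
  proof (rule scalar_fieldI)
    fix c assume c: "c \<in> \<A>"
    show "smooth_on (chart_img c) (\<lambda>x. sgn (s c x))"
    proof (rule smooth_on_locally)
      fix x assume "x \<in> chart_img c"
      then obtain U k where U: "open U" "x \<in> U" "\<forall>y\<in>U. sgn (s c y) = k" using loc[OF c] by blast
      then have "smooth_on U (\<lambda>y. sgn (s c y))"
        by (intro smooth_on_cong[OF smooth_on_const[of U k]]) auto
      then show "\<exists>U. open U \<and> x \<in> U \<and> smooth_on U (\<lambda>x. sgn (s c x))" using U by blast
    qed
  qed (simp add: scalar_field_natural[OF s])
  show "grad (\<lambda>c x. sgn (s c x)) c x v = 0" if c: "c \<in> \<A>" "x \<in> chart_img c" for c x v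
  proof -
    obtain U k where U: "open U" "x \<in> U" "\<forall>y\<in>U. sgn (s c y) = k" using loc[OF c] by blast
    have "frechet_derivative (\<lambda>y. k) (at x) = frechet_derivative (\<lambda>y. sgn (s c y)) (at x)"
      by (rule frechet_derivative_cong_open[OF U(1,2)]) (use U(3) in auto)
    then show ?thesis by (simp add: grad_def fun_eq_iff)
  qed
qed

end

context cartan_frame
begin

text \<open>A change of sign of \<open>w2\<close> and \<open>al\<close>, possibly only on some of the components of the manifold,
  replaces \<open>\<theta>\<close> by its conjugate there.\<close>

lemma cartan_frame_flip:
  assumes \<epsilon>: "scalar_field \<A> \<epsilon>"
    and grad: "\<And>c x v. c \<in> \<A> \<Longrightarrow> x \<in> chart_img c \<Longrightarrow> grad \<epsilon> c x v = 0"
    and sq: "\<And>c x. c \<in> \<A> \<Longrightarrow> x \<in> chart_img c \<Longrightarrow> \<epsilon> c x * \<epsilon> c x = 1"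
  shows "cartan_frame M \<A> w1 (scale_form \<epsilon> w2) (scale_form \<epsilon> al)"
    and "manifold_integral M \<A> (wedge12 (scale_form \<epsilon> al) (ext_d (scale_form \<epsilon> al)))
      = manifold_integral M \<A> (wedge12 al (ext_d al))"
proof -
  have d: "ext_d (scale_form \<epsilon> a) c x u v = \<epsilon> c x * ext_d a c x u v"
    if "one_form \<A> a" "c \<in> \<A>" "x \<in> chart_img c" for a c x u v
    using ext_d_scale[OF \<epsilon> that] grad[OF that(2,3)] by (simp add: wedge11_def)
  have sq': "\<epsilon> c x * (\<epsilon> c x * r) = r" if "c \<in> \<A>" "x \<in> chart_img c" for c x r
    using sq[OF that] by (simp add: mult.assoc[symmetric])
  show "cartan_frame M \<A> w1 (scale_form \<epsilon> w2) (scale_form \<epsilon> al)"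
  proof
    show "one_form \<A> w1" "one_form \<A> (scale_form \<epsilon> w2)" "one_form \<A> (scale_form \<epsilon> al)"
      using w1 w2 al one_form_scale[OF \<epsilon>] by blast+
    show "field_eq \<A> (ext_d w1) (wedge11 (scale_form \<epsilon> w2) (scale_form \<epsilon> al))"
      unfolding field_eq_def
      by (intro ballI ext) (simp add: d_w1_eq wedge11_def scale_form_def mult_ac sq')
    show "field_eq \<A> (ext_d (scale_form \<epsilon> w2)) (wedge11 (scale_form \<epsilon> al) w1)"
      unfolding field_eq_def
      by (intro ballI ext) (simp only: d[OF w2] d_w2_eq wedge11_def, simp add: scale_form_def algebra_simps)
    fix c x assume c: "c \<in> \<A>" "x \<in> chart_img c"
    have "triple (w1 c x) (scale_form \<epsilon> w2 c x) (scale_form \<epsilon> al c x) e1 e2 e3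
      = (\<epsilon> c x * \<epsilon> c x) * triple (w1 c x) (w2 c x) (al c x) e1 e2 e3"
      by (simp add: triple_def scale_form_def algebra_simps)
    then show "triple (w1 c x) (scale_form \<epsilon> w2 c x) (scale_form \<epsilon> al c x) e1 e2 e3 \<noteq> 0"
      using frame[OF c] sq[OF c] by simp
  qed
  show "manifold_integral M \<A> (wedge12 (scale_form \<epsilon> al) (ext_d (scale_form \<epsilon> al)))
      = manifold_integral M \<A> (wedge12 al (ext_d al))"
    by (rule manifold_integral_cong)
       (simp only: coeff3_def wedge12_def d[OF al], simp add: scale_form_def mult_ac sq')
qed

text \<open>Cramer's rule gives \<open>\<omega>\<close> as a combination of \<open>w1\<close>, \<open>w2\<close> and \<open>al\<close>; the coefficient of \<open>al\<close> is
  \<open>\<omega>(X) = 0\<close>. The real and imaginary parts of \<open>\<omega>\<close> are combinations of \<open>w1\<close> and \<open>w2\<close> with the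
  determinant \<open>Im (cnj k\<^sub>1 * k\<^sub>2)\<close>, which is not zero since they are independent.\<close>

lemma transversely_holomorphic_coefficients:
  assumes hol: "transversely_holomorphic \<A> X \<omega>"
    and w1_X: "field_eq \<A> (pair1 w1 X) (\<lambda>c x. 0)" and w2_X: "field_eq \<A> (pair1 w2 X) (\<lambda>c x. 0)"
    and al_X: "field_eq \<A> (pair1 al X) (\<lambda>c x. 1)"
  shows "\<exists>k1 k2. scalar_field \<A> k1 \<and> scalar_field \<A> k2 \<and> (\<forall>c\<in>\<A>. \<forall>x\<in>chart_img c.
      (\<forall>v. \<omega> c x v = k1 c x * of_real (w1 c x v) + k2 c x * of_real (w2 c x v)) \<and>
      Im (cnj (k1 c x) * k2 c x) \<noteq> 0)"
proof -
  have \<omega>: "one_form \<A> \<omega>" using hol by (simp add: transversely_holomorphic_def)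
  have indep: "\<And>a b. (\<forall>v. a * Re (\<omega> c x v) + b * Im (\<omega> c x v) = 0) \<Longrightarrow> a = 0 \<and> b = 0"
    and ker: "{v. Re (\<omega> c x v) = 0} \<inter> {v. Im (\<omega> c x v) = 0} = span {X c x}"
    if "c \<in> \<A>" "x \<in> chart_img c" for c x
    using hol that unfolding transversely_holomorphic_def by blast+
  define W2 where "W2 = map_form complex_of_real w2"
  define Al where "Al = map_form complex_of_real al"
  have W2: "one_form \<A> W2" and Al: "one_form \<A> Al"
    unfolding W2_def Al_def by (intro one_form_map bounded_linear_of_real w2 al)+
  have T: "triple (W1 c x) (W2 c x) (Al c x) e1 e2 e3 \<noteq> 0" if "c \<in> \<A>" "x \<in> chart_img c" for c x
  proof -
    have "triple (W1 c x) (W2 c x) (Al c x) e1 e2 e3 = of_real (triple (w1 c x) (w2 c x) (al c x) e1 e2 e3)"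
      by (simp add: triple_def W1_def W2_def Al_def map_form_def)
    then show ?thesis using frame[OF that] by simp
  qed
  define k1 where "k1 = (\<lambda>c x. triple (\<omega> c x) (W2 c x) (Al c x) e1 e2 e3
     / triple (W1 c x) (W2 c x) (Al c x) e1 e2 e3)"
  define k2 where "k2 = (\<lambda>c x. triple (W1 c x) (\<omega> c x) (Al c x) e1 e2 e3
     / triple (W1 c x) (W2 c x) (Al c x) e1 e2 e3)"
  have k: "scalar_field \<A> k1" "scalar_field \<A> k2"
    unfolding k1_def k2_def
    by (intro scalar_field_triple_ratio \<omega> one_form_W1 W2 Al T; assumption)+
  have eq: "\<omega> c x v = k1 c x * of_real (w1 c x v) + k2 c x * of_real (w2 c x v)"
    if c: "c \<in> \<A>" "x \<in> chart_img c" for c x v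
  proof -
    define T where "T = triple (W1 c x) (W2 c x) (Al c x) e1 e2 e3"
    define r where "r = triple (W1 c x) (W2 c x) (\<omega> c x) e1 e2 e3"
    have "T \<noteq> 0" using T[OF c] by (simp add: T_def)
    have cr: "\<omega> c x u * T = k1 c x * T * of_real (w1 c x u) + k2 c x * T * of_real (w2 c x u)
        + r * of_real (al c x u)" for u
      using triple_cramer[OF one_form_linear[OF one_form_W1 c] one_form_linear[OF W2 c]
          one_form_linear[OF Al c] one_form_linear[OF \<omega> c], of u] T[OF c]
      by (simp add: k1_def k2_def T_def r_def) (simp add: W1_def W2_def Al_def map_form_def)
    have "X c x \<in> span {X c x}" by (simp add: span_base)
    then have "\<omega> c x (X c x) = 0" using ker[OF c] by (auto simp: complex_eq_iff)
    moreover have "w1 c x (X c x) = 0" "w2 c x (X c x) = 0" "al c x (X c x) = 1"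
      using w1_X w2_X al_X c by (simp_all add: field_eq_def pair1_def)
    ultimately have "r = 0" using cr[of "X c x"] by simp
    then have "\<omega> c x v * T = (k1 c x * of_real (w1 c x v) + k2 c x * of_real (w2 c x v)) * T"
      using cr[of v] by (simp add: algebra_simps)
    then show ?thesis using \<open>T \<noteq> 0\<close> by simp
  qed
  have "Im (cnj (k1 c x) * k2 c x) \<noteq> 0" if c: "c \<in> \<A>" "x \<in> chart_img c" for c x
  proof
    assume "Im (cnj (k1 c x) * k2 c x) = 0"
    then have z: "Re (k1 c x) * Im (k2 c x) = Im (k1 c x) * Re (k2 c x)" by simp
    have re: "Re (\<omega> c x v) = Re (k1 c x) * w1 c x v + Re (k2 c x) * w2 c x v"
      and im: "Im (\<omega> c x v) = Im (k1 c x) * w1 c x v + Im (k2 c x) * w2 c x v" for v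
      by (simp_all add: eq[OF c])
    \<comment> \<open>As the determinant vanishes, these combinations of the real and imaginary parts of \<open>\<omega>\<close>, which
      eliminate \<open>w1\<close> and \<open>w2\<close>, respectively, are zero.\<close>
    have "Im (k1 c x) = 0 \<and> - Re (k1 c x) = 0"
      by (rule indep[OF c]) (simp add: re im algebra_simps, use z in algebra)
    moreover have "Im (k2 c x) = 0 \<and> - Re (k2 c x) = 0"
      by (rule indep[OF c]) (simp add: re im algebra_simps, use z in algebra)
    ultimately have "\<forall>v. 1 * Re (\<omega> c x v) + 0 * Im (\<omega> c x v) = 0" by (simp add: re im)
    then show False using indep[OF c, of 1 0] by simp
  qed
  with k eq show ?thesis by (intro exI[of _ k1] exI[of _ k2]) simp
qed

text \<open>After multiplying \<open>w2\<close> and \<open>al\<close> by the sign \<open>\<epsilon>\<close> of the determinant, the coefficient of \<open>\<theta>\<close> in \<open>\<omega>\<close>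
  is nowhere zero.\<close>

lemma bott_invariant_transversely_holomorphic:
  assumes hol: "transversely_holomorphic \<A> X \<omega>"
    and X: "field_eq \<A> (pair1 w1 X) (\<lambda>c x. 0)" "field_eq \<A> (pair1 w2 X) (\<lambda>c x. 0)"
      "field_eq \<A> (pair1 al X) (\<lambda>c x. 1)"
  shows "bott_invariant M \<A> \<omega> = - of_real (manifold_integral M \<A> (wedge12 al (ext_d al)))"
proof -
  obtain k1 k2 where k: "scalar_field \<A> k1" "scalar_field \<A> k2" and
    *: "\<forall>c\<in>\<A>. \<forall>x\<in>chart_img c.
      (\<forall>v. \<omega> c x v = k1 c x * of_real (w1 c x v) + k2 c x * of_real (w2 c x v)) \<and>
      Im (cnj (k1 c x) * k2 c x) \<noteq> 0"
    using transversely_holomorphic_coefficients[OF hol X] by auto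
  have eq: "\<omega> c x v = k1 c x * of_real (w1 c x v) + k2 c x * of_real (w2 c x v)"
    and nz: "Im (cnj (k1 c x) * k2 c x) \<noteq> 0" if "c \<in> \<A>" "x \<in> chart_img c" for c x v
    using bspec[OF bspec[OF * that(1)] that(2)] by simp_all
  define \<epsilon> where "\<epsilon> = (\<lambda>c x. sgn (Im (cnj (k1 c x) * k2 c x)))"
  have s: "scalar_field \<A> (\<lambda>c x. Im (cnj (k1 c x) * k2 c x))"
    by (intro scalar_field_map[OF bounded_linear_Im] scalar_field_arith(3)
        scalar_field_map[OF bounded_linear_cnj] k)
  have \<epsilon>: "scalar_field \<A> \<epsilon>" unfolding \<epsilon>_def by (rule scalar_field_sgn(1)[OF s nz])
  have grad: "grad \<epsilon> c x v = 0" if "c \<in> \<A>" "x \<in> chart_img c" for c x v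
    unfolding \<epsilon>_def by (rule scalar_field_sgn(2)[OF s nz that])
  have sq: "\<epsilon> c x * \<epsilon> c x = 1" if "c \<in> \<A>" "x \<in> chart_img c" for c x
    using nz[OF that] by (simp add: \<epsilon>_def sgn_if)
  interpret flip: cartan_frame M \<A> w1 "scale_form \<epsilon> w2" "scale_form \<epsilon> al"
    by (rule cartan_frame_flip[OF \<epsilon> grad sq])
  have "bott_invariant M \<A> \<omega>
    = - of_real (manifold_integral M \<A> (wedge12 (scale_form \<epsilon> al) (ext_d (scale_form \<epsilon> al))))"
  proof (rule flip.bott_invariant_eq[where ?k1.0=k1 and ?k2.0="\<lambda>c x. of_real (\<epsilon> c x) * k2 c x"])
    show "one_form \<A> \<omega>" "field_eq \<A> (wedge12 \<omega> (ext_d \<omega>)) zero3"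
      using hol by (simp_all add: transversely_holomorphic_def)
    show "scalar_field \<A> (\<lambda>c x. of_real (\<epsilon> c x) * k2 c x)"
      by (intro scalar_field_arith(3) scalar_field_map[OF bounded_linear_of_real] \<epsilon> k)
  next
    fix c x v assume c: "c \<in> \<A>" "x \<in> chart_img c"
    have "of_real (\<epsilon> c x) * of_real (\<epsilon> c x) = (1::complex)"
      using sq[OF c] by (metis of_real_1 of_real_mult)
    then show "\<omega> c x v = k1 c x * of_real (w1 c x v) + of_real (\<epsilon> c x) * k2 c x * of_real (scale_form \<epsilon> w2 c x v)"
      by (simp add: eq[OF c] scale_form_def)
  next
    fix c x assume c: "c \<in> \<A>" "x \<in> chart_img c"
    show "k1 c x - \<i> * (of_real (\<epsilon> c x) * k2 c x) \<noteq> 0"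
    proof
      assume "k1 c x - \<i> * (of_real (\<epsilon> c x) * k2 c x) = 0"
      \<comment> \<open>Then the determinant would have the sign opposite to \<open>\<epsilon>\<close>.\<close>
      then have k1: "k1 c x = \<i> * (of_real (\<epsilon> c x) * k2 c x)" by simp
      have "Im (cnj (k1 c x) * k2 c x) = - \<epsilon> c x * ((Re (k2 c x))\<^sup>2 + (Im (k2 c x))\<^sup>2)"
        unfolding k1 by (simp add: power2_eq_square algebra_simps)
      then have "\<epsilon> c x * Im (cnj (k1 c x) * k2 c x) = - (\<epsilon> c x * \<epsilon> c x) * ((Re (k2 c x))\<^sup>2 + (Im (k2 c x))\<^sup>2)"
        by simp
      also have "\<dots> \<le> 0" unfolding sq[OF c] by simp
      finally have "\<bar>Im (cnj (k1 c x) * k2 c x)\<bar> \<le> 0"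
        by (simp only: \<epsilon>_def mult.commute[of "sgn _"] mult_sgn_abs abs_sgn[symmetric])
      then show False using nz[OF c] by simp
    qed
  qed (rule k(1))
  then show ?thesis using cartan_frame_flip(2)[OF \<epsilon> grad sq] by simp
qed

end

theorem theorem8p3:
  fixes M :: "'a topology" and \<A> :: "'a chart set"
    and \<omega>1 \<omega>2 \<alpha> :: "('a, real) form1" and X :: "'a vfield"
    and \<omega>c :: "('a, complex) form1"
  assumes "closed_oriented_3manifold M \<A>"
    and "cartan_structure \<A> \<omega>1 \<omega>2"
    and "one_form \<A> \<alpha>"
    and "field_eq \<A> (ext_d \<omega>1) (wedge11 \<omega>2 \<alpha>)"
    and "field_eq \<A> (ext_d \<omega>2) (wedge11 \<alpha> \<omega>1)"
    and "vector_field \<A> X"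
    and "field_eq \<A> (pair1 \<omega>1 X) (\<lambda>c x. 0)"
    and "field_eq \<A> (pair1 \<omega>2 X) (\<lambda>c x. 0)"
    and "field_eq \<A> (pair1 \<alpha> X) (\<lambda>c x. 1)"
    and "transversely_holomorphic \<A> X \<omega>c"
  shows "complex_of_real (vol M \<A> X) = - bott_invariant M \<A> \<omega>c"
proof -
  interpret closed_3manifold M \<A> by (rule closed_3manifold.intro[OF assms(1)])
  interpret cartan_frame M \<A> \<omega>1 \<omega>2 \<alpha>
  proof
    show "one_form \<A> \<omega>1" "one_form \<A> \<omega>2"
      using assms(2) by (simp_all add: cartan_structure_def contact_form_def)
    fix c x assume c: "c \<in> \<A>" "x \<in> chart_img c"
    then obtain u v w where "wedge12 \<omega>1 (ext_d \<omega>1) c x u v w \<noteq> 0"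
      using assms(2) unfolding cartan_structure_def contact_form_def nowhere_zero3_def by blast
    moreover have "wedge12 \<omega>1 (ext_d \<omega>1) c x u v w = wedge12 \<omega>1 (wedge11 \<omega>2 \<alpha>) c x u v w"
      using assms(4) c by (simp add: wedge12_def field_eq_def)
    ultimately have "triple (\<omega>1 c x) (\<omega>2 c x) (\<alpha> c x) u v w \<noteq> 0" by (simp add: wedge12_wedge11)
    then show "triple (\<omega>1 c x) (\<omega>2 c x) (\<alpha> c x) e1 e2 e3 \<noteq> 0"
      using one_form_linear[OF \<open>one_form \<A> \<omega>1\<close> c] one_form_linear[OF \<open>one_form \<A> \<omega>2\<close> c]
        one_form_linear[OF assms(3) c] by (rule triple_nonzero_frame[rotated 3])
  qed (rule assms)+
  show ?thesis
    using vol_eq[OF assms(7-9)] bott_invariant_transversely_holomorphic[OF assms(10,7-9)] by simp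
qed

end
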